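(* Let $u,v>0$ be real numbers. Case $q=1$. Let $K=(\log 2\pi-\gamma+1)/2$, and put $S_1(x)=\sum_{k\ge1}R_1(kx)$ for $x>0$, where $$R_1(x)=\log x+\gamma-H(x)-\frac{\{x\}-1/2}{x}\qquad(x>0).$$ Then $$G^{(1)}_{u,v}=\frac1v\left(K+\frac12\log\frac vu\right)+\frac1u\,S_1(v/u).$$ Case $q=2$. Let $K_1=(\log 2\pi-\gamma+2)/2$ and $$K_2=\left(1-\frac{\gamma}{2}\right)\log 2\pi+\frac14\log^2 2\pi+\frac{\pi^2}{48}-\frac{\gamma^2}{4}-\gamma-\gamma_1+\frac32,$$ and put $S_2(x)=\sum_{k\ge1}R_2(kx)$ for $x>0$, where $$R_2(x)=\frac1x\left(\frac12\log 2\pi+1+\frac12\log x\right)+(2-\gamma)\log x-\frac12\log^2x+2\gamma+\gamma_1-3+\frac1x\sum_{1\le\ell\le x}\left[\left(1+\frac x\ell\right)\log\frac x\ell+2\left(1-\frac x\ell\right)\right]\qquad(x>0).$$ Then $$G^{(2)}_{u,v}=\frac1v\left(K_2+K_1\log\frac vu+\frac14\log^2\frac vu\right)+\frac1u\,S_2(v/u).$$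
   Context: For $q=1,2$ and $u,v>0$ the Gram kernel is $$G^{(q)}_{u,v}=\frac{1}{2\pi i}\int_{\Re(s)=1/2}u^{-s}\,v^{-(1-s)}\,\frac{\zeta(s)\zeta(1-s)}{s^q(1-s)^q}\,ds,$$ where $\zeta$ is the Riemann zeta function and the line is traversed upwards. $H(x)=\sum_{1\le k\le x}1/k$ for $x>0$ (sum over integers $k$; empty sums are $0$), $\{x\}=x-\lfloor x\rfloor$ is the fractional part, $\log^2 x=(\log x)^2$, and $\gamma=\gamma_0$ and $\gamma_1$ are the first two Stieltjes constants: $\zeta(s)=\frac1{s-1}+\gamma-\gamma_1(s-1)+O((s-1)^2)$ as $s\to1$. In sums over $\ell\le x$, $\ell$ runs over positive integers. The series $S_1(x)$, $S_2(x)$ converge absolutely for every $x>0$. *)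

theory Defs
  imports "HOL-Complex_Analysis.Complex_Analysis"
begin

(* The analytic continuation of the Dirichlet series to the complex plane without 1.
   The value at the pole is fixed as 0, so that the description is unique as a total function. *)
definition riemann_zeta :: "complex \<Rightarrow> complex" where
  "riemann_zeta = (THE f. f holomorphic_on - {1} \<and> f 1 = 0 \<and>
     (\<forall>s. Re s > 1 \<longrightarrow> (\<lambda>n. 1 / of_nat (Suc n) powr s) sums f s))"

(* riemann_zeta s = 1 / (s - 1) + (\<Sum>n. (-1)^n / n! * stieltjes n * (s - 1)^n) near s = 1;
   the Laurent coefficients are real, so that Re loses nothing. *)
definition stieltjes :: "nat \<Rightarrow> real" where
  "stieltjes n = (-1) ^ n * fact n * Re (fls_nth (laurent_expansion riemann_zeta 1) (int n))"

definition gram_integrand :: "nat \<Rightarrow> real \<Rightarrow> real \<Rightarrow> complex \<Rightarrow> complex" where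
  "gram_integrand q u v s =
     of_real u powr (- s) * of_real v powr (- (1 - s)) *
     (riemann_zeta s * riemann_zeta (1 - s)) / (s ^ q * (1 - s) ^ q)"

(* Upward parametrisation s = 1/2 + i t of the critical line; the factor \<i> is ds/dt. *)
definition gram_kernel :: "nat \<Rightarrow> real \<Rightarrow> real \<Rightarrow> complex" where
  "gram_kernel q u v =
     1 / (2 * of_real pi * \<i>) * (LBINT t. gram_integrand q u v (Complex (1/2) t) * \<i>)"

definition H :: "real \<Rightarrow> real" where
  "H x = (\<Sum>k\<in>{k::nat. 1 \<le> k \<and> real k \<le> x}. 1 / real k)"

definition K :: real where
  "K = (ln (2 * pi) - stieltjes 0 + 1) / 2"

definition R1 :: "real \<Rightarrow> real" where
  "R1 x = ln x + stieltjes 0 - H x - (frac x - 1/2) / x"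

definition S1 :: "real \<Rightarrow> real" where
  "S1 x = (\<Sum>k. R1 (real (Suc k) * x))"

definition K1 :: real where
  "K1 = (ln (2 * pi) - stieltjes 0 + 2) / 2"

definition K2 :: real where
  "K2 = (1 - stieltjes 0 / 2) * ln (2 * pi) + 1/4 * (ln (2 * pi))\<^sup>2 + pi\<^sup>2 / 48
        - (stieltjes 0)\<^sup>2 / 4 - stieltjes 0 - stieltjes 1 + 3/2"

definition R2 :: "real \<Rightarrow> real" where
  "R2 x = 1 / x * (1/2 * ln (2 * pi) + 1 + 1/2 * ln x)
        + (2 - stieltjes 0) * ln x - 1/2 * (ln x)\<^sup>2 + 2 * stieltjes 0 + stieltjes 1 - 3
        + 1 / x * (\<Sum>l\<in>{l::nat. 1 \<le> l \<and> real l \<le> x}.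
                     (1 + x / real l) * ln (x / real l) + 2 * (1 - x / real l))"

definition S2 :: "real \<Rightarrow> real" where
  "S2 x = (\<Sum>k. R2 (real (Suc k) * x))"

end

(*
Write s = 1/2 + it and h(y) = {e^y} e^(-y/2). The Fourier transform of h is -zeta(s)/s, so Fourier inversion
turns the first kernel into the correlation c(w) = int h(y) h(y+w) dy at w = log(v/u), up to the factor
(uv)^(-1/2). The inversion only needs that c is bounded, continuous and integrable with a nonnegative transform,
and it yields the integrability of |zeta(s)/s|^2 as well. Since 1/(s(1-s)) is the transform of e^(-|y|/2), the
second kernel is the convolution of c with e^(-|y|/2).

With x = e^w one has e^(w/2) c(w) = x int {t}{t/x}/t^2 dt over t > 0. The function R1 is an antiderivative of
({t} - 1/2)/t^2 that vanishes at infinity; this gives an explicit antiderivative of the integrand, whose limit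
is K + w/2 + x S1(x). For q = 2 put T = R2 + t R2'. Then t T' = -R1 and (t R2)' = T, so the two halves of the
convolution integral are sums of values of T and T - R2, and evenness of c disposes of the part near -infinity.
The remaining constant is the sum of 2 T(k) - R2(k), whose partial sums are expressible through the sums of 1/k,
log k, log k / k and log^2 k because the double sum over l <= k is symmetric. Their asymptotic constants are
gamma, zeta'(0), gamma_1 and zeta''(0), and the functional equation expands zeta'(0) and zeta''(0).
*)
theory Submission
  imports Defs "HOL-Probability.Probability" "HOL-Real_Asymp.Real_Asymp"
begin

section \<open>Euler-Maclaurin continuation of the zeta function\<close>

text \<open>\<open>riemann_zeta\<close> is a definite description over the punctured plane, so
  nothing can be said about it before one function with all its properties is exhibited. The
  Euler-Maclaurin limit supplies that function for \<open>Re s > -1\<close> only; the functional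
  equation fills the rest of the plane, and it is also what turns the Laurent data at 1 into the
  Taylor data at 0 that enter \<open>K2\<close>. The half-plane contains both 0 and 1 in its
  interior, so all asymptotic constants are derivatives of one holomorphic function and come from
  differentiating a single locally uniform limit. That limit carries a weight
  \<open>n powr b\<close>, because the remainders are later multiplied by factors as large as
  \<open>n * ln n\<close>, where mere convergence would not do. The decay of \<open>R1\<close>,
  \<open>T_aux\<close> and \<open>R2\<close> rests on the same remainders: their limits are known
  along the integers, where the finite sums are explicit, and bounds on their derivatives carry the
  decay to all positive reals.\<close>

text \<open>The Euler-Maclaurin approximations of \<open>(s - 1) \<zeta>(s)\<close>. The factor \<open>s - 1\<close> removes the pole,
  so that the approximations are entire and their limit is holomorphic for \<open>Re s > -1\<close>.\<close>

definition em_approx :: "nat \<Rightarrow> complex \<Rightarrow> complex" where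
  "em_approx n s = (s - 1) * ((\<Sum>k=1..n. of_nat k powr (-s)) - of_nat n powr (-s) / 2) + of_nat n powr (1 - s)"

definition zeta_reg :: "complex \<Rightarrow> complex" where
  "zeta_reg s = lim (\<lambda>n. em_approx n s)"

lemma em_approx_holomorphic [holomorphic_intros]: 
  "n > 0 \<Longrightarrow> em_approx n holomorphic_on A"
  unfolding em_approx_def by (intro holomorphic_intros) auto

text \<open>Integration by parts twice on the interval from \<open>n\<close> to
  \<open>n + 1\<close>. The weight \<open>(u - u^2) / 2\<close> vanishes at both ends and has second
  derivative \<open>-1\<close>, so the boundary terms form the trapezoidal rule. In the derivative
  of \<open>g\<close> the terms with exponent \<open>-s - 1\<close> cancel because
  \<open>u - 1/2\<close> is minus the derivative of the weight.\<close>

lemma em_approx_Suc_has_integral: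
  fixes s :: complex
  assumes n: "n > 0"
  shows "((\<lambda>u. (s - 1) * s * (s + 1) * of_real ((u - u\<^sup>2) / 2) * of_real (real n + u) powr (-s - 2))
           has_integral (em_approx (Suc n) s - em_approx n s)) {0..1}"
proof -
  define g where "g u = (s - 1) * (of_real ((u - u\<^sup>2) / 2) * (-s) * of_real (real n + u) powr (-s - 1)
       + of_real (u - 1/2) * of_real (real n + u) powr (-s)) + of_real (real n + u) powr (1 - s)" for u :: real
  have "((\<lambda>u. (s - 1) * s * (s + 1) * of_real ((u - u\<^sup>2) / 2) * of_real (real n + u) powr (-s - 2))
           has_integral (g 1 - g 0)) {0..1}"
  proof (rule fundamental_theorem_of_calculus)
    fix u :: real assume u: "u \<in> {0..1}"
    have nu: "real n + u > 0" using n u by auto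
    have D: "((\<lambda>u. of_real (real n + u) powr a) has_vector_derivative (a * of_real (real n + u) powr (a - 1)))
         (at u within {0..1})" for a :: complex
    proof -
      have "((\<lambda>z. (of_nat n + z) powr a) has_field_derivative (a * (of_nat n + of_real u) powr (a - 1)))
         (at (of_real u :: complex))"
        using nu by (auto intro!: derivative_eq_intros simp: complex_nonpos_Reals_iff)
      from has_vector_derivative_real_field[OF this]
      have "((\<lambda>u. (of_nat n + of_real u) powr a) has_vector_derivative (a * (of_nat n + of_real u) powr (a - 1))) (at u within {0..1})"
        by (simp add: has_vector_derivative_at_within)
      then show ?thesis by simp
    qed
    have pw: "of_real (real n + u) powr (-s - 1 - 1) = of_real (real n + u) powr (-s - 2)" by (simp add: algebra_simps)
    have pw2: "of_real (real n + u) powr (1 - s - 1) = of_real (real n + u) powr (-s)" by (simp add: algebra_simps)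
    have "((\<lambda>u. (u - u\<^sup>2) / 2) has_real_derivative (1/2 - u)) (at u within {0..1})"
      by (auto intro!: derivative_eq_intros simp: field_simps)
    then have D1: "((\<lambda>u. of_real ((u - u\<^sup>2) / 2)) has_vector_derivative (of_real (1/2 - u) :: complex)) (at u within {0..1})"
      by (rule has_vector_derivative_of_real)
    have "((\<lambda>u. u - 1/2) has_real_derivative 1) (at u within {0..1})"
      by (auto intro!: derivative_eq_intros)
    then have D2: "((\<lambda>u. of_real (u - 1/2)) has_vector_derivative (of_real 1 :: complex)) (at u within {0..1})"
      by (rule has_vector_derivative_of_real)
    have U: "(of_real (1/2 - u) :: complex) = - of_real (u - 1/2)" by simp
    have alg: "B = - U \<Longrightarrow> (s - 1) * (A * - s * ((- s - 1) * P2) + (A * 0 + B * - s) * P1 + (U * (- s * P1) + 1 * P0)) +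
      0 * X + (1 - s) * P0 = (s - 1) * s * (s + 1) * A * P2" for A B P0 P1 P2 X U :: complex
      by (simp add: algebra_simps)
    show "(g has_vector_derivative ((s - 1) * s * (s + 1) * of_real ((u - u\<^sup>2) / 2) * of_real (real n + u) powr (-s - 2))) (at u within {0..1})"
      using has_vector_derivative_add[OF has_vector_derivative_mult[OF has_vector_derivative_const[of "s-1"] has_vector_derivative_add[OF has_vector_derivative_mult[OF has_vector_derivative_mult[OF D1 has_vector_derivative_const[of "-s"]] D[of "-s-1"]] has_vector_derivative_mult[OF D2 D[of "-s"]]]] D[of "1-s"]]
      unfolding g_def pw pw2 of_real_1 by (rule has_vector_derivative_eq_rhs) (rule alg[OF U])
  qed simp
  also have "g 1 - g 0 = em_approx (Suc n) s - em_approx n s"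
    by (simp add: g_def em_approx_def algebra_simps add_divide_distrib)
  finally show ?thesis .
qed

lemma em_approx_Suc_bound:
  assumes n: "n > 0" and s: "Re s > -2"
  shows "norm (em_approx (Suc n) s - em_approx n s) \<le> norm ((s - 1) * s * (s + 1)) * real n powr (-Re s - 2)"
proof -
  have "norm (em_approx (Suc n) s - em_approx n s) \<le> (norm ((s - 1) * s * (s + 1)) * real n powr (-Re s - 2)) * measure lborel (cbox 0 (1::real))"
  proof (rule has_integral_bound)
    show "((\<lambda>u. (s - 1) * s * (s + 1) * of_real ((u - u\<^sup>2) / 2) * of_real (real n + u) powr (-s - 2))
           has_integral (em_approx (Suc n) s - em_approx n s)) (cbox 0 1)"
      using em_approx_Suc_has_integral[OF n] by simp
    fix u :: real assume "u \<in> cbox 0 1"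
    then have u: "0 \<le> u" "u \<le> 1" by auto
    have q: "\<bar>(u - u\<^sup>2) / 2\<bar> \<le> 1" using u by (auto simp: abs_le_iff power2_eq_square) (use mult_left_le_one_le[of u u] mult_nonneg_nonneg[of u u] in linarith)+
    have "norm (of_real (real n + u) powr (-s - 2)) = (real n + u) powr (- Re s - 2)"
      using u by (subst norm_powr_real_powr) auto
    also have "\<dots> \<le> real n powr (-Re s - 2)"
      using s n u by (intro powr_mono2') auto
    finally have *: "norm (of_real (real n + u) powr (-s - 2)) \<le> real n powr (-Re s - 2)" .
    have "norm ((s - 1) * s * (s + 1) * of_real ((u - u\<^sup>2) / 2) * of_real (real n + u) powr (-s - 2))
      = norm ((s - 1) * s * (s + 1)) * (\<bar>(u - u\<^sup>2) / 2\<bar> * norm (of_real (real n + u) powr (-s - 2)))"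
      by (simp only: norm_mult norm_of_real mult_ac)
    also have "\<dots> \<le> norm ((s - 1) * s * (s + 1)) * (1 * real n powr (-Re s - 2))"
      using * q by (intro mult_left_mono mult_mono) auto
    finally show "norm ((s - 1) * s * (s + 1) * of_real ((u - u\<^sup>2) / 2) * of_real (real n + u) powr (-s - 2))
       \<le> norm ((s - 1) * s * (s + 1)) * real n powr (-Re s - 2)" by simp
  qed auto
  then show ?thesis by simp
qed

text \<open>The weight is absorbed by the tail: \<open>n powr b\<close> is at most
  \<open>(i + n) powr b\<close>, so the weighted distance to the limit is bounded by a tail of a
  convergent series with exponent \<open>p - b > 1\<close>. That tail does not depend on
  \<open>x\<close>, hence the uniformity.\<close>

lemma weighted_tail_uniform_limit:
  fixes f :: "nat \<Rightarrow> 'b \<Rightarrow> 'c::banach"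
  assumes step: "\<And>n x. n > 0 \<Longrightarrow> x \<in> S \<Longrightarrow> norm (f (Suc n) x - f n x) \<le> C * real n powr (-p)"
    and b: "b \<ge> 0" "p - b > 1" and C: "C \<ge> 0"
  shows "x \<in> S \<Longrightarrow> (\<lambda>n. f n x) \<longlonglongrightarrow> lim (\<lambda>n. f n x)" 
    and "uniform_limit S (\<lambda>n x. real n powr b *\<^sub>R (f n x - lim (\<lambda>n. f n x))) (\<lambda>_. 0) sequentially"
proof -
  have sm: "summable (\<lambda>n. C * real n powr (-p))" using b
    by (intro summable_mult) (auto simp: summable_real_powr_iff)
  have smb: "summable (\<lambda>n. C * real n powr (b-p))" using b
    by (intro summable_mult) (auto simp: summable_real_powr_iff)
  have conv: "(\<lambda>n. f n x) \<longlonglongrightarrow> lim (\<lambda>n. f n x)" if x: "x \<in> S" for x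
  proof -
    have "summable (\<lambda>n. f (Suc n) x - f n x)"
      by (rule summable_comparison_test'[OF sm, of 1]) (use step x in auto)
    then have "convergent (\<lambda>n. \<Sum>i<n. f (Suc i) x - f i x)" by (simp add: summable_iff_convergent)
    then have "convergent (\<lambda>n. (\<Sum>i<n. f (Suc i) x - f i x) + f 0 x)" by (intro convergent_add convergent_const)
    then show ?thesis by (simp add: sum_lessThan_telescope[of "\<lambda>i. f i x"] convergent_LIMSEQ_iff)
  qed
  then show "x \<in> S \<Longrightarrow> (\<lambda>n. f n x) \<longlonglongrightarrow> lim (\<lambda>n. f n x)" by blast
  define T where "T n = (\<Sum>i. C * real (i + n) powr (b-p))" for n
  have T0: "T \<longlonglongrightarrow> 0" unfolding T_def by (rule suminf_exist_split2[OF smb])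
  have bd: "norm (real n powr b *\<^sub>R (f n x - lim (\<lambda>n. f n x))) \<le> T n" if n: "n > 0" and x: "x \<in> S" for n x
  proof -
    have part: "norm (real n powr b *\<^sub>R (f n x - f (n + m) x)) \<le> T n" for m
    proof -
      have "norm (f (n + m) x - f n x) = norm (\<Sum>i<m. f (Suc (i + n)) x - f (i + n) x)"
        using sum_lessThan_telescope[of "\<lambda>i. f (i + n) x" m] by (simp add: add.commute)
      also have "\<dots> \<le> (\<Sum>i<m. norm (f (Suc (i + n)) x - f (i + n) x))" by (rule norm_sum)
      also have "\<dots> \<le> (\<Sum>i<m. C * real (i + n) powr (-p))"
        by (intro sum_mono step) (use n x in auto)
      finally have "real n powr b * norm (f (n + m) x - f n x) \<le> real n powr b * (\<Sum>i<m. C * real (i + n) powr (-p))"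
        by (intro mult_left_mono) auto
      also have "\<dots> = (\<Sum>i<m. C * (real n powr b * real (i + n) powr (-p)))"
        by (simp add: sum_distrib_left mult_ac)
      also have "\<dots> \<le> (\<Sum>i<m. C * (real (i + n) powr b * real (i + n) powr (-p)))"
        by (intro sum_mono mult_left_mono mult_right_mono powr_mono2) (use n b C in auto)
      also have "\<dots> = (\<Sum>i<m. C * real (i + n) powr (b - p))"
        by (simp flip: powr_add)
      also have "\<dots> \<le> T n" unfolding T_def
        by (intro sum_le_suminf summable_ignore_initial_segment[OF smb]) (use C in auto)
      finally show ?thesis by (simp add: norm_minus_commute)
    qed
    have "(\<lambda>m. f (n + m) x) \<longlonglongrightarrow> lim (\<lambda>n. f n x)"
      using LIMSEQ_ignore_initial_segment[OF conv[OF x], of n] by (simp add: add.commute)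
    then have "(\<lambda>m. norm (real n powr b *\<^sub>R (f n x - f (n + m) x))) \<longlonglongrightarrow> norm (real n powr b *\<^sub>R (f n x - lim (\<lambda>n. f n x)))"
      by (intro tendsto_intros)
    then show ?thesis by (rule LIMSEQ_le_const2) (use part in auto)
  qed
  show "uniform_limit S (\<lambda>n x. real n powr b *\<^sub>R (f n x - lim (\<lambda>n. f n x))) (\<lambda>_. 0) sequentially"
  proof (rule uniform_limitI)
    fix e :: real assume "e > 0"
    with T0 have "eventually (\<lambda>n. T n < e) sequentially" by (simp add: order_tendstoD)
    then show "\<forall>\<^sub>F n in sequentially. \<forall>x\<in>S. dist (real n powr b *\<^sub>R (f n x - lim (\<lambda>n. f n x))) 0 < e"
      using eventually_gt_at_top[of 0]
    proof eventually_elim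
      case (elim n)
      then show ?case using bd[of n] by fastforce
    qed
  qed
qed

text \<open>Where \<open>Re s > a\<close>, the increments are of order
  \<open>n powr (- a - 2)\<close>, which leaves room for every weight with \<open>b < a + 1\<close>.
  Bounding \<open>norm s\<close> controls the cubic factor
  \<open>(s - 1) * s * (s + 1)\<close>.\<close>

lemma em_approx_limits:
  assumes a: "a > -1" and b: "0 \<le> b" "b < a + 1"
  shows "uniform_limit {s. Re s > a \<and> norm s < r} (\<lambda>n s. real n powr b *\<^sub>R (em_approx n s - zeta_reg s)) (\<lambda>_. 0) sequentially"
    (is ?A)
    and "Re s > -1 \<Longrightarrow> (\<lambda>n. em_approx n s) \<longlonglongrightarrow> zeta_reg s"
proof -
  have gen: "norm (em_approx (Suc n) s - em_approx n s) \<le> ((r + 1)^3) * real n powr (-(a+2))"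
    if n: "n > 0" and s: "s \<in> {s. Re s > a \<and> norm s < r}" and a: "a > -1" for n a s r
  proof -
    have r: "r > 0" using s by (smt (verit) mem_Collect_eq norm_ge_zero)
    have "norm (em_approx (Suc n) s - em_approx n s) \<le> norm ((s - 1) * s * (s + 1)) * real n powr (-Re s - 2)"
      by (rule em_approx_Suc_bound) (use n s a in auto)
    also have "norm ((s - 1) * s * (s + 1)) \<le> (r + 1) * (r + 1) * (r + 1)"
      unfolding norm_mult using norm_triangle_ineq4[of s 1] norm_triangle_ineq[of s 1] s r
      by (intro mult_mono) auto
    also have "real n powr (-Re s - 2) \<le> real n powr (-(a+2))"
      by (intro powr_mono) (use n s in auto)
    finally show ?thesis using r by (simp add: power3_eq_cube mult_left_mono mult_right_mono)
  qed
  show ?A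
  proof (cases "r > 0")
    case True
    show ?thesis unfolding zeta_reg_def
      by (rule weighted_tail_uniform_limit[where C = "(r + 1)^3" and p = "a + 2"]) (use gen True a b in auto)
  next
    case False
    then have "{s :: complex. Re s > a \<and> norm s < r} = {}" by (auto simp: not_less) (smt (verit) norm_ge_zero)
    then show ?thesis by (simp only:) simp
  qed
  show "(\<lambda>n. em_approx n s) \<longlonglongrightarrow> zeta_reg s" if s: "Re s > -1"
  proof -
    \<comment> \<open>\<open>Re s / 2 - 1/2\<close> is the midpoint between \<open>-1\<close> and
      \<open>Re s\<close>, so it serves as an abscissa strictly between the two.\<close>
    have "norm (em_approx (Suc n) z - em_approx n z) \<le> ((norm s + 1 + 1)^3) * real n powr (-(Re s/2 - 1/2+2))"
      if "n > 0" "z \<in> {z. Re z > Re s/2 - 1/2 \<and> norm z < norm s + 1}" for n z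
      using that by (rule gen) (use s in linarith)
    then show ?thesis unfolding zeta_reg_def
      by (rule weighted_tail_uniform_limit(1)[where b = 0 and S = "{z. Re z > Re s/2 - 1/2 \<and> norm z < norm s + 1}"])
        (use s in \<open>simp; linarith\<close>)+
  qed
qed

lemma zeta_reg_holomorphic: "zeta_reg holomorphic_on {s. Re s > -1}"
proof -
  have ul: "\<exists>d>0. cball z d \<subseteq> {s. Re s > -1} \<and> uniform_limit (cball z d) (\<lambda>n. em_approx (Suc n)) zeta_reg sequentially"
    if z: "Re z > -1" for z
  proof -
    \<comment> \<open>Half the distance from \<open>z\<close> to the line \<open>Re s = -1\<close>.
      The disc stays to the right of \<open>Re z / 2 - 1/2\<close>, and
      \<open>Re z / 4 - 3/4\<close> is the midpoint between that abscissa and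
      \<open>-1\<close>.\<close>
    define d where "d = Re z / 2 + 1 / 2"
    have d: "d > 0" unfolding d_def using z by linarith
    have zd: "Re z - d > Re z/4 - 3/4" "Re z - d > -1" unfolding d_def using z by linarith+
    have re: "Re w \<ge> Re z - d" "norm w \<le> norm z + d" if "w \<in> cball z d" for w
      using that abs_Re_le_cmod[of "z - w"] norm_triangle_ineq2[of w z] norm_minus_commute[of z w]
      unfolding mem_cball dist_norm minus_complex.simps by linarith+
    have sub: "cball z d \<subseteq> {s. Re s > Re z/4 - 3/4 \<and> norm s < norm z + d + 1}"
    proof
      fix w assume "w \<in> cball z d"
      from re[OF this] zd show "w \<in> {s. Re s > Re z/4 - 3/4 \<and> norm s < norm z + d + 1}"
        unfolding mem_Collect_eq by linarith
    qed
    have sub': "cball z d \<subseteq> {s. Re s > -1}"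
    proof
      fix w assume "w \<in> cball z d"
      from re[OF this] zd show "w \<in> {s. Re s > -1}"
        unfolding mem_Collect_eq by linarith
    qed
    have "uniform_limit {s. Re s > Re z/4 - 3/4 \<and> norm s < norm z + d + 1} (\<lambda>n s. real n powr 0 *\<^sub>R (em_approx n s - zeta_reg s)) (\<lambda>_. 0) sequentially"
      by (rule em_approx_limits; use z in linarith)
    then have "uniform_limit (cball z d) (\<lambda>n s. real n powr 0 *\<^sub>R (em_approx n s - zeta_reg s)) (\<lambda>_. 0) sequentially"
      by (rule uniform_limit_on_subset[OF _ sub])
    then have "uniform_limit (cball z d) (\<lambda>n s. real (Suc n) powr 0 *\<^sub>R (em_approx (Suc n) s - zeta_reg s)) (\<lambda>_. 0) sequentially"
      using filterlim_Suc by (rule filterlim_compose)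
    then have "uniform_limit (cball z d) (\<lambda>n. em_approx (Suc n)) zeta_reg sequentially"
      unfolding uniform_limit_iff by (simp add: dist_norm)
    moreover have "cball z d \<subseteq> {s. Re s > -1}" by (rule sub')
    ultimately show ?thesis using d by blast
  qed
  show ?thesis
  proof (rule holomorphic_uniform_sequence)
    show "open {s. Re s > -1}" by (simp add: open_halfspace_Re_gt)
    show "em_approx (Suc n) holomorphic_on {s. Re s > -1}" for n by (simp add: em_approx_holomorphic)
  qed (use ul in simp)
qed

text \<open>Locally uniform limits of holomorphic functions may be differentiated, and the weight is
  constant in \<open>s\<close>; hence every derivative converges at the same rate as the functions
  themselves.\<close>

lemma em_approx_deriv_limit:
  assumes a: "a > -1" "Re s > a" and b: "0 \<le> b" "b < a + 1"
  shows "(\<lambda>n. of_real (real n powr b) * ((deriv ^^ m) (em_approx n) s - (deriv ^^ m) zeta_reg s)) \<longlonglongrightarrow> 0"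
proof -
  define A where "A = {z. Re z > a \<and> norm z < norm s + 1}"
  have oA: "open A" "s \<in> A" unfolding A_def using a
    by (auto intro!: open_Collect_conj open_Collect_less continuous_intros)
  have hz: "zeta_reg holomorphic_on A" by (rule holomorphic_on_subset[OF zeta_reg_holomorphic]) (use a in \<open>auto simp: A_def\<close>)
  have "uniform_limit A (\<lambda>n s. real n powr b *\<^sub>R (em_approx n s - zeta_reg s)) (\<lambda>_. 0) sequentially"
    unfolding A_def by (rule em_approx_limits) (use a b in auto)
  then have "(\<lambda>n. (deriv ^^ m) (\<lambda>s. real n powr b *\<^sub>R (em_approx n s - zeta_reg s)) s) \<longlonglongrightarrow> (deriv ^^ m) (\<lambda>_. 0) s"
  proof (rule higher_deriv_complex_uniform_limit)
    show "\<forall>\<^sub>F n in sequentially. (\<lambda>s. real n powr b *\<^sub>R (em_approx n s - zeta_reg s)) holomorphic_on A"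
      using eventually_gt_at_top[of 0] by eventually_elim (intro holomorphic_intros hz, auto)
  qed (use oA in auto)
  then have "(\<lambda>n. (deriv ^^ m) (\<lambda>s. real n powr b *\<^sub>R (em_approx n s - zeta_reg s)) s) \<longlonglongrightarrow> 0" by simp
  moreover have "\<forall>\<^sub>F n in sequentially. (deriv ^^ m) (\<lambda>s. real n powr b *\<^sub>R (em_approx n s - zeta_reg s)) s
     = of_real (real n powr b) * ((deriv ^^ m) (em_approx n) s - (deriv ^^ m) zeta_reg s)"
    using eventually_gt_at_top[of 0]
  proof eventually_elim
    case (elim n)
    show ?case unfolding scaleR_conv_of_real
      by (subst higher_deriv_cmult[OF _ oA(2,1)], intro holomorphic_intros hz elim, subst higher_deriv_diff[OF _ _ oA])
         (auto intro!: holomorphic_intros hz elim)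
  qed
  ultimately show ?thesis by (rule Lim_transform_eventually)
qed

section \<open>Derivatives of the approximations at 1 and at 0\<close>

lemma DERIV_nat_powr_minus:
  fixes s :: complex
  assumes "k > 0"
  shows "((\<lambda>s. of_nat k powr (-s)) has_field_derivative (- (of_real (ln (real k)) * of_nat k powr (-s)))) (at s)"
proof -
  have "(\<lambda>s. of_nat k powr (-s)) = (\<lambda>s :: complex. exp (- s * of_real (ln (real k))))"
    using assms by (simp add: powr_def fun_eq_iff Ln_of_nat)
  moreover have "((\<lambda>s. exp (- s * of_real (ln (real k)))) has_field_derivative (exp (- s * of_real (ln (real k))) * (- of_real (ln (real k))))) (at s)"
    by (rule derivative_eq_intros refl | simp)+
  ultimately show ?thesis by (metis mult.commute mult_minus_left)
qed

lemma DERIV_nat_powr_one_minus: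
  fixes s :: complex
  assumes "n > 0"
  shows "((\<lambda>s. of_nat n powr (1-s)) has_field_derivative (- (of_real (ln (real n)) * of_nat n powr (1-s)))) (at s)"
proof -
  have "(\<lambda>s. of_nat n powr (1-s)) = (\<lambda>s :: complex. exp ((1 - s) * of_real (ln (real n))))"
    using assms by (simp add: powr_def fun_eq_iff Ln_of_nat)
  moreover have "((\<lambda>s. exp ((1 - s) * of_real (ln (real n)))) has_field_derivative (exp ((1 - s) * of_real (ln (real n))) * (- of_real (ln (real n))))) (at s)"
    by (rule derivative_eq_intros refl | simp)+
  ultimately show ?thesis by (metis mult.commute mult_minus_left)
qed

lemma DERIV_sum_nat_powr_minus:
  fixes s :: complex
  shows "((\<lambda>s. (\<Sum>k=1..n. of_nat k powr (-s))) has_field_derivative (\<Sum>k=1..n. - (of_real (ln (real k)) * of_nat k powr (-s)))) (at s)"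
  by (rule DERIV_sum) (auto intro!: DERIV_nat_powr_minus)

lemma em_approx_deriv:
  assumes n: "n > 0"
  shows "deriv (em_approx n) = (\<lambda>s. ((\<Sum>k=1..n. of_nat k powr (-s)) - of_nat n powr (-s) / 2)
     + (s - 1) * ((\<Sum>k=1..n. - (of_real (ln (real k)) * of_nat k powr (-s))) + of_real (ln (real n)) * of_nat n powr (-s) / 2)
     - of_real (ln (real n)) * of_nat n powr (1 - s))"
proof (rule ext, rule DERIV_imp_deriv)
  fix s
  show "(em_approx n has_field_derivative ((\<Sum>k=1..n. of_nat k powr (-s)) - of_nat n powr (-s) / 2)
     + (s - 1) * ((\<Sum>k=1..n. - (of_real (ln (real k)) * of_nat k powr (-s))) + of_real (ln (real n)) * of_nat n powr (-s) / 2)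
     - of_real (ln (real n)) * of_nat n powr (1 - s)) (at s)"
    unfolding em_approx_def
    by (rule derivative_eq_intros DERIV_sum_nat_powr_minus DERIV_nat_powr_minus DERIV_nat_powr_one_minus n refl | simp)+
qed

lemma em_approx_deriv2:
  assumes n: "n > 0"
  shows "(deriv ^^ 2) (em_approx n) s = 2 * ((\<Sum>k=1..n. - (of_real (ln (real k)) * of_nat k powr (-s))) + of_real (ln (real n)) * of_nat n powr (-s) / 2)
     + (s - 1) * ((\<Sum>k=1..n. of_real (ln (real k))^2 * of_nat k powr (-s)) - of_real (ln (real n))^2 * of_nat n powr (-s) / 2)
     + of_real (ln (real n))^2 * of_nat n powr (1 - s)"
proof -
  have DS2: "((\<lambda>s. (\<Sum>k=1..n. - (of_real (ln (real k)) * of_nat k powr (-s)))) has_field_derivative (\<Sum>k=1..n. of_real (ln (real k))^2 * of_nat k powr (-s))) (at s)" for s :: complex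
  proof (rule DERIV_sum)
    fix k assume "k \<in> {1..n}"
    then have "k > 0" by auto
    have "((\<lambda>s. - (of_real (ln (real k)) * of_nat k powr (-s))) has_field_derivative
      - (of_real (ln (real k)) * (- (of_real (ln (real k)) * of_nat k powr (-s))))) (at s)"
      by (intro DERIV_minus DERIV_cmult DERIV_nat_powr_minus \<open>k > 0\<close>)
    then show "((\<lambda>s. - (of_real (ln (real k)) * of_nat k powr (-s))) has_field_derivative of_real (ln (real k))^2 * of_nat k powr (-s)) (at s)"
      by (simp add: power2_eq_square mult_ac)
  qed
  have "deriv (deriv (em_approx n)) s = 2 * ((\<Sum>k=1..n. - (of_real (ln (real k)) * of_nat k powr (-s))) + of_real (ln (real n)) * of_nat n powr (-s) / 2)
     + (s - 1) * ((\<Sum>k=1..n. of_real (ln (real k))^2 * of_nat k powr (-s)) - of_real (ln (real n))^2 * of_nat n powr (-s) / 2)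
     + of_real (ln (real n))^2 * of_nat n powr (1 - s)"
    unfolding em_approx_deriv[OF n]
    apply (rule DERIV_imp_deriv)
    apply (rule derivative_eq_intros DERIV_sum_nat_powr_minus DS2 DERIV_nat_powr_minus DERIV_nat_powr_one_minus n refl | simp)+
    apply (simp add: power2_eq_square algebra_simps)
    done
  then show ?thesis by (simp add: numeral_2_eq_2)
qed

lemma em_approx_at_1: "n > 0 \<Longrightarrow> em_approx n 1 = 1"
  by (simp add: em_approx_def)

lemma powr_minus_1_nat: "n > 0 \<Longrightarrow> of_nat n powr (- 1 :: complex) = of_real (1 / real n)"
  by (simp add: powr_minus powr_of_real divide_inverse)

text \<open>At 1 the factor \<open>s - 1\<close> annihilates the sum that carries the additional
  logarithm. The first derivative there sees only harmonic numbers, and the second only the sum of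
  \<open>ln k / k\<close>.\<close>

lemma em_approx_deriv_at_1:
  assumes "n > 0"
  shows "deriv (em_approx n) 1 = of_real (harm n - 1 / (2 * real n) - ln (real n))"
proof -
  have "(\<Sum>k=1..n. of_nat k powr (-1)) = (\<Sum>k=1..n. of_real (1 / real k) :: complex)"
    by (intro sum.cong refl powr_minus_1_nat) auto
  then show ?thesis
    unfolding em_approx_deriv[OF assms] using assms
    by (simp add: powr_minus_1_nat harm_def inverse_eq_divide)
qed

lemma em_approx_deriv2_at_1:
  assumes "n > 0"
  shows "(deriv ^^ 2) (em_approx n) 1 = of_real (- 2 * (\<Sum>k=1..n. ln (real k) / real k) + ln (real n) / real n + ln (real n)^2)"
proof -
  have "(\<Sum>k=1..n. - (of_real (ln (real k)) * of_nat k powr (-1))) = (\<Sum>k=1..n. - of_real (ln (real k) / real k) :: complex)"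
    by (intro sum.cong refl, subst powr_minus_1_nat) auto
  then show ?thesis
    unfolding em_approx_deriv2[OF assms] using assms
    by (simp add: powr_minus_1_nat sum_negf)
qed

lemma em_approx_deriv_at_0:
  assumes "n > 0"
  shows "deriv (em_approx n) 0 = of_real (real n - 1/2 + (\<Sum>k=1..n. ln (real k)) - ln (real n) / 2 - ln (real n) * real n)"
  using assms unfolding em_approx_deriv[OF assms]
  by (simp add: sum_negf powr_of_real)

text \<open>At 0 the factor \<open>s - 1\<close> equals \<open>-1\<close>, so the sums of
  \<open>ln k\<close> and of its square both survive. This is where the sum of squares gets its
  asymptotics from.\<close>

lemma em_approx_deriv2_at_0:
  assumes "n > 0"
  shows "(deriv ^^ 2) (em_approx n) 0 = of_real (- 2 * (\<Sum>k=1..n. ln (real k)) + ln (real n)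
     - (\<Sum>k=1..n. ln (real k)^2) + ln (real n)^2 / 2 + ln (real n)^2 * real n)"
  using assms unfolding em_approx_deriv2[OF assms]
  by (simp add: sum_negf powr_of_real)

text \<open>For \<open>Re s > 1\<close> the two correction terms, of sizes
  \<open>n powr (1 - Re s)\<close> and \<open>n powr (- Re s)\<close>, vanish in the limit, and the
  partial sums of the Dirichlet series remain.\<close>

lemma zeta_reg_sums:
  assumes s: "Re s > 1"
  shows "(\<lambda>n. 1 / of_nat (Suc n) powr s) sums (zeta_reg s / (s - 1))"
proof -
  have s1: "s \<noteq> 1" using s by auto
  have z: "(\<lambda>n. of_nat n powr a :: complex) \<longlonglongrightarrow> 0" if "Re a < 0" for a
  proof (rule tendsto_norm_zero_cancel)
    have "(\<lambda>n. real n powr Re a) \<longlonglongrightarrow> 0"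
      using that by (intro tendsto_neg_powr filterlim_real_sequentially)
    moreover have "\<forall>\<^sub>F n in sequentially. real n powr Re a = norm (of_nat n powr a :: complex)"
      using eventually_gt_at_top[of 0] by eventually_elim (subst norm_powr_real_powr, auto)
    ultimately show "(\<lambda>n. norm (of_nat n powr a :: complex)) \<longlonglongrightarrow> 0" by (rule Lim_transform_eventually)
  qed
  have "(\<lambda>n. (em_approx n s - of_nat n powr (1 - s)) / (s - 1) + of_nat n powr (-s) / 2) \<longlonglongrightarrow> (zeta_reg s - 0) / (s - 1) + 0 / 2"
    by (intro tendsto_intros em_approx_limits(2)[of 0 0] z) (use s s1 in auto)
  also have "(\<lambda>n. (em_approx n s - of_nat n powr (1 - s)) / (s - 1) + of_nat n powr (-s) / 2) = (\<lambda>n. \<Sum>k=1..n. of_nat k powr (-s))"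
  proof -
    have "((s - 1) * (A - B / 2) + C - C) / (s - 1) + B / 2 = A" for A B C using s1 by simp
    then show ?thesis unfolding em_approx_def by blast
  qed
  also have "\<dots> = (\<lambda>n. \<Sum>k<n. 1 / of_nat (Suc k) powr s)"
  proof
    fix n :: nat
    show "(\<Sum>k=1..n. of_nat k powr (-s)) = (\<Sum>k<n. 1 / of_nat (Suc k) powr s)"
      by (rule sum.reindex_bij_witness[of _ Suc "\<lambda>k. k - 1"]) (auto simp: powr_minus divide_inverse)
  qed
  finally show ?thesis by (simp add: sums_def)
qed

section \<open>The functional equation\<close>

text \<open>Differentiating the reflection formula for \<open>Gamma\<close> expresses
  \<open>Digamma z - Digamma (1 - z)\<close> by the cotangent. The recurrence moves \<open>z\<close>
  to \<open>1 + z\<close>, which produces the \<open>1 / z\<close>, and the difference of the two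
  Digamma series is the series of simple fractions.\<close>

lemma cot_partial_fractions:
  fixes z :: complex
  assumes z: "z \<notin> \<int>"
  shows "(\<lambda>k. inverse (of_nat (Suc k) - z) - inverse (of_nat (Suc k) + z)) sums (1 / z - of_real pi * cos (of_real pi * z) / sin (of_real pi * z))"
proof -
  have z0: "z \<noteq> 0" using z by auto
  have npi: "z \<notin> \<int>\<^sub>\<le>\<^sub>0" "1 - z \<notin> \<int>\<^sub>\<le>\<^sub>0" "1 + z \<noteq> 0" "1 - z \<noteq> 0"
  proof -
    show "z \<notin> \<int>\<^sub>\<le>\<^sub>0" using z nonpos_Ints_Int by blast
    have "1 - z \<notin> \<int>" using z by (metis Ints_1 Ints_diff diff_diff_eq2 add_diff_cancel_left')
    then show "1 - z \<notin> \<int>\<^sub>\<le>\<^sub>0" "1 - z \<noteq> 0" using nonpos_Ints_Int by (blast, force)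
    show "1 + z \<noteq> 0" using z by (metis Ints_1 Ints_minus add_eq_0_iff)
  qed
  have sin0: "sin (of_real pi * z) \<noteq> 0" using z by (auto simp: sin_eq_0 Ints_def)
  have D1: "((\<lambda>z. Gamma z * Gamma (1 - z)) has_field_derivative 
      (Gamma z * Gamma (1 - z) * (Digamma z - Digamma (1 - z)))) (at z)"
    using npi by (auto intro!: derivative_eq_intros simp: algebra_simps)
  have D2: "((\<lambda>z. of_real pi / sin (of_real pi * z)) has_field_derivative 
      (- of_real pi * (of_real pi * cos (of_real pi * z)) / (sin (of_real pi * z))^2)) (at z)"
    using sin0 by (auto intro!: derivative_eq_intros simp: power2_eq_square)
  have eq: "Gamma z * Gamma (1 - z) * (Digamma z - Digamma (1 - z)) = - of_real pi * (of_real pi * cos (of_real pi * z)) / (sin (of_real pi * z))^2"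
  proof (rule DERIV_unique[OF D1])
    show "((\<lambda>z. Gamma z * Gamma (1 - z)) has_field_derivative 
      (- of_real pi * (of_real pi * cos (of_real pi * z)) / (sin (of_real pi * z))^2)) (at z)"
      unfolding Gamma_reflection_complex by (rule D2)
  qed
  have reflection: "Digamma z - Digamma (1 - z) = - of_real pi * cos (of_real pi * z) / sin (of_real pi * z)"
  proof -
    have "Digamma z - Digamma (1 - z) = (sin (of_real pi * z) / of_real pi) * (of_real pi / sin (of_real pi * z) * (Digamma z - Digamma (1 - z)))"
      using sin0 by simp
    also have "\<dots> = (sin (of_real pi * z) / of_real pi) * (- of_real pi * (of_real pi * cos (of_real pi * z)) / (sin (of_real pi * z))^2)"
      using eq unfolding Gamma_reflection_complex by (simp only:)
    also have "\<dots> = - of_real pi * cos (of_real pi * z) / sin (of_real pi * z)"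
      using sin0 by (simp add: power2_eq_square)
    finally show ?thesis .
  qed
  have s1: "(\<lambda>k. inverse (of_nat (Suc k)) - inverse ((1 + z) + of_nat k)) sums (Digamma (1 + z) + euler_mascheroni)"
    using summable_Digamma[OF npi(3)] by (simp add: Digamma_def summable_sums)
  have s2: "(\<lambda>k. inverse (of_nat (Suc k)) - inverse ((1 - z) + of_nat k)) sums (Digamma (1 - z) + euler_mascheroni)"
    using summable_Digamma[OF npi(4)] by (simp add: Digamma_def summable_sums)
  have "(\<lambda>k. inverse (of_nat (Suc k) - z) - inverse (of_nat (Suc k) + z)) sums (Digamma (1 + z) - Digamma (1 - z))"
    using sums_diff[OF s1 s2] by (simp add: algebra_simps)
  also have "Digamma (1 + z) - Digamma (1 - z) = 1 / z - of_real pi * cos (of_real pi * z) / sin (of_real pi * z)"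
    using reflection Digamma_plus1[OF z0] by (simp add: algebra_simps)
  finally show ?thesis .
qed

text \<open>The cotangent expansion at \<open>z = i t / (2 pi)\<close>, where the cotangent of
  \<open>pi z\<close> is \<open>-i\<close> times the hyperbolic cotangent of \<open>t / 2\<close>.
  The latter is written with \<open>exp (- t)\<close> because it will be compared with a geometric
  series in \<open>exp (- t)\<close>. All terms are purely imaginary, so passing to
  \<open>Im\<close> loses nothing.\<close>

lemma coth_partial_fractions:
  fixes t :: real
  assumes t: "t > 0"
  shows "(\<lambda>m. 2 * t / (t\<^sup>2 + (2 * pi * real (Suc m))\<^sup>2)) sums ((1 + exp (-t)) / (1 - exp (-t)) / 2 - 1 / t)"
proof -
  define y where "y = t / (2 * pi)"
  have y: "y > 0" using t by (simp add: y_def)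
  define z where "z = \<i> * of_real y"
  have zZ: "z \<notin> \<int>" using y by (auto simp: z_def complex_is_Int_iff)
  have pz: "of_real pi * z = \<i> * of_real (t / 2)" by (simp add: z_def y_def)
  have ez: "exp (\<i> * (of_real pi * z)) = of_real (exp (- t / 2))" "exp (- (\<i> * (of_real pi * z))) = of_real (exp (t / 2))"
    unfolding pz exp_of_real[symmetric] by (simp_all add: mult.assoc[symmetric])
  have cs: "cos (of_real pi * z) / sin (of_real pi * z) = - \<i> * of_real ((1 + exp (-t)) / (1 - exp (-t)))"
  proof -
    define E where "E = exp (t / 2)"
    have E: "E > 1" using t by (simp add: E_def)
    have E2: "exp (-t) = inverse (E * E)" "exp (- (t / 2)) = inverse E"
      by (simp_all add: E_def exp_minus flip: exp_add)
    have EE: "E * E > 1" using E by (simp add: less_1_mult)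
    have "cos (of_real pi * z) / sin (of_real pi * z) = of_real ((E + inverse E) / 2) / (of_real (inverse E - E) / (2 * \<i>))"
      unfolding cos_exp_eq sin_exp_eq using ez by (simp add: E2 E_def[symmetric] add.commute)
    also have "\<dots> = \<i> * of_real ((E + inverse E) / (inverse E - E))"
    proof -
      have "of_real (a / 2) / (of_real b / (2 * \<i>)) = \<i> * of_real (a / b)" for a b :: real
        by (cases "b = 0") (auto simp: field_simps)
      then show ?thesis by blast
    qed
    also have "(E + inverse E) / (inverse E - E) = - ((1 + exp (-t)) / (1 - exp (-t)))"
      unfolding E2 using E EE by (simp add: field_simps)
    finally show ?thesis by simp
  qed
  have S: "(\<lambda>k. inverse (of_nat (Suc k) - z) - inverse (of_nat (Suc k) + z)) sums (1 / z - of_real pi * (- \<i> * of_real ((1 + exp (-t)) / (1 - exp (-t)))))"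
    using cot_partial_fractions[OF zZ] by (simp only: times_divide_eq_right[symmetric] cs)
  have trm: "inverse (of_nat (Suc k) - z) - inverse (of_nat (Suc k) + z) = \<i> * of_real (2 * pi * (2 * t / (t\<^sup>2 + (2 * pi * real (Suc k))\<^sup>2)))" for k
  proof -
    have "of_nat (Suc k) - z \<noteq> 0" "of_nat (Suc k) + z \<noteq> 0"
      using zZ by (metis Ints_of_nat eq_iff_diff_eq_0, metis Ints_minus Ints_of_nat add_eq_0_iff2 minus_minus)
    then have "inverse (of_nat (Suc k) - z) - inverse (of_nat (Suc k) + z) = 2 * z / ((of_nat (Suc k))\<^sup>2 - z\<^sup>2)"
      by (simp add: field_simps power2_eq_square)
    also have "(of_nat (Suc k))\<^sup>2 - z\<^sup>2 = of_real ((real (Suc k))\<^sup>2 + y\<^sup>2)"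
      by (simp add: z_def power_mult_distrib)
    also have "2 * z / of_real ((real (Suc k))\<^sup>2 + y\<^sup>2) = \<i> * of_real (2 * y / ((real (Suc k))\<^sup>2 + y\<^sup>2))"
      by (simp add: z_def)
    also have "2 * y / ((real (Suc k))\<^sup>2 + y\<^sup>2) = 2 * pi * (2 * t / (t\<^sup>2 + (2 * pi * real (Suc k))\<^sup>2))"
    proof -
      have p: "(real (Suc k))\<^sup>2 + y\<^sup>2 > 0" using y by (simp add: add_nonneg_pos)
      have "t = 2 * pi * y" by (simp add: y_def)
      have "t\<^sup>2 + (2 * pi * real (Suc k))\<^sup>2 = (2 * pi)\<^sup>2 * ((real (Suc k))\<^sup>2 + y\<^sup>2)"
      proof -
        have "(2 * pi * y)\<^sup>2 + (2 * pi * n)\<^sup>2 = (2 * pi)\<^sup>2 * (n\<^sup>2 + y\<^sup>2)" for n :: real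
          by (simp add: power2_eq_square algebra_simps)
        then show ?thesis by (simp only: \<open>t = 2 * pi * y\<close>)
      qed
      then show ?thesis using p by (simp add: \<open>t = 2 * pi * y\<close> power2_eq_square)
    qed
    finally show ?thesis .
  qed
  have rhs: "1 / z - of_real pi * (- \<i> * of_real ((1 + exp (-t)) / (1 - exp (-t)))) = \<i> * of_real (2 * pi * ((1 + exp (-t)) / (1 - exp (-t)) / 2 - 1 / t))"
    using t by (simp add: z_def y_def field_simps)
  have "(\<lambda>k. Im (\<i> * of_real (2 * pi * (2 * t / (t\<^sup>2 + (2 * pi * real (Suc k))\<^sup>2))))) sums Im (\<i> * of_real (2 * pi * ((1 + exp (-t)) / (1 - exp (-t)) / 2 - 1 / t)))"
    using S unfolding trm rhs by (rule sums_Im)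
  then have "(\<lambda>k. 2 * pi * (2 * t / (t\<^sup>2 + (2 * pi * real (Suc k))\<^sup>2))) sums (2 * pi * ((1 + exp (-t)) / (1 - exp (-t)) / 2 - 1 / t))"
    by simp
  then show ?thesis by (subst (asm) sums_mult_iff) auto
qed

section \<open>Gamma-type integrals over the positive half-line\<close>

lemma nn_integral_Gamma_scaled:
  fixes c x :: real
  assumes c: "c > 0" and x: "x > 0"
  shows "(\<integral>\<^sup>+t\<in>{0<..}. ennreal (t powr (c - 1) * exp (- x * t)) \<partial>lborel) = ennreal (Gamma c * x powr (-c))"
proof -
  define I where "I = (\<integral>\<^sup>+t\<in>{0<..}. ennreal (t powr (c - 1) * exp (- x * t)) \<partial>lborel)"
  have "ennreal (Gamma c) = (\<integral>\<^sup>+t. ennreal (indicator {0..} t * t powr (c - 1) / exp t) \<partial>lborel)"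
    by (rule Gamma_conv_nn_integral_real[OF c])
  also have "\<dots> = (\<integral>\<^sup>+t. ennreal (t powr (c - 1) * exp (- t)) * indicator {0<..} t \<partial>lborel)"
    by (intro nn_integral_cong) (auto simp: indicator_def exp_minus divide_inverse)
  also have "\<dots> = ennreal \<bar>x\<bar> * (\<integral>\<^sup>+t. ennreal ((0 + x * t) powr (c - 1) * exp (- (0 + x * t))) * indicator {0<..} (0 + x * t) \<partial>lborel)"
    using x by (intro nn_integral_real_affine) auto
  also have "(\<integral>\<^sup>+t. ennreal ((0 + x * t) powr (c - 1) * exp (- (0 + x * t))) * indicator {0<..} (0 + x * t) \<partial>lborel)
     = (\<integral>\<^sup>+t. ennreal (x powr (c - 1)) * (ennreal (t powr (c - 1) * exp (- x * t)) * indicator {0<..} t) \<partial>lborel)"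
    using x by (intro nn_integral_cong) (auto simp: indicator_def powr_mult zero_less_mult_iff mult_ac simp flip: ennreal_mult)
  also have "\<dots> = ennreal (x powr (c - 1)) * I"
    unfolding I_def by (intro nn_integral_cmult) measurable
  finally have "ennreal (x powr (-c)) * ennreal (Gamma c) = ennreal (x powr (-c)) * (ennreal x * (ennreal (x powr (c - 1)) * I))"
    using x by simp
  also have "\<dots> = ennreal (x powr (-c) * (x * x powr (c-1))) * I"
    using x by (simp add: ennreal_mult mult_ac)
  also have "x powr (-c) * (x * x powr (c-1)) = 1"
    using x by (simp add: powr_minus powr_diff)
  finally show ?thesis using x c unfolding I_def
    by (simp add: ennreal_mult[symmetric] mult.commute Gamma_real_pos less_imp_le)
qed

text \<open>The substitution of \<open>t^2\<close> turns the Gamma integral at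
  \<open>(b + 1) / 2\<close> into the moment for \<open>y = 1\<close>; a scaling by
  \<open>sqrt y\<close> then gives the general case.\<close>

lemma nn_integral_Gauss_moment:
  fixes b y :: real
  assumes b: "b > -1" and y: "y > 0"
  shows "(\<integral>\<^sup>+t\<in>{0<..}. ennreal (t powr b * exp (- y * t\<^sup>2)) \<partial>lborel) = ennreal (Gamma ((b + 1) / 2) / 2 * y powr (- ((b + 1) / 2)))"
proof -
  define e where "e = (b + 1) / 2"
  have e: "e > 0" using b by (simp add: e_def)
  have "((\<lambda>t. t powr (e - 1) / exp t) has_integral Gamma e) {0..}" by (rule Gamma_integral_real[OF e])
  then have "((\<lambda>t. t powr (e - 1) / exp t) has_integral Gamma e) {0<..}"
    by (rule has_integral_spike_set_eq[THEN iffD1, rotated 2])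
       (auto intro: negligible_subset[of "{0}"])
  then have A: "(\<lambda>t. t powr (e - 1) / exp t) absolutely_integrable_on {0<..} \<and> integral {0<..} (\<lambda>t. t powr (e - 1) / exp t) = Gamma e"
    by (auto intro!: nonnegative_absolutely_integrable_1 simp: has_integral_iff)
  have img: "(\<lambda>t::real. t\<^sup>2) ` {0<..} = {0<..}"
  proof
    show "{0<..} \<subseteq> (\<lambda>t::real. t\<^sup>2) ` {0<..}"
    proof
      fix x :: real assume "x \<in> {0<..}"
      then show "x \<in> (\<lambda>t::real. t\<^sup>2) ` {0<..}" by (intro image_eqI[of _ _ "sqrt x"]) auto
    qed
  qed auto
  have "(\<lambda>t. \<bar>2 * t\<bar> * (t\<^sup>2 powr (e - 1) / exp (t\<^sup>2))) absolutely_integrable_on {0<..} \<and>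
        integral {0<..} (\<lambda>t. \<bar>2 * t\<bar> * (t\<^sup>2 powr (e - 1) / exp (t\<^sup>2))) = Gamma e"
    by (subst has_absolute_integral_change_of_variables_1'[where g = "\<lambda>t. t\<^sup>2"])
       (use A img in \<open>auto intro!: derivative_eq_intros inj_onI simp: power2_eq_iff\<close>)
  then have "((\<lambda>t. \<bar>2 * t\<bar> * (t\<^sup>2 powr (e - 1) / exp (t\<^sup>2))) has_integral Gamma e) {0<..}"
    by (auto simp: has_integral_iff intro: absolutely_integrable_on_def[THEN iffD1, THEN conjunct1])
  then have "(\<integral>\<^sup>+t\<in>{0<..}. ennreal (\<bar>2 * t\<bar> * (t\<^sup>2 powr (e - 1) / exp (t\<^sup>2))) \<partial>lborel) = ennreal (Gamma e)"
    by (rule nn_integral_has_integral_lebesgue'[rotated]) auto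
  also have "(\<integral>\<^sup>+t\<in>{0<..}. ennreal (\<bar>2 * t\<bar> * (t\<^sup>2 powr (e - 1) / exp (t\<^sup>2))) \<partial>lborel)
     = (\<integral>\<^sup>+t. 2 * (ennreal (t powr b * exp (- t\<^sup>2)) * indicator {0<..} t) \<partial>lborel)"
  proof (intro nn_integral_cong)
    fix t :: real
    show "ennreal (\<bar>2 * t\<bar> * (t\<^sup>2 powr (e - 1) / exp (t\<^sup>2))) * indicator {0<..} t = 2 * (ennreal (t powr b * exp (- t\<^sup>2)) * indicator {0<..} t)"
    proof (cases "t > 0")
      case True
      have "t\<^sup>2 powr (e - 1) = t powr (2 * (e - 1))"
        using True by (simp add: powr_powr flip: powr_numeral)
      also have "2 * (e - 1) = b - 1" by (simp add: e_def)
      finally have "t * t\<^sup>2 powr (e - 1) = t powr b" using True by (simp add: powr_diff)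
      then have "\<bar>2 * t\<bar> * (t\<^sup>2 powr (e - 1) / exp (t\<^sup>2)) = 2 * (t powr b * exp (- t\<^sup>2))"
        using True by (simp add: exp_minus divide_inverse)
      then show ?thesis using True by (simp only: ennreal_mult') simp
    qed auto
  qed
  also have "\<dots> = 2 * (\<integral>\<^sup>+t\<in>{0<..}. ennreal (t powr b * exp (- t\<^sup>2)) \<partial>lborel)"
    by (intro nn_integral_cmult) measurable
  finally have half: "(\<integral>\<^sup>+t\<in>{0<..}. ennreal (t powr b * exp (- t\<^sup>2)) \<partial>lborel) = ennreal (Gamma e / 2)"
  proof -
    assume a: "2 * (\<integral>\<^sup>+t\<in>{0<..}. ennreal (t powr b * exp (- t\<^sup>2)) \<partial>lborel) = ennreal (Gamma e)"
    have "(\<integral>\<^sup>+t\<in>{0<..}. ennreal (t powr b * exp (- t\<^sup>2)) \<partial>lborel) = (ennreal (1/2) * 2) * (\<integral>\<^sup>+t\<in>{0<..}. ennreal (t powr b * exp (- t\<^sup>2)) \<partial>lborel)"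
    proof -
      have "ennreal (1/2) * 2 = ennreal (1/2) * ennreal 2" by simp
      also have "\<dots> = ennreal (1/2 * 2)" by (rule ennreal_mult[symmetric]) auto
      also have "\<dots> = 1" by simp
      finally show ?thesis by simp
    qed
    also have "\<dots> = ennreal (1/2) * ennreal (Gamma e)" by (simp only: mult.assoc a)
    also have "\<dots> = ennreal (1/2 * Gamma e)"
      using e by (intro ennreal_mult[symmetric]) (auto simp: Gamma_real_pos less_imp_le)
    finally show ?thesis by simp
  qed
  define r where "r = sqrt y"
  have r: "r > 0" "r * r = y" using y by (auto simp: r_def)
  define I where "I = (\<integral>\<^sup>+t\<in>{0<..}. ennreal (t powr b * exp (- y * t\<^sup>2)) \<partial>lborel)"
  have "ennreal (Gamma e / 2) = ennreal \<bar>r\<bar> * (\<integral>\<^sup>+t. ennreal ((0 + r * t) powr b * exp (- (0 + r * t)\<^sup>2)) * indicator {0<..} (0 + r * t) \<partial>lborel)"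
    unfolding half[symmetric] using r by (intro nn_integral_real_affine) auto
  also have "(\<integral>\<^sup>+t. ennreal ((0 + r * t) powr b * exp (- (0 + r * t)\<^sup>2)) * indicator {0<..} (0 + r * t) \<partial>lborel)
     = (\<integral>\<^sup>+t. ennreal (r powr b) * (ennreal (t powr b * exp (- y * t\<^sup>2)) * indicator {0<..} t) \<partial>lborel)"
    using r by (intro nn_integral_cong) (auto simp: indicator_def powr_mult zero_less_mult_iff power2_eq_square mult_ac simp flip: ennreal_mult)
  also have "\<dots> = ennreal (r powr b) * I"
    unfolding I_def by (intro nn_integral_cmult) measurable
  finally have "ennreal (r powr (-(b+1))) * ennreal (Gamma e / 2) = ennreal (r powr (-(b+1))) * (ennreal r * (ennreal (r powr b) * I))"
    using r by simp
  also have "\<dots> = ennreal (r powr (-(b+1)) * (r * r powr b)) * I"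
    using r by (simp add: ennreal_mult mult_ac)
  also have "r powr (-(b+1)) * (r * r powr b) = 1"
  proof -
    have "r * r powr b = r powr (b + 1)" using r by (simp add: powr_add)
    then show ?thesis using r by (simp only: powr_minus) simp
  qed
  also have "r powr (-(b+1)) = y powr (- e)"
  proof -
    have "r powr (-(b+1)) = y powr (1/2 * (-(b+1)))"
      unfolding r_def using y by (simp only: powr_half_sqrt[symmetric] powr_powr less_imp_le)
    also have "1/2 * (-(b+1)) = - e" unfolding e_def by linarith
    finally show ?thesis .
  qed
  finally show ?thesis using y e unfolding I_def e_def[symmetric]
    by (simp add: ennreal_mult[symmetric] mult.commute Gamma_real_pos less_imp_le)
qed

text \<open>Writing \<open>1 / (t^2 + d^2)\<close> as the integral of
  \<open>exp (- y (t^2 + d^2))\<close> over \<open>y > 0\<close> and exchanging the integrals by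
  Tonelli leaves a Gaussian moment in \<open>t\<close> and a Gamma integral in \<open>y\<close>.
  Their product contains \<open>Gamma e * Gamma (1 - e)\<close>, and the reflection formula turns it
  into the sine.\<close>

lemma nn_integral_powr_div_quadratic:
  fixes b d :: real
  assumes b: "-1 < b" "b < 1" and d: "d > 0"
  shows "(\<integral>\<^sup>+t\<in>{0<..}. ennreal (t powr b / (t\<^sup>2 + d\<^sup>2)) \<partial>lborel) = ennreal (pi / 2 / sin (pi * (b + 1) / 2) * d powr (b - 1))"
proof -
  define e where "e = (b + 1) / 2"
  have e: "0 < e" "e < 1" using b by (auto simp: e_def)
  have "(\<integral>\<^sup>+t\<in>{0<..}. ennreal (t powr b / (t\<^sup>2 + d\<^sup>2)) \<partial>lborel)
    = (\<integral>\<^sup>+t. (\<integral>\<^sup>+y. ennreal (t powr b * exp (- y * (t\<^sup>2 + d\<^sup>2))) * indicator {0<..} y * indicator {0<..} t \<partial>lborel) \<partial>lborel)"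
  proof (intro nn_integral_cong)
    fix t :: real
    show "ennreal (t powr b / (t\<^sup>2 + d\<^sup>2)) * indicator {0<..} t = (\<integral>\<^sup>+y. ennreal (t powr b * exp (- y * (t\<^sup>2 + d\<^sup>2))) * indicator {0<..} y * indicator {0<..} t \<partial>lborel)"
    proof (cases "t > 0")
      case True
      have p: "t\<^sup>2 + d\<^sup>2 > 0" using True by (simp add: add_pos_nonneg)
      have "(\<integral>\<^sup>+y. ennreal (t powr b * exp (- y * (t\<^sup>2 + d\<^sup>2))) * indicator {0<..} y * indicator {0<..} t \<partial>lborel)
        = (\<integral>\<^sup>+y. ennreal (t powr b) * (ennreal (y powr (1 - 1) * exp (- (t\<^sup>2 + d\<^sup>2) * y)) * indicator {0<..} y) \<partial>lborel)"
      proof (intro nn_integral_cong)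
        fix y :: real
        have "- y * (t\<^sup>2 + d\<^sup>2) = - (t\<^sup>2 + d\<^sup>2) * y" by (simp add: algebra_simps)
        then show "ennreal (t powr b * exp (- y * (t\<^sup>2 + d\<^sup>2))) * indicator {0<..} y * indicator {0<..} t
          = ennreal (t powr b) * (ennreal (y powr (1 - 1) * exp (- (t\<^sup>2 + d\<^sup>2) * y)) * indicator {0<..} y)"
          using True by (simp only:) (auto simp: indicator_def simp flip: ennreal_mult)
      qed
      also have "\<dots> = ennreal (t powr b) * (\<integral>\<^sup>+y\<in>{0<..}. ennreal (y powr (1 - 1) * exp (- (t\<^sup>2 + d\<^sup>2) * y)) \<partial>lborel)"
        by (intro nn_integral_cmult) measurable
      also have "\<dots> = ennreal (t powr b) * ennreal (1 / (t\<^sup>2 + d\<^sup>2))"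
        using p by (subst nn_integral_Gamma_scaled) (auto simp: powr_minus divide_inverse)
      finally show ?thesis using True p by (simp flip: ennreal_mult)
    qed auto
  qed
  also have "\<dots> = (\<integral>\<^sup>+y. (\<integral>\<^sup>+t. ennreal (t powr b * exp (- y * (t\<^sup>2 + d\<^sup>2))) * indicator {0<..} y * indicator {0<..} t \<partial>lborel) \<partial>lborel)"
    by (rule lborel_pair.Fubini'[symmetric]) measurable
  also have "\<dots> = (\<integral>\<^sup>+y. ennreal (Gamma e / 2) * (ennreal (y powr ((1 - e) - 1) * exp (- d\<^sup>2 * y)) * indicator {0<..} y) \<partial>lborel)"
  proof (intro nn_integral_cong)
    fix y :: real
    show "(\<integral>\<^sup>+t. ennreal (t powr b * exp (- y * (t\<^sup>2 + d\<^sup>2))) * indicator {0<..} y * indicator {0<..} t \<partial>lborel)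
       = ennreal (Gamma e / 2) * (ennreal (y powr ((1 - e) - 1) * exp (- d\<^sup>2 * y)) * indicator {0<..} y)"
    proof (cases "y > 0")
      case True
      have "(\<integral>\<^sup>+t. ennreal (t powr b * exp (- y * (t\<^sup>2 + d\<^sup>2))) * indicator {0<..} y * indicator {0<..} t \<partial>lborel)
         = (\<integral>\<^sup>+t. ennreal (exp (- d\<^sup>2 * y)) * (ennreal (t powr b * exp (- y * t\<^sup>2)) * indicator {0<..} t) \<partial>lborel)"
        using True by (intro nn_integral_cong) (auto simp: indicator_def mult_ac distrib_left exp_add exp_diff exp_minus divide_inverse simp flip: ennreal_mult)
      also have "\<dots> = ennreal (exp (- d\<^sup>2 * y)) * (\<integral>\<^sup>+t\<in>{0<..}. ennreal (t powr b * exp (- y * t\<^sup>2)) \<partial>lborel)"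
        by (intro nn_integral_cmult) measurable
      also have "\<dots> = ennreal (exp (- d\<^sup>2 * y)) * ennreal (Gamma e / 2 * y powr (- e))"
        using b True by (subst nn_integral_Gauss_moment) (auto simp: e_def)
      finally show ?thesis using True e
        by (simp add: mult_ac Gamma_real_pos less_imp_le flip: ennreal_mult)
    qed auto
  qed
  also have "\<dots> = ennreal (Gamma e / 2) * (\<integral>\<^sup>+y\<in>{0<..}. ennreal (y powr ((1 - e) - 1) * exp (- d\<^sup>2 * y)) \<partial>lborel)"
    by (intro nn_integral_cmult) measurable
  also have "\<dots> = ennreal (Gamma e / 2) * ennreal (Gamma (1 - e) * (d\<^sup>2) powr (- (1 - e)))"
    using e d by (subst nn_integral_Gamma_scaled) auto
  also have "\<dots> = ennreal (Gamma e * Gamma (1 - e) / 2 * d powr (b - 1))"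
  proof -
    have "(d\<^sup>2) powr (- (1 - e)) = d powr (2 * (- (1 - e)))"
      using d by (simp add: powr_powr flip: powr_numeral)
    also have "2 * (- (1 - e)) = b - 1" by (simp add: e_def)
    finally show ?thesis using e by (simp add: Gamma_real_pos less_imp_le flip: ennreal_mult)
  qed
  also have "Gamma e * Gamma (1 - e) = pi / sin (pi * e)"
  proof -
    have "Gamma (of_real e) * Gamma (of_real (1 - e)) = (of_real (pi / sin (pi * e)) :: complex)"
    proof -
      have "sin (of_real pi * of_real e) = (of_real (sin (pi * e)) :: complex)"
        by (metis of_real_mult sin_of_real)
      then show ?thesis using Gamma_reflection_complex[of "of_real e"]
        by (simp only: of_real_diff of_real_1 of_real_divide)
    qed
    then have "of_real (Gamma e * Gamma (1 - e)) = (of_real (pi / sin (pi * e)) :: complex)"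
      by (simp only: Gamma_complex_of_real of_real_mult)
    then show ?thesis by (simp only: of_real_eq_iff)
  qed
  finally show ?thesis by (simp add: e_def mult_ac)
qed

text \<open>Up to the factor \<open>(s - 1) * s * (s + 1)\<close> this is the \<open>n\<close>-th
  Euler-Maclaurin increment at the real point \<open>s = a - 2\<close>.\<close>

definition em_kernel_integral :: "real \<Rightarrow> nat \<Rightarrow> real" where
  "em_kernel_integral a n = integral {0..1} (\<lambda>u. (u - u\<^sup>2) / 2 * (real n + u) powr (-a))"

lemma em_kernel_has_integral_0:
  assumes a: "1 < a" "a < 2"
  shows "((\<lambda>u. (u - u\<^sup>2) / 2 * (real 0 + u) powr (-a)) has_integral (1 / (2 * (2 - a) * (3 - a)))) {0..1}"
proof -
  have "((\<lambda>u. (u powr (1 - a) - u powr (2 - a)) / 2) has_integral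
      ((1 powr (2 - a) / (2 - a) - 0 powr (2-a) / (2-a)) / 2 - (1 powr (3 - a) / (3 - a) - 0 powr (3-a)/(3-a)) / 2)) {0..1}"
  proof -
    have g: "((\<lambda>u. u powr (1 - a)) has_integral (1 powr (2 - a) / (2 - a))) {0..1}"
      using has_integral_powr_from_0[of "1 - a" 1] a by (simp add: algebra_simps)
    have h: "((\<lambda>u. u powr (2 - a)) has_integral (1 powr (3 - a) / (3 - a))) {0..1}"
      using has_integral_powr_from_0[of "2 - a" 1] a by (simp add: algebra_simps)
    show ?thesis using has_integral_divide[OF has_integral_diff[OF g h], of 2] a by (simp add: diff_divide_distrib)
  qed
  also have "(1 powr (2 - a) / (2 - a) - 0 powr (2-a) / (2-a)) / 2 - (1 powr (3 - a) / (3 - a) - 0 powr (3-a)/(3-a)) / 2 = 1 / (2 * (2 - a) * (3 - a))"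
    using a by (simp add: divide_simps) (simp add: algebra_simps)
  finally show ?thesis
  proof (rule has_integral_eq[rotated])
    fix u :: real assume "u \<in> {0..1}"
    show "(u powr (1 - a) - u powr (2 - a)) / 2 = (u - u\<^sup>2) / 2 * (real 0 + u) powr (-a)"
    proof (cases "u = 0")
      case False
      with \<open>u \<in> {0..1}\<close> have "u > 0" by auto
      then have "u powr (1 - a) = u * u powr (-a)" "u powr (2 - a) = u\<^sup>2 * u powr (-a)"
        by (simp_all add: powr_diff powr_minus divide_inverse)
      then show ?thesis by (simp add: algebra_simps)
    qed auto
  qed
qed

lemma em_kernel_has_integral:
  assumes a: "1 < a" "a < 2"
  shows "((\<lambda>u. (u - u\<^sup>2) / 2 * (real n + u) powr (-a)) has_integral em_kernel_integral a n) {0..1}"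
proof -
  have "(\<lambda>u. (u - u\<^sup>2) / 2 * (real n + u) powr (-a)) integrable_on {0..1}"
  proof (cases "n = 0")
    case True
    then show ?thesis using em_kernel_has_integral_0[OF a] by (auto simp: integrable_on_def)
  next
    case False
    then show ?thesis by (intro integrable_continuous_real continuous_intros) auto
  qed
  then show ?thesis unfolding em_kernel_integral_def by (rule integrable_integral)
qed

text \<open>The increments telescope from \<open>n = 1\<close> on. For \<open>a < 2\<close> the
  integral also converges at \<open>n = 0\<close>, and there its multiple is
  \<open>(a - 1) / 2\<close>, which is the starting value \<open>em_approx 1\<close>. The series
  therefore runs over all \<open>n\<close>, as a geometric series in \<open>exp (- t)\<close>
  requires later.\<close>

lemma zeta_reg_eq_kernel_series:
  assumes a: "1 < a" "a < 2"
  shows "(\<lambda>n. of_real ((a - 3) * (a - 2) * (a - 1) * em_kernel_integral a n)) sums zeta_reg (of_real (a - 2))"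
proof -
  let ?s = "of_real (a - 2) :: complex"
  let ?c = "(a - 3) * (a - 2) * (a - 1)"
  have st: "of_real (?c * em_kernel_integral a n) = em_approx (Suc n) ?s - em_approx n ?s" if n: "n > 0" for n
  proof (rule has_integral_unique)
    show "((\<lambda>u. (?s - 1) * ?s * (?s + 1) * of_real ((u - u\<^sup>2) / 2) * of_real (real n + u) powr (-?s - 2))
           has_integral (em_approx (Suc n) ?s - em_approx n ?s)) {0..1}"
      by (rule em_approx_Suc_has_integral[OF n])
    have "((\<lambda>u. of_real (?c * ((u - u\<^sup>2) / 2 * (real n + u) powr (-a))) :: complex) has_integral of_real (?c * em_kernel_integral a n)) {0..1}"
      by (intro has_integral_of_real has_integral_mult_right em_kernel_has_integral a)
    then show "((\<lambda>u. (?s - 1) * ?s * (?s + 1) * of_real ((u - u\<^sup>2) / 2) * of_real (real n + u) powr (-?s - 2))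
           has_integral of_real (?c * em_kernel_integral a n)) {0..1}"
    proof (rule has_integral_eq[rotated])
      fix u :: real assume u: "u \<in> {0..1}"
      have "of_real (real n + u) powr (-?s - 2) = (of_real (real n + u) powr (of_real (-a)) :: complex)"
        by simp
      also have "\<dots> = of_real ((real n + u) powr (-a))" using u by (intro powr_of_real) auto
      finally show "of_real (?c * ((u - u\<^sup>2) / 2 * (real n + u) powr (-a))) = (?s - 1) * ?s * (?s + 1) * of_real ((u - u\<^sup>2) / 2) * of_real (real n + u) powr (-?s - 2)"
        by (simp only:) (simp add: mult_ac)
    qed
  qed
  have zero: "of_real (?c * em_kernel_integral a 0) = em_approx 1 ?s"
  proof -
    have "em_kernel_integral a 0 = 1 / (2 * (2 - a) * (3 - a))"
      by (rule has_integral_unique[OF em_kernel_has_integral[OF a] em_kernel_has_integral_0[OF a]])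
    then have "?c * em_kernel_integral a 0 = (a - 1) / 2" using a by (simp add: divide_simps) (simp add: algebra_simps)
    moreover have "em_approx 1 ?s = of_real ((a - 1) / 2)" by (simp add: em_approx_def field_simps)
    ultimately show ?thesis by (simp only:)
  qed
  have part: "(\<Sum>n<Suc m. of_real (?c * em_kernel_integral a n)) = em_approx (Suc m) ?s" for m
  proof (induction m)
    case 0 then show ?case using zero by simp
  next
    case (Suc m) then show ?case using st[of "Suc m"] by simp
  qed
  have "(\<lambda>m. em_approx (Suc m) ?s) \<longlonglongrightarrow> zeta_reg ?s"
    by (rule LIMSEQ_Suc[OF em_approx_limits(2)[of 0 0 ?s]]) (use a in auto)
  then have "(\<lambda>m. \<Sum>n<Suc m. of_real (?c * em_kernel_integral a n)) \<longlonglongrightarrow> zeta_reg ?s"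
    by (simp only: part)
  then show ?thesis unfolding sums_def by (subst (asm) filterlim_sequentially_Suc)
qed

lemma Laplace_em_kernel:
  fixes t :: real
  assumes t: "t > 0"
  shows "((\<lambda>u. (u - u\<^sup>2) / 2 * exp (- t * u)) has_integral (((t - 2) + (t + 2) * exp (-t)) / (2 * t ^ 3))) {0..1}"
proof -
  define g where "g u = exp (- t * u) * (u\<^sup>2 / (2 * t) + u * (1 / t^2 - 1 / (2 * t)) + (1 / t^3 - 1 / (2 * t^2)))" for u
  have "((\<lambda>u. (u - u\<^sup>2) / 2 * exp (- t * u)) has_integral (g 1 - g 0)) {0..1}"
  proof (rule fundamental_theorem_of_calculus)
    fix u :: real
    have "(g has_real_derivative (u - u\<^sup>2) / 2 * exp (- t * u)) (at u within {0..1})"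
      unfolding g_def using t
      by (auto intro!: derivative_eq_intros) (simp add: field_simps power2_eq_square power3_eq_cube)
    then show "(g has_vector_derivative (u - u\<^sup>2) / 2 * exp (- t * u)) (at u within {0..1})"
      by (simp add: has_real_derivative_iff_has_vector_derivative)
  qed simp
  also have "g 1 - g 0 = ((t - 2) + (t + 2) * exp (-t)) / (2 * t ^ 3)"
    unfolding g_def using t by (simp add: field_simps power2_eq_square power3_eq_cube)
  finally show ?thesis .
qed

text \<open>The power \<open>(n + u) powr (- a)\<close> is a Gamma integral over \<open>t\<close>.
  Integrating over \<open>u\<close> gives the Laplace transform of the weight, and summing over
  \<open>n\<close> a geometric series; together they are \<open>t powr (a - 3)\<close> times half
  the hyperbolic cotangent of \<open>t / 2\<close> minus \<open>1 / t\<close>. Its partial fractions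
  have poles at the multiples of \<open>2 pi i\<close>, and integrating them term by term produces
  the Dirichlet series at \<open>3 - a = 1 - s\<close>. Everything is nonnegative, so Tonelli
  justifies each exchange.\<close>

lemma em_kernel_series_functional:
  assumes a: "1 < a" "a < 2"
  shows "Gamma a * (\<Sum>n. em_kernel_integral a n) = pi / sin (pi * (a - 1) / 2) * (2 * pi) powr (a - 3) * (\<Sum>m. real (Suc m) powr (a - 3))"
proof -
  define L where "L t = ((t - 2) + (t + 2) * exp (-t)) / (2 * t ^ 3)" for t :: real
  have Gp: "Gamma a > 0" using a by (simp add: Gamma_real_pos)
  have kap: "0 \<le> (u - u\<^sup>2) / 2" if "u \<in> {0..1}" for u :: real
    using that by (simp add: power2_eq_square mult_left_le)
  have L0: "L t \<ge> 0" if "t > 0" for t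
    unfolding L_def by (rule has_integral_nonneg[OF Laplace_em_kernel[OF that]]) (use kap in auto)
  have I0: "em_kernel_integral a n \<ge> 0" for n
    by (rule has_integral_nonneg[OF em_kernel_has_integral[OF a]]) (use kap in auto)
  have c0: "(a - 3) * (a - 2) * (a - 1) \<noteq> 0" using a by auto
  have sI: "summable (em_kernel_integral a)"
  proof -
    have "summable (\<lambda>n. of_real ((a - 3) * (a - 2) * (a - 1) * em_kernel_integral a n) :: complex)"
      using zeta_reg_eq_kernel_series[OF a] by (rule sums_summable)
    then have "summable (\<lambda>n. (a - 3) * (a - 2) * (a - 1) * em_kernel_integral a n)"
      by (simp only: summable_of_real_iff)
    then show ?thesis using c0 by (simp only: summable_cmult_iff) simp
  qed
  have sZ: "summable (\<lambda>m. real (Suc m) powr (a - 3))"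
    by (subst summable_Suc_iff) (use a in \<open>simp add: summable_real_powr_iff\<close>)
  have step: "ennreal (Gamma a * em_kernel_integral a n) = (\<integral>\<^sup>+t. ennreal (t powr (a - 1) * exp (- real n * t) * L t) * indicator {0<..} t \<partial>lborel)" for n
  proof -
    have "((\<lambda>u. (u - u\<^sup>2) / 2 * (real n + u) powr (-a) * Gamma a) has_integral em_kernel_integral a n * Gamma a) {0..1}"
      by (intro has_integral_mult_left em_kernel_has_integral a)
    then have "ennreal (em_kernel_integral a n * Gamma a) = (\<integral>\<^sup>+u. ennreal ((u - u\<^sup>2) / 2 * (real n + u) powr (-a) * Gamma a) * indicator {0..1} u \<partial>lborel)"
      by (intro nn_integral_has_integral_lebesgue'[symmetric]) (use kap Gp in auto)
    also have "\<dots> = (\<integral>\<^sup>+u. (\<integral>\<^sup>+t. ennreal ((u - u\<^sup>2) / 2 * (t powr (a - 1) * exp (- (real n + u) * t))) * indicator {0<..} t * indicator {0..1} u \<partial>lborel) \<partial>lborel)"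
    proof (intro nn_integral_cong)
      fix u :: real
      show "ennreal ((u - u\<^sup>2) / 2 * (real n + u) powr (-a) * Gamma a) * indicator {0..1} u =
        (\<integral>\<^sup>+t. ennreal ((u - u\<^sup>2) / 2 * (t powr (a - 1) * exp (- (real n + u) * t))) * indicator {0<..} t * indicator {0..1} u \<partial>lborel)"
      proof (cases "u \<in> {0<..1}")
        case True
        then have nu: "real n + u > 0" by auto
        have k: "0 \<le> (u - u\<^sup>2) / 2" using kap[of u] True by simp
        have "(\<integral>\<^sup>+t. ennreal ((u - u\<^sup>2) / 2 * (t powr (a - 1) * exp (- (real n + u) * t))) * indicator {0<..} t * indicator {0..1} u \<partial>lborel)
          = (\<integral>\<^sup>+t. ennreal ((u - u\<^sup>2) / 2) * (ennreal (t powr (a - 1) * exp (- (real n + u) * t)) * indicator {0<..} t) \<partial>lborel)"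
        proof (intro nn_integral_cong)
          fix t :: real
          have i: "indicator {0..1} u = (1 :: ennreal)" using True by auto
          show "ennreal ((u - u\<^sup>2) / 2 * (t powr (a - 1) * exp (- (real n + u) * t))) * indicator {0<..} t * indicator {0..1} u
            = ennreal ((u - u\<^sup>2) / 2) * (ennreal (t powr (a - 1) * exp (- (real n + u) * t)) * indicator {0<..} t)"
            by (simp only: i mult_1_right ennreal_mult[OF k mult_nonneg_nonneg[OF powr_ge_zero exp_ge_zero]] mult.assoc)
        qed
        also have "\<dots> = ennreal ((u - u\<^sup>2) / 2) * (\<integral>\<^sup>+t\<in>{0<..}. ennreal (t powr (a - 1) * exp (- (real n + u) * t)) \<partial>lborel)"
          by (intro nn_integral_cmult) measurable
        also have "\<dots> = ennreal ((u - u\<^sup>2) / 2) * ennreal (Gamma a * (real n + u) powr (-a))"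
          using a nu by (subst nn_integral_Gamma_scaled) auto
        also have "\<dots> = ennreal ((u - u\<^sup>2) / 2 * (Gamma a * (real n + u) powr (-a)))"
          using k Gp by (intro ennreal_mult[symmetric]) auto
        finally show ?thesis using True by (simp add: mult_ac)
      next
        case False
        then have "u = 0 \<or> u \<notin> {0..1}" by auto
        then show ?thesis by auto
      qed
    qed
    also have "\<dots> = (\<integral>\<^sup>+t. (\<integral>\<^sup>+u. ennreal ((u - u\<^sup>2) / 2 * (t powr (a - 1) * exp (- (real n + u) * t))) * indicator {0<..} t * indicator {0..1} u \<partial>lborel) \<partial>lborel)"
      by (rule lborel_pair.Fubini') measurable
    also have "\<dots> = (\<integral>\<^sup>+t. ennreal (t powr (a - 1) * exp (- real n * t) * L t) * indicator {0<..} t \<partial>lborel)"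
    proof (intro nn_integral_cong)
      fix t :: real
      show "(\<integral>\<^sup>+u. ennreal ((u - u\<^sup>2) / 2 * (t powr (a - 1) * exp (- (real n + u) * t))) * indicator {0<..} t * indicator {0..1} u \<partial>lborel)
         = ennreal (t powr (a - 1) * exp (- real n * t) * L t) * indicator {0<..} t"
      proof (cases "t > 0")
        case True
        have "((\<lambda>u. t powr (a - 1) * exp (- real n * t) * ((u - u\<^sup>2) / 2 * exp (- t * u))) has_integral (t powr (a - 1) * exp (- real n * t) * L t)) {0..1}"
          unfolding L_def by (intro has_integral_mult_right Laplace_em_kernel True)
        then have "((\<lambda>u. (u - u\<^sup>2) / 2 * (t powr (a - 1) * exp (- (real n + u) * t))) has_integral (t powr (a - 1) * exp (- real n * t) * L t)) {0..1}"
        proof (rule has_integral_eq[rotated])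
          fix u :: real
          have "exp (- (real n + u) * t) = exp (- real n * t) * exp (- t * u)"
            unfolding exp_add[symmetric] by (simp add: algebra_simps)
          then show "t powr (a - 1) * exp (- real n * t) * ((u - u\<^sup>2) / 2 * exp (- t * u)) = (u - u\<^sup>2) / 2 * (t powr (a - 1) * exp (- (real n + u) * t))"
            by (simp only: mult_ac)
        qed
        then have "(\<integral>\<^sup>+u. ennreal ((u - u\<^sup>2) / 2 * (t powr (a - 1) * exp (- (real n + u) * t))) * indicator {0..1} u \<partial>lborel) = ennreal (t powr (a - 1) * exp (- real n * t) * L t)"
          by (intro nn_integral_has_integral_lebesgue') (use kap in auto)
        then show ?thesis using True by simp
      qed auto
    qed
    finally show ?thesis by (simp add: mult.commute)
  qed
  have "ennreal (Gamma a * (\<Sum>n. em_kernel_integral a n)) = (\<Sum>n. ennreal (Gamma a * em_kernel_integral a n))"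
    using sI I0 Gp by (subst suminf_ennreal2) (auto intro: summable_mult simp: suminf_mult)
  also have "\<dots> = (\<integral>\<^sup>+t. (\<Sum>n. ennreal (t powr (a - 1) * exp (- real n * t) * L t) * indicator {0<..} t) \<partial>lborel)"
    unfolding step L_def by (rule nn_integral_suminf[symmetric]) measurable
  also have "\<dots> = (\<integral>\<^sup>+t. (\<Sum>m. ennreal (2 * (t powr (a - 2) / (t\<^sup>2 + (2 * pi * real (Suc m))\<^sup>2))) * indicator {0<..} t) \<partial>lborel)"
  proof (intro nn_integral_cong)
    fix t :: real
    show "(\<Sum>n. ennreal (t powr (a - 1) * exp (- real n * t) * L t) * indicator {0<..} t) =
       (\<Sum>m. ennreal (2 * (t powr (a - 2) / (t\<^sup>2 + (2 * pi * real (Suc m))\<^sup>2))) * indicator {0<..} t)"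
    proof (cases "t > 0")
      case True
      have e1: "exp (-t) < 1" using True by simp
      have "(\<lambda>n. t powr (a - 1) * L t * exp (-t) ^ n) sums (t powr (a - 1) * L t * (1 / (1 - exp (-t))))"
        by (intro sums_mult geometric_sums) (use True in auto)
      moreover have "t powr (a - 1) * L t * exp (-t) ^ n = t powr (a - 1) * exp (- real n * t) * L t" for n
        by (simp add: exp_of_nat_mult[symmetric])
      ultimately have S1: "(\<lambda>n. t powr (a - 1) * exp (- real n * t) * L t) sums (t powr (a - 1) * L t * (1 / (1 - exp (-t))))"
        by simp
      have SA: "(\<lambda>m. t powr (a - 3) * (2 * t / (t\<^sup>2 + (2 * pi * real (Suc m))\<^sup>2))) sums (t powr (a - 3) * ((1 + exp (-t)) / (1 - exp (-t)) / 2 - 1 / t))"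
        by (intro sums_mult coth_partial_fractions True)
      have SB: "t powr (a - 3) * (2 * t / X) = 2 * (t powr (a - 2) / X)" for X
      proof -
        have "t powr (a - 2) = t powr (a - 3 + 1)" by simp
        also have "\<dots> = t powr (a - 3) * t" using True by (subst powr_add) simp
        finally show ?thesis by simp
      qed
      have SC: "t powr (a - 3) * ((1 + exp (-t)) / (1 - exp (-t)) / 2 - 1 / t) = t powr (a - 1) * L t * (1 / (1 - exp (-t)))"
      proof -
        have "t powr (a - 1) = t powr (a - 3 + 2)" by simp
        also have "\<dots> = t powr (a - 3) * t\<^sup>2" using True by (subst powr_add) simp
        finally have "t powr (a - 1) * L t * (1 / (1 - exp (-t))) = t powr (a - 3) * (t\<^sup>2 * L t / (1 - exp (-t)))" by simp
        also have "t\<^sup>2 * L t / (1 - exp (-t)) = (1 + exp (-t)) / (1 - exp (-t)) / 2 - 1 / t"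
          unfolding L_def using True e1 by (simp add: field_simps power2_eq_square power3_eq_cube)
        finally show ?thesis by simp
      qed
      have S2: "(\<lambda>m. 2 * (t powr (a - 2) / (t\<^sup>2 + (2 * pi * real (Suc m))\<^sup>2))) sums (t powr (a - 1) * L t * (1 / (1 - exp (-t))))"
        using SA by (simp only: SB SC)
      have "(\<Sum>n. ennreal (t powr (a - 1) * exp (- real n * t) * L t)) = (\<Sum>m. ennreal (2 * (t powr (a - 2) / (t\<^sup>2 + (2 * pi * real (Suc m))\<^sup>2))))"
        using S1 S2 L0[OF True] True
        by (subst (1 2) suminf_ennreal2) (auto simp: sums_iff)
      then show ?thesis using True by simp
    qed auto
  qed
  also have "\<dots> = (\<Sum>m. (\<integral>\<^sup>+t. ennreal (2 * (t powr (a - 2) / (t\<^sup>2 + (2 * pi * real (Suc m))\<^sup>2))) * indicator {0<..} t \<partial>lborel))"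
    by (rule nn_integral_suminf) measurable
  also have "\<dots> = (\<Sum>m. ennreal (pi / sin (pi * (a - 1) / 2) * (2 * pi) powr (a - 3) * real (Suc m) powr (a - 3)))"
  proof (intro suminf_cong)
    fix m :: nat
    have sp: "sin (pi * (a - 1) / 2) > 0" using a by (intro sin_gt_zero) (auto simp: field_simps)
    have "(\<integral>\<^sup>+t. ennreal (2 * (t powr (a - 2) / (t\<^sup>2 + (2 * pi * real (Suc m))\<^sup>2))) * indicator {0<..} t \<partial>lborel)
       = (\<integral>\<^sup>+t. ennreal 2 * (ennreal (t powr (a - 2) / (t\<^sup>2 + (2 * pi * real (Suc m))\<^sup>2)) * indicator {0<..} t) \<partial>lborel)"
      by (intro nn_integral_cong) (simp only: ennreal_mult[OF zero_le_numeral divide_nonneg_nonneg[OF powr_ge_zero add_nonneg_nonneg[OF zero_le_power2 zero_le_power2]]] mult.assoc)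
    also have "\<dots> = ennreal 2 * (\<integral>\<^sup>+t\<in>{0<..}. ennreal (t powr (a - 2) / (t\<^sup>2 + (2 * pi * real (Suc m))\<^sup>2)) \<partial>lborel)"
      by (intro nn_integral_cmult) measurable
    also have "\<dots> = ennreal 2 * ennreal (pi / 2 / sin (pi * (a - 2 + 1) / 2) * (2 * pi * real (Suc m)) powr (a - 2 - 1))"
      using a by (subst nn_integral_powr_div_quadratic) auto
    also have "\<dots> = ennreal (2 * (pi / 2 / sin (pi * (a - 2 + 1) / 2) * (2 * pi * real (Suc m)) powr (a - 2 - 1)))"
      using sp by (intro ennreal_mult[symmetric]) auto
    also have "2 * (pi / 2 / sin (pi * (a - 2 + 1) / 2) * (2 * pi * real (Suc m)) powr (a - 2 - 1)) = pi / sin (pi * (a - 1) / 2) * (2 * pi) powr (a - 3) * real (Suc m) powr (a - 3)"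
      by (simp add: powr_mult)
    finally show "(\<integral>\<^sup>+t. ennreal (2 * (t powr (a - 2) / (t\<^sup>2 + (2 * pi * real (Suc m))\<^sup>2))) * indicator {0<..} t \<partial>lborel)
       = ennreal (pi / sin (pi * (a - 1) / 2) * (2 * pi) powr (a - 3) * real (Suc m) powr (a - 3))" .
  qed
  also have "\<dots> = ennreal (pi / sin (pi * (a - 1) / 2) * (2 * pi) powr (a - 3) * (\<Sum>m. real (Suc m) powr (a - 3)))"
  proof -
    have sp: "sin (pi * (a - 1) / 2) > 0" using a by (intro sin_gt_zero) (auto simp: field_simps)
    show ?thesis using sp
      by (subst suminf_mult[OF sZ, symmetric], subst suminf_ennreal2) (simp, rule summable_mult[OF sZ], simp)
  qed
  finally show ?thesis
  proof (rule ennreal_inj[THEN iffD1, rotated 2])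
    show "0 \<le> Gamma a * (\<Sum>n. em_kernel_integral a n)"
      using Gp I0 sI by (intro mult_nonneg_nonneg suminf_nonneg) auto
    have sp: "sin (pi * (a - 1) / 2) > 0" using a by (intro sin_gt_zero) (auto simp: field_simps)
    show "0 \<le> pi / sin (pi * (a - 1) / 2) * (2 * pi) powr (a - 3) * (\<Sum>m. real (Suc m) powr (a - 3))"
      using sp sZ by (intro mult_nonneg_nonneg suminf_nonneg) auto
  qed
qed

section \<open>Functional equation and continuation to the punctured plane\<close>

lemma Re_pos_not_nonpos_Ints: "Re z > 0 \<Longrightarrow> z \<notin> \<int>\<^sub>\<le>\<^sub>0"
  by (auto elim!: nonpos_Ints_cases)

lemma zeta_reg_functional_real:
  fixes s :: real
  assumes s: "-1 < s" "s < 0"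
  shows "zeta_reg (of_real s) * Gamma (1 + of_real s) * cos (of_real pi * of_real s / 2)
     = of_real (2 * pi) powr of_real s * (1 - of_real s) / 2 * zeta_reg (1 - of_real s)"
proof -
  define a where "a = s + 2"
  have a: "1 < a" "a < 2" using s by (auto simp: a_def)
  define I where "I = (\<Sum>n. em_kernel_integral a n)"
  define Z where "Z = (\<Sum>m. real (Suc m) powr (a - 3))"
  have c0: "(a - 3) * (a - 2) * (a - 1) \<noteq> 0" using a by auto
  have zs: "zeta_reg (of_real s) = of_real ((a - 3) * (a - 2) * (a - 1) * I)"
  proof -
    have S: "(\<lambda>n. of_real ((a - 3) * (a - 2) * (a - 1) * em_kernel_integral a n)) sums zeta_reg (of_real s)"
      using zeta_reg_eq_kernel_series[OF a] by (simp add: a_def)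
    then have sm: "summable (\<lambda>n. (a - 3) * (a - 2) * (a - 1) * em_kernel_integral a n)"
      using sums_summable summable_of_real_iff by blast
    then have "summable (em_kernel_integral a)" using c0 by (simp only: summable_cmult_iff) simp
    then have "(\<lambda>n. (a - 3) * (a - 2) * (a - 1) * em_kernel_integral a n) sums ((a - 3) * (a - 2) * (a - 1) * I)"
      unfolding I_def by (intro sums_mult summable_sums)
    then have "(\<lambda>n. of_real ((a - 3) * (a - 2) * (a - 1) * em_kernel_integral a n) :: complex) sums of_real ((a - 3) * (a - 2) * (a - 1) * I)"
      by (simp only: sums_of_real_iff)
    with S show ?thesis by (rule sums_unique2)
  qed
  have z1: "zeta_reg (1 - of_real s) = of_real (- s * Z)"
  proof -
    have "(\<lambda>n. 1 / of_nat (Suc n) powr (1 - of_real s)) sums (zeta_reg (1 - of_real s) / (1 - of_real s - 1))"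
      using s by (intro zeta_reg_sums) simp
    moreover have "1 / of_nat (Suc n) powr (1 - of_real s) = (of_real (real (Suc n) powr (a - 3)) :: complex)" for n
    proof -
      have "of_nat (Suc n) powr (1 - of_real s) = (of_real (real (Suc n)) powr of_real (1 - s) :: complex)" by simp
      also have "\<dots> = of_real (real (Suc n) powr (1 - s))" by (rule powr_of_real) simp
      also have "1 / \<dots> = of_real (real (Suc n) powr - (1 - s))"
        by (simp only: powr_minus divide_inverse mult_1 of_real_inverse)
      finally show ?thesis by (simp add: a_def)
    qed
    ultimately have A: "(\<lambda>n. of_real (real (Suc n) powr (a - 3)) :: complex) sums (zeta_reg (1 - of_real s) / (- of_real s))"
      by simp
    then have "summable (\<lambda>m. real (Suc m) powr (a - 3))"
      using sums_summable summable_of_real_iff by blast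
    then have "(\<lambda>n. of_real (real (Suc n) powr (a - 3)) :: complex) sums of_real Z"
      unfolding Z_def by (subst sums_of_real_iff) (rule summable_sums)
    from sums_unique2[OF A this] have "zeta_reg (1 - of_real s) = of_real Z * (- of_real s)"
      using s by (subst (asm) nonzero_divide_eq_eq) auto
    then show ?thesis by simp
  qed
  have cz: "cos (pi * s / 2) = sin (pi * (a - 1) / 2)"
  proof -
    have "pi * (a - 1) / 2 = pi * s / 2 + pi / 2" unfolding a_def by (simp add: field_simps)
    moreover have "sin (pi * s / 2 + pi / 2) = cos (pi * s / 2)" by (subst sin_add) simp
    ultimately show ?thesis by (simp only:)
  qed
  have sp: "sin (pi * (a - 1) / 2) > 0" using a by (intro sin_gt_zero) (auto simp: field_simps)
  \<comment> \<open>The recurrence matches the factor \<open>a - 1 = 1 + s\<close> of the kernel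
    series, so that \<open>Gamma (1 + s)\<close> can stand in the final equation.\<close>
  have G: "Gamma a = (1 + s) * Gamma (1 + s)"
  proof -
    have "1 + s \<notin> \<int>\<^sub>\<le>\<^sub>0" using s by (auto elim!: nonpos_Ints_cases)
    from Gamma_plus1[OF this] show ?thesis by (simp add: a_def add_ac)
  qed
  have "Gamma a * I = pi / sin (pi * (a - 1) / 2) * (2 * pi) powr (a - 3) * Z"
    unfolding I_def Z_def by (rule em_kernel_series_functional[OF a])
  then have GI: "(1 + s) * Gamma (1 + s) * I * cos (pi * s / 2) = pi * (2 * pi) powr (s - 1) * Z"
    using sp unfolding cz G by (simp add: a_def field_simps)
  have p: "(2 * pi) powr (s - 1) = (2 * pi) powr s / (2 * pi)" by (simp add: powr_diff)
  have "(a - 3) * (a - 2) * (a - 1) * I * Gamma (1 + s) * cos (pi * s / 2) = (s - 1) * s * ((1 + s) * Gamma (1 + s) * I * cos (pi * s / 2))"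
    by (simp add: a_def algebra_simps)
  also have "\<dots> = (s - 1) * s * (pi * (2 * pi) powr (s - 1) * Z)" by (simp only: GI)
  also have "\<dots> = (2 * pi) powr s * (1 - s) / 2 * (- s * Z)" unfolding p by (simp add: field_simps)
  finally have R: "(a - 3) * (a - 2) * (a - 1) * I * Gamma (1 + s) * cos (pi * s / 2) = (2 * pi) powr s * (1 - s) / 2 * (- s * Z)" .
  have c1: "cos (of_real pi * of_real s / 2) = (of_real (cos (pi * s / 2)) :: complex)"
  proof -
    have "of_real pi * of_real s / 2 = (of_real (pi * s / 2) :: complex)" by simp
    then show ?thesis by (simp only: cos_of_real)
  qed
  have c2: "of_real (2 * pi) powr of_real s = (of_real ((2 * pi) powr s) :: complex)"
    by (rule powr_of_real) auto
  have c3: "Gamma (1 + of_real s) = (of_real (Gamma (1 + s)) :: complex)"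
    by (simp flip: Gamma_complex_of_real)
  have "zeta_reg (of_real s) * Gamma (1 + of_real s) * cos (of_real pi * of_real s / 2) =
    of_real ((a - 3) * (a - 2) * (a - 1) * I * Gamma (1 + s) * cos (pi * s / 2))"
    unfolding zs c1 c3 by simp
  also have "\<dots> = of_real (2 * pi) powr of_real s * (1 - of_real s) / 2 * zeta_reg (1 - of_real s)"
    unfolding R c2 z1 by simp
  finally show ?thesis .
qed

text \<open>Both \<open>s\<close> and \<open>1 - s\<close> have real part above \<open>-1\<close>
  exactly in this strip. With \<open>Gamma (1 + s)\<close> and the cosine as factors on the left,
  both sides are holomorphic throughout the strip, including at 0 and 1, so agreement on a real
  segment with the limit point \<open>-1/2\<close> suffices.\<close>

lemma zeta_reg_functional:
  assumes s: "-1 < Re s" "Re s < 2"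
  shows "zeta_reg s * Gamma (1 + s) * cos (of_real pi * s / 2)
     = of_real (2 * pi) powr s * (1 - s) / 2 * zeta_reg (1 - s)"
proof -
  define S where "S = {s. -1 < Re s \<and> Re s < 2}"
  have S: "S = {s. Re s > -1} \<inter> {s. Re s < 2}" by (auto simp: S_def)
  have oS: "open S" unfolding S by (intro open_Int open_halfspace_Re_gt open_halfspace_Re_lt)
  have cS: "connected S" unfolding S by (intro convex_connected convex_Int convex_halfspace_Re_gt convex_halfspace_Re_lt)
  have hz: "zeta_reg holomorphic_on S" "(\<lambda>s. zeta_reg (1 - s)) holomorphic_on S"
  proof -
    show "zeta_reg holomorphic_on S"
      by (rule holomorphic_on_subset[OF zeta_reg_holomorphic]) (auto simp: S_def)
    have "(zeta_reg \<circ> (\<lambda>s. 1 - s)) holomorphic_on S"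
      by (rule holomorphic_on_compose_gen[OF _ zeta_reg_holomorphic]) (auto simp: S_def intro!: holomorphic_intros)
    then show "(\<lambda>s. zeta_reg (1 - s)) holomorphic_on S" by (simp add: o_def)
  qed
  have hG: "(\<lambda>s. Gamma (1 + s)) holomorphic_on S"
  proof (intro holomorphic_intros)
    fix z assume "z \<in> S"
    then have "Re (1 + z) > 0" by (simp add: S_def)
    then show "1 + z \<notin> \<int>\<^sub>\<le>\<^sub>0" by (rule Re_pos_not_nonpos_Ints)
  qed
  have "zeta_reg s * Gamma (1 + s) * cos (of_real pi * s / 2)
     - of_real (2 * pi) powr s * (1 - s) / 2 * zeta_reg (1 - s) = 0"
  proof (rule analytic_continuation[where f = "\<lambda>s. zeta_reg s * Gamma (1 + s) * cos (of_real pi * s / 2)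
     - of_real (2 * pi) powr s * (1 - s) / 2 * zeta_reg (1 - s)" and w = s
     and U = "of_real ` {-1<..<0}" and \<xi> = "of_real (-1/2)", OF _ oS cS])
    show "(\<lambda>s. zeta_reg s * Gamma (1 + s) * cos (of_real pi * s / 2)
     - of_real (2 * pi) powr s * (1 - s) / 2 * zeta_reg (1 - s)) holomorphic_on S"
      by (intro holomorphic_intros hz hG) auto
    show "of_real ` {-1<..<0} \<subseteq> S" by (auto simp: S_def)
    show "of_real (-1/2) \<in> S" by (simp add: S_def)
    show "of_real (-1/2) islimpt (of_real ` {-1<..<0} :: complex set)"
    proof -
      have "(-1/2 :: real) islimpt {-1<..<0}" by (rule open_imp_islimpt) auto
      then show ?thesis
      proof (rule islimpt_isCont_image)
        show "eventually (\<lambda>y. of_real y \<noteq> (of_real (-1/2) :: complex)) (at (-1/2))"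
          unfolding of_real_eq_iff by (simp add: eventually_at_filter)
      qed simp
    qed
    show "s \<in> S" using s by (simp add: S_def)
  qed (use zeta_reg_functional_real in force)
  then show ?thesis by simp
qed

text \<open>The function is glued from \<open>zeta_reg s / (s - 1)\<close> and, for
  \<open>Re s < 0\<close>, the sine form \<open>g\<close> of the functional equation, in which
  \<open>1 - s\<close> lies in the domain of \<open>zeta_reg\<close>. On the overlap the two forms
  agree by the reflection formula and the double-angle formula for the sine.\<close>

lemma riemann_zeta_exists:
  "\<exists>f. f holomorphic_on - {1} \<and> f 1 = 0 \<and> (\<forall>s. Re s > -1 \<longrightarrow> s \<noteq> 1 \<longrightarrow> f s = zeta_reg s / (s - 1))"
proof -
  define g where "g s = 2 * of_real (2 * pi) powr (s - 1) * sin (of_real pi * s / 2) * Gamma (1 - s) * (zeta_reg (1 - s) / (- s))" for s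
  define f where "f s = (if s = 1 then 0 else if Re s > -1 then zeta_reg s / (s - 1) else g s)" for s
  have fg: "f s = g s" if "Re s < 0" for s
  proof (cases "Re s > -1")
    case True
    have s: "s \<notin> \<int>" "s \<noteq> 0" "s \<noteq> 1" using True that by (auto elim!: Ints_cases)
    have FE: "zeta_reg s * Gamma (1 + s) * cos (of_real pi * s / 2) = of_real (2 * pi) powr s * (1 - s) / 2 * zeta_reg (1 - s)"
      using zeta_reg_functional[of s] True that by simp
    have sin0: "sin (of_real pi * s) \<noteq> 0" using s by (auto simp: sin_eq_0 Ints_def)
    have dbl: "sin (of_real pi * s) = 2 * sin (of_real pi * s / 2) * cos (of_real pi * s / 2)"
      using sin_double[of "of_real pi * s / 2"] by simp
    have G1: "Gamma (1 + s) = s * Gamma s" using Gamma_plus1[of s] s nonpos_Ints_Int by (auto simp: add.commute)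
    have G2: "Gamma s * Gamma (1 - s) * sin (of_real pi * s) = of_real pi" using Gamma_reflection_complex[of s] sin0 by simp
    have pw: "of_real (2 * pi) powr (s - 1) = of_real (2 * pi) powr s / of_real (2 * pi)" by (simp add: powr_diff)
    have "g s * (s * (s - 1)) = (2 / of_real pi) * sin (of_real pi * s / 2) * Gamma (1 - s) * (of_real (2 * pi) powr s * (1 - s) / 2 * zeta_reg (1 - s))"
      unfolding g_def pw using s by (simp add: field_simps)
    also have "\<dots> = (2 / of_real pi) * sin (of_real pi * s / 2) * Gamma (1 - s) * (zeta_reg s * (s * Gamma s) * cos (of_real pi * s / 2))"
      by (simp only: FE[symmetric] G1)
    also have "\<dots> = zeta_reg s * s / of_real pi * (Gamma s * Gamma (1 - s) * sin (of_real pi * s))"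
      unfolding dbl by (simp add: field_simps)
    also have "\<dots> = zeta_reg s * s" by (simp only: G2) simp
    finally have "s * (g s * (s - 1)) = s * zeta_reg s" by (simp only: mult_ac)
    then have "g s * (s - 1) = zeta_reg s" using s by simp
    then have "g s = zeta_reg s / (s - 1)" using s by (simp add: nonzero_eq_divide_eq)
    then show ?thesis using True s by (simp add: f_def)
  next
    case False
    with that show ?thesis by (auto simp: f_def)
  qed
  have h1: "f holomorphic_on ({s. Re s > -1} - {1})"
    by (rule holomorphic_transform[of "\<lambda>s. zeta_reg s / (s - 1)"])
       (auto simp: f_def intro!: holomorphic_intros holomorphic_on_subset[OF zeta_reg_holomorphic])
  have h2: "f holomorphic_on {s. Re s < 0}"
  proof (rule holomorphic_transform[of g])
    have np: "1 - z \<notin> \<int>\<^sub>\<le>\<^sub>0" if "Re z < 0" for z :: complex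
      by (rule Re_pos_not_nonpos_Ints) (use that in simp)
    have "(\<lambda>s. Gamma (1 - s)) holomorphic_on {s. Re s < 0}"
    proof (intro holomorphic_intros)
      fix z assume "z \<in> {s. Re s < 0}"
      then have "Re (1 - z) > 0" by simp
      then show "1 - z \<notin> \<int>\<^sub>\<le>\<^sub>0" by (rule Re_pos_not_nonpos_Ints)
    qed
    moreover have "(\<lambda>s. zeta_reg (1 - s)) holomorphic_on {s. Re s < 0}"
    proof -
      have "(zeta_reg \<circ> (\<lambda>s. 1 - s)) holomorphic_on {s. Re s < 0}"
        by (rule holomorphic_on_compose_gen[OF _ zeta_reg_holomorphic]) (auto intro!: holomorphic_intros)
      then show ?thesis by (simp add: o_def)
    qed
    ultimately show "g holomorphic_on {s. Re s < 0}"
      unfolding g_def by (intro holomorphic_intros) (auto simp: np)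
  qed (use fg in auto)
  have "f holomorphic_on (({s. Re s > -1} - {1}) \<union> {s. Re s < 0})"
    by (intro holomorphic_on_Un h1 h2 open_Diff open_halfspace_Re_gt open_halfspace_Re_lt) auto
  also have "({s. Re s > -1} - {1}) \<union> {s. Re s < 0} = - {1 :: complex}" by auto
  finally have "f holomorphic_on - {1}" .
  moreover have "f 1 = 0" "\<forall>s. Re s > -1 \<longrightarrow> s \<noteq> 1 \<longrightarrow> f s = zeta_reg s / (s - 1)"
    by (auto simp: f_def)
  ultimately show ?thesis by blast
qed

text \<open>Two candidates agree on the open half-plane \<open>Re s > 1\<close>, hence on the
  connected punctured plane; at the point 1 the value is prescribed. So the description denotes the
  function constructed before.\<close>

theorem riemann_zeta_eq:
  assumes "Re s > -1" "s \<noteq> 1"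
  shows "riemann_zeta s = zeta_reg s / (s - 1)"
proof -
  obtain f where f: "f holomorphic_on - {1}" "f 1 = 0" and fz: "\<And>s. Re s > -1 \<Longrightarrow> s \<noteq> 1 \<Longrightarrow> f s = zeta_reg s / (s - 1)"
    using riemann_zeta_exists by blast
  have fs: "(\<lambda>n. 1 / of_nat (Suc n) powr s) sums f s" if "Re s > 1" for s
  proof -
    have "Re s > -1" "s \<noteq> 1" using that by auto
    then show ?thesis using zeta_reg_sums[OF that] fz[of s] by simp
  qed
  have "riemann_zeta = f" unfolding riemann_zeta_def
  proof (rule the_equality)
    show "f holomorphic_on - {1} \<and> f 1 = 0 \<and> (\<forall>s. Re s > 1 \<longrightarrow> (\<lambda>n. 1 / of_nat (Suc n) powr s) sums f s)"
      using f fs by blast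
    fix g assume g: "g holomorphic_on - {1} \<and> g 1 = 0 \<and> (\<forall>s. Re s > 1 \<longrightarrow> (\<lambda>n. 1 / of_nat (Suc n) powr s) sums g s)"
    show "g = f"
    proof
      fix s
      show "g s = f s"
      proof (cases "s = 1")
        case False
        show ?thesis
        proof (rule analytic_continuation_open[of "{s. Re s > 1}" "- {1}" g f])
          show "open {s. Re s > 1}" by (rule open_halfspace_Re_gt)
          show "{s. Re s > 1} \<noteq> {}" by (auto intro: exI[of _ 2])
          show "connected (- {1 :: complex})" by (rule connected_punctured_universe) simp
          show "g z = f z" if "z \<in> {s. Re s > 1}" for z
            using that g fs[of z] sums_unique2 by blast
        qed (use g f False in auto)
      qed (use g f in auto)
    qed
  qed
  with fz assms show ?thesis by simp
qed

section \<open>Laurent coefficients at 1 and Taylor coefficients at 0\<close>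

text \<open>Division by \<open>s - 1\<close> shifts coefficients: the Laurent coefficient of index
  \<open>n\<close> at 1 is the Taylor coefficient of index \<open>n + 1\<close> of
  \<open>zeta_reg\<close>. The quotient of factorials accounts for the \<open>1/2\<close> in the
  second equation.\<close>

lemma stieltjes_eq_deriv:
  "stieltjes 0 = Re (deriv zeta_reg 1)" "stieltjes 1 = - Re ((deriv ^^ 2) zeta_reg 1) / 2"
proof -
  define F where "F = fps_expansion zeta_reg 1"
  have "zeta_reg analytic_on {1}"
    unfolding analytic_on_holomorphic
    by (intro exI[of _ "{s. Re s > -1}"]) (auto intro: zeta_reg_holomorphic open_halfspace_Re_gt)
  then have "(\<lambda>w. zeta_reg (1 + w)) has_fps_expansion F"
    unfolding F_def by (rule analytic_at_imp_has_fps_expansion)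
  then have "(\<lambda>w. zeta_reg (1 + w)) has_laurent_expansion fps_to_fls F"
    by (rule has_laurent_expansion_fps)
  then have "(\<lambda>w. zeta_reg (1 + w) / w) has_laurent_expansion (fps_to_fls F / fls_X)"
    by (intro laurent_expansion_intros)
  moreover have "\<forall>\<^sub>F w in at 0. riemann_zeta (1 + w) = zeta_reg (1 + w) / w"
  proof -
    have "\<forall>\<^sub>F w in at (0 :: complex). w \<in> ball 0 1 - {0}"
      by (rule eventually_at_in_open) auto
    then show ?thesis
    proof eventually_elim
      case (elim w)
      then have "Re (1 + w) > -1" using abs_Re_le_cmod[of w] by auto
      then show ?case using elim riemann_zeta_eq[of "1 + w"] by auto
    qed
  qed
  ultimately have "(\<lambda>w. riemann_zeta (1 + w)) has_laurent_expansion (fps_to_fls F / fls_X)"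
    by (subst has_laurent_expansion_cong) auto
  then have L: "laurent_expansion riemann_zeta 1 = fps_to_fls F / fls_X"
    by (rule laurent_expansion_eqI)
  have "fls_nth (fps_to_fls F / fls_X) (int n) = fps_nth F (n + 1)" for n
    by (simp add: nat_add_distrib)
  then have "stieltjes n = (-1) ^ n * fact n * Re ((deriv ^^ (n+1)) zeta_reg 1 / fact (n + 1))" for n
    unfolding stieltjes_def L by (simp add: F_def fps_expansion_def)
  from this[of 0] this[of 1] show "stieltjes 0 = Re (deriv zeta_reg 1)" "stieltjes 1 = - Re ((deriv ^^ 2) zeta_reg 1) / 2"
    by (simp_all add: numeral_2_eq_2)
qed

text \<open>The approximations have real derivatives at real points, so the limit is real as well;
  the case of weight 1 is used for that.\<close>

lemma em_deriv_limit_Re: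
  assumes a: "a > -1" "s > a" and b: "0 \<le> b" "b < a + 1"
    and x: "\<And>n. n > 0 \<Longrightarrow> (deriv ^^ m) (em_approx n) (of_real s) = of_real (x n)"
  shows "(\<lambda>n. real n powr b * (x n - Re ((deriv ^^ m) zeta_reg (of_real s)))) \<longlonglongrightarrow> 0"
    and "(deriv ^^ m) zeta_reg (of_real s) = of_real (Re ((deriv ^^ m) zeta_reg (of_real s)))"
proof -
  have L: "(\<lambda>n. of_real (real n powr b) * ((deriv ^^ m) (em_approx n) (of_real s) - (deriv ^^ m) zeta_reg (of_real s))) \<longlonglongrightarrow> 0"
    by (rule em_approx_deriv_limit[of a]) (use a b in auto)
  have ev: "\<forall>\<^sub>F n in sequentially. of_real (real n powr b) * ((deriv ^^ m) (em_approx n) (of_real s) - (deriv ^^ m) zeta_reg (of_real s))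
       = of_real (real n powr b) * (of_real (x n) - (deriv ^^ m) zeta_reg (of_real s))"
    using eventually_gt_at_top[of 0] by eventually_elim (simp add: x)
  have L': "(\<lambda>n. of_real (real n powr b) * (of_real (x n) - (deriv ^^ m) zeta_reg (of_real s))) \<longlonglongrightarrow> 0"
    by (rule Lim_transform_eventually[OF L ev])
  from tendsto_Re[OF this] show "(\<lambda>n. real n powr b * (x n - Re ((deriv ^^ m) zeta_reg (of_real s)))) \<longlonglongrightarrow> 0"
    by simp
  have L0: "(\<lambda>n. of_real (real n powr 0) * ((deriv ^^ m) (em_approx n) (of_real s) - (deriv ^^ m) zeta_reg (of_real s))) \<longlonglongrightarrow> 0"
    by (rule em_approx_deriv_limit[of a]) (use a in auto)
  have "(\<lambda>n. of_real (real n powr 0) * (of_real (x n) - (deriv ^^ m) zeta_reg (of_real s))) \<longlonglongrightarrow> 0"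
    by (rule Lim_transform_eventually[OF L0]) (use eventually_gt_at_top[of 0] in \<open>eventually_elim, simp add: x\<close>)
  then have "(\<lambda>n. Im (of_real (real n powr 0) * (of_real (x n) - (deriv ^^ m) zeta_reg (of_real s)))) \<longlonglongrightarrow> Im 0"
    by (rule tendsto_Im)
  moreover have "\<forall>\<^sub>F n in sequentially. Im (of_real (real n powr 0) * (of_real (x n) - (deriv ^^ m) zeta_reg (of_real s))) = - Im ((deriv ^^ m) zeta_reg (of_real s))"
    using eventually_gt_at_top[of 0] by eventually_elim simp
  ultimately have "(\<lambda>n::nat. - Im ((deriv ^^ m) zeta_reg (of_real s))) \<longlonglongrightarrow> Im 0"
    by (rule Lim_transform_eventually)
  then have "Im ((deriv ^^ m) zeta_reg (of_real s)) = 0" by (simp add: LIMSEQ_const_iff)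
  then show "(deriv ^^ m) zeta_reg (of_real s) = of_real (Re ((deriv ^^ m) zeta_reg (of_real s)))"
    by (simp add: complex_eq_iff)
qed

text \<open>The weight \<open>5/4\<close> only has to exceed 1, since the remainder will be
  multiplied by \<open>n * ln n\<close>. The choice \<open>a = 1/2\<close> permits every weight
  below \<open>3/2\<close>.\<close>

lemma harm_asymp: "(\<lambda>n. real n powr (5/4) * (harm n - ln (real n) - stieltjes 0 - 1 / (2 * real n))) \<longlonglongrightarrow> 0"
  and deriv_zeta_reg_1: "deriv zeta_reg 1 = of_real (stieltjes 0)"
proof -
  have x: "(deriv ^^ 1) (em_approx n) (of_real 1) = of_real (harm n - 1 / (2 * real n) - ln (real n))" if "n > 0" for n
    using em_approx_deriv_at_1[OF that] by simp
  from em_deriv_limit_Re[of "1/2" 1 "5/4" 1, OF _ _ _ _ x]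
  show "(\<lambda>n. real n powr (5/4) * (harm n - ln (real n) - stieltjes 0 - 1 / (2 * real n))) \<longlonglongrightarrow> 0"
    "deriv zeta_reg 1 = of_real (stieltjes 0)"
    by (simp_all add: stieltjes_eq_deriv algebra_simps)
qed

lemma sum_ln_div_asymp: "(\<lambda>n. real n powr (5/4) * ((\<Sum>k=1..n. ln (real k) / real k) - ln (real n)^2 / 2 - ln (real n) / (2 * real n) - stieltjes 1)) \<longlonglongrightarrow> 0"
  and deriv2_zeta_reg_1: "(deriv ^^ 2) zeta_reg 1 = of_real (- 2 * stieltjes 1)"
proof -
  have x: "(deriv ^^ 2) (em_approx n) (of_real 1) = of_real (- 2 * (\<Sum>k=1..n. ln (real k) / real k) + ln (real n) / real n + ln (real n)^2)" if "n > 0" for n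
    using em_approx_deriv2_at_1[OF that] by simp
  note L = em_deriv_limit_Re[of "1/2" 1 "5/4" 2, OF _ _ _ _ x]
  have r: "Re ((deriv ^^ 2) zeta_reg (of_real 1)) = - 2 * stieltjes 1" using stieltjes_eq_deriv(2) by simp
  show "(deriv ^^ 2) zeta_reg 1 = of_real (- 2 * stieltjes 1)"
    using L(2) unfolding r by simp
  have "(\<lambda>n. (-1/2) * (real n powr (5/4) * (- 2 * (\<Sum>k=1..n. ln (real k) / real k) + ln (real n) / real n + ln (real n)^2 - (- 2 * stieltjes 1)))) \<longlonglongrightarrow> (-1/2) * 0"
    by (rule tendsto_mult[OF tendsto_const]) (use L(1) r in simp)
  moreover have "(-1/2) * (r * (- 2 * A + L / x + L^2 - (- 2 * c))) = r * (A - L^2 / 2 - L / (2 * x) - c)" for r A L x c :: real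
    by (simp add: algebra_simps add_divide_distrib diff_divide_distrib)
  ultimately show "(\<lambda>n. real n powr (5/4) * ((\<Sum>k=1..n. ln (real k) / real k) - ln (real n)^2 / 2 - ln (real n) / (2 * real n) - stieltjes 1)) \<longlonglongrightarrow> 0"
    by (simp only: mult_zero_right)
qed

text \<open>Both numbers are the limit of \<open>harm n - ln n\<close>. The identification is what
  allows the derivative of \<open>Gamma\<close> at 1 to be expressed by the Stieltjes
  constant.\<close>

lemma stieltjes_0: "stieltjes 0 = euler_mascheroni"
proof (rule LIMSEQ_unique)
  show "(\<lambda>n. harm n - ln (of_nat n)) \<longlonglongrightarrow> (euler_mascheroni :: real)"
    by (rule euler_mascheroni_LIMSEQ)
  have "(\<lambda>n. real n powr (5/4) * (harm n - ln (real n) - stieltjes 0 - 1 / (2 * real n)) * real n powr (- (5/4)) + stieltjes 0 + 1 / (2 * real n)) \<longlonglongrightarrow> 0 * 0 + stieltjes 0 + 0"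
    by (intro tendsto_add tendsto_mult tendsto_const harm_asymp) real_asymp+
  moreover
  have c: "p * X * inverse p = X" if "p \<noteq> 0" for p X :: real using that by simp
  have "\<forall>\<^sub>F n in sequentially. real n powr (5/4) * (harm n - ln (real n) - stieltjes 0 - 1 / (2 * real n)) * real n powr (- (5/4)) + stieltjes 0 + 1 / (2 * real n) = harm n - ln (real n)"
      using eventually_gt_at_top[of 0] by eventually_elim (simp add: powr_minus c)
  ultimately show "(\<lambda>n. harm n - ln (of_nat n)) \<longlonglongrightarrow> stieltjes 0"
    by (auto intro: Lim_transform_eventually)
qed

section \<open>Taylor coefficients at 0 from the functional equation\<close>

lemma higher_deriv_mult_12:
  assumes "f holomorphic_on S" "g holomorphic_on S" "open S" "z \<in> S"
  shows "deriv (\<lambda>w. f w * g w) z = deriv f z * g z + f z * deriv g z"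
    and "(deriv ^^ 2) (\<lambda>w. f w * g w) z = (deriv ^^ 2) f z * g z + 2 * deriv f z * deriv g z + f z * (deriv ^^ 2) g z"
  using higher_deriv_mult[OF assms, of 1] higher_deriv_mult[OF assms, of 2]
  by (simp_all add: numeral_2_eq_2)

text \<open>The second derivative contains \<open>Polygamma 1 1\<close>, the sum of the inverse
  squares. With the \<open>- pi^2 / 4\<close> from the cosine, its \<open>pi^2 / 6\<close> gives the
  \<open>pi^2 / 24\<close> at 0 and, halved once more, the \<open>pi^2 / 48\<close> of
  \<open>K2\<close>.\<close>

lemma deriv_Gamma_1:
  "deriv Gamma (1 :: complex) = - euler_mascheroni"
  "(deriv ^^ 2) Gamma (1 :: complex) = euler_mascheroni\<^sup>2 + of_real (pi\<^sup>2 / 6)"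
proof -
  have D: "deriv Gamma z = Gamma z * Digamma z" if "z \<notin> \<int>\<^sub>\<le>\<^sub>0" for z :: complex
    by (rule DERIV_imp_deriv, rule has_field_derivative_Gamma[OF that])
  have n1: "(1 :: complex) \<notin> \<int>\<^sub>\<le>\<^sub>0" by simp
  show "deriv Gamma (1 :: complex) = - euler_mascheroni" using D[OF n1] by simp
  have "\<forall>\<^sub>F z in nhds (1 :: complex). z \<in> {z. Re z > 0}"
    by (rule eventually_nhds_in_open) (auto simp: open_halfspace_Re_gt)
  then have "\<forall>\<^sub>F z in nhds (1 :: complex). deriv Gamma z = Gamma z * Digamma z"
    by eventually_elim (auto intro!: D Re_pos_not_nonpos_Ints)
  then have "deriv (deriv Gamma) 1 = deriv (\<lambda>z. Gamma z * Digamma z) (1 :: complex)"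
    by (rule deriv_cong_ev) simp
  also have "\<dots> = euler_mascheroni\<^sup>2 + Polygamma 1 1"
    by (rule DERIV_imp_deriv) (auto intro!: derivative_eq_intros simp: power2_eq_square)
  also have "Polygamma 1 (1 :: complex) = of_real (pi\<^sup>2 / 6)"
  proof -
    have "(\<lambda>k. 1 / (real (Suc k))\<^sup>2) sums (pi\<^sup>2 / 6)" using inverse_squares_sums by simp
    then have "(\<lambda>k. of_real (1 / (real (Suc k))\<^sup>2) :: complex) sums of_real (pi\<^sup>2 / 6)"
      by (simp only: sums_of_real_iff)
    then have "(\<Sum>k. inverse ((1 + of_nat k)\<^sup>2)) = (of_real (pi\<^sup>2 / 6) :: complex)"
      by (simp add: sums_iff inverse_eq_divide)
    then show ?thesis by (simp add: Polygamma_def eval_nat_numeral)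
  qed
  finally show "(deriv ^^ 2) Gamma (1 :: complex) = euler_mascheroni\<^sup>2 + of_real (pi\<^sup>2 / 6)"
    by (simp add: numeral_2_eq_2)
qed

lemma deriv_exp_linear:
  fixes c :: complex
  shows "deriv (\<lambda>s. exp (c * s)) 0 = c" "(deriv ^^ 2) (\<lambda>s. exp (c * s)) 0 = c\<^sup>2"
proof -
  have d: "deriv (\<lambda>s. exp (c * s)) = (\<lambda>s. c * exp (c * s))"
    by (rule ext, rule DERIV_imp_deriv) (auto intro!: derivative_eq_intros)
  show "deriv (\<lambda>s. exp (c * s)) 0 = c" by (simp add: d)
  have "deriv (\<lambda>s. c * exp (c * s)) 0 = c * c"
    by (rule DERIV_imp_deriv) (auto intro!: derivative_eq_intros)
  then show "(deriv ^^ 2) (\<lambda>s. exp (c * s)) 0 = c\<^sup>2" by (simp add: d numeral_2_eq_2 power2_eq_square)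
qed

lemma deriv_cos_linear:
  fixes c :: complex
  shows "deriv (\<lambda>s. cos (c * s)) 0 = 0" "(deriv ^^ 2) (\<lambda>s. cos (c * s)) 0 = - (c\<^sup>2)"
proof -
  have d: "deriv (\<lambda>s. cos (c * s)) = (\<lambda>s. - c * sin (c * s))"
    by (rule ext, rule DERIV_imp_deriv) (auto intro!: derivative_eq_intros)
  show "deriv (\<lambda>s. cos (c * s)) 0 = 0" by (simp add: d)
  have "deriv (\<lambda>s. - c * sin (c * s)) 0 = - (c * c)"
    by (rule DERIV_imp_deriv) (auto intro!: derivative_eq_intros)
  then show "(deriv ^^ 2) (\<lambda>s. cos (c * s)) 0 = - (c\<^sup>2)" by (simp add: d numeral_2_eq_2 power2_eq_square)
qed

lemma deriv_one_minus_half: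
  "deriv (\<lambda>s. (1 - s) / 2 :: complex) 0 = - 1 / 2" "(deriv ^^ 2) (\<lambda>s. (1 - s) / 2 :: complex) 0 = 0"
proof -
  have d: "deriv (\<lambda>s. (1 - s) / 2 :: complex) = (\<lambda>s. - 1 / 2)"
    by (rule ext, rule DERIV_imp_deriv) (auto intro!: derivative_eq_intros)
  show "deriv (\<lambda>s. (1 - s) / 2 :: complex) 0 = - 1 / 2" "(deriv ^^ 2) (\<lambda>s. (1 - s) / 2 :: complex) 0 = 0"
    by (simp_all add: d numeral_2_eq_2)
qed

text \<open>Near 0 the functional equation reads \<open>zeta_reg * (B * C) = (E * M) * D\<close>, so
  Leibniz' rule is enough: order zero gives \<open>zeta_reg 0 = 1/2\<close>, and orders one and two
  are linear equations for the derivatives. The Taylor data of \<open>D\<close> are the Laurent data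
  at 1. In terms of zeta itself the first value says that its derivative at 0 is
  \<open>- ln (2 pi) / 2\<close>.\<close>

lemma zeta_reg_at_0:
  defines "l \<equiv> ln (2 * pi)" and "g \<equiv> stieltjes 0"
  shows "deriv zeta_reg 0 = of_real (l / 2 - 1 / 2)"
    and "(deriv ^^ 2) zeta_reg 0 = of_real (l\<^sup>2 / 2 + pi\<^sup>2 / 24 - g\<^sup>2 / 2 - l - stieltjes 1)"
proof -
  define S where "S = ball (0 :: complex) 1"
  have S: "open S" "0 \<in> S" by (auto simp: S_def)
  have re: "-1 < Re s" "Re s < 1" "Re s < 2" "0 < Re s + 1" if "s \<in> S" for s
    using that abs_Re_le_cmod[of s] by (auto simp: S_def)
  have z1: "zeta_reg 1 = 1"
  proof -
    have "(\<lambda>n. em_approx n 1) \<longlonglongrightarrow> zeta_reg 1" by (rule em_approx_limits(2)[of 0 0]) auto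
    moreover have "(\<lambda>n. em_approx n 1) \<longlonglongrightarrow> 1"
      by (rule tendsto_eventually) (use eventually_gt_at_top[of 0] in \<open>eventually_elim, simp add: em_approx_at_1\<close>)
    ultimately show ?thesis by (rule LIMSEQ_unique)
  qed
  have eg: "euler_mascheroni = (of_real g :: complex)" by (simp add: g_def stieltjes_0)
  have h1: "zeta_reg holomorphic_on S"
    by (rule holomorphic_on_subset[OF zeta_reg_holomorphic]) (use re in auto)
  \<comment> \<open>The argument \<open>1 - s\<close> is written as \<open>-1 * s + 1\<close> to fit
    the rule for derivatives of a composition with a linear function.\<close>
  define D where "D = (\<lambda>s. zeta_reg (-1 * s + 1))"
  have zS: "zeta_reg holomorphic_on {s. Re s > -1}" "open {s. Re s > -1}"
    by (simp_all add: zeta_reg_holomorphic open_halfspace_Re_gt)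
  have hD: "D holomorphic_on S"
  proof -
    have "(zeta_reg \<circ> (\<lambda>s. -1 * s + 1)) holomorphic_on S"
      by (rule holomorphic_on_compose_gen[OF _ zeta_reg_holomorphic]) (use re in \<open>auto intro!: holomorphic_intros\<close>)
    then show ?thesis by (simp add: o_def D_def)
  qed
  have dD: "D 0 = 1" "deriv D 0 = - of_real g" "(deriv ^^ 2) D 0 = of_real (- 2 * stieltjes 1)"
  proof -
    have c: "(deriv ^^ n) (\<lambda>w. zeta_reg (-1 * w + 1)) 0 = (-1) ^ n * (deriv ^^ n) zeta_reg (-1 * 0 + 1)" for n
      by (rule higher_deriv_compose_linear'[OF zS(1) S(1) zS(2) S(2)]) (use re in auto)
    show "D 0 = 1" by (simp add: D_def z1)
    show "deriv D 0 = - of_real g" using c[of 1] by (simp add: D_def deriv_zeta_reg_1 g_def)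
    show "(deriv ^^ 2) D 0 = of_real (- 2 * stieltjes 1)" unfolding D_def c using deriv2_zeta_reg_1 by simp
  qed
  define B where "B = (\<lambda>s :: complex. Gamma (1 * s + 1))"
  have GS: "Gamma holomorphic_on {s. Re s > 0}" "open {s. Re s > 0}"
    by (auto intro!: holomorphic_intros open_halfspace_Re_gt dest: Re_pos_not_nonpos_Ints)
  have hB: "B holomorphic_on S" unfolding B_def
    by (intro holomorphic_intros Re_pos_not_nonpos_Ints) (use re in auto)
  have dB: "B 0 = 1" "deriv B 0 = - of_real g" "(deriv ^^ 2) B 0 = of_real (g\<^sup>2 + pi\<^sup>2 / 6)"
  proof -
    have c: "(deriv ^^ n) (\<lambda>w. Gamma (1 * w + 1)) 0 = 1 ^ n * (deriv ^^ n) Gamma (1 * 0 + 1 :: complex)" for n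
      by (rule higher_deriv_compose_linear'[OF GS(1) S(1) GS(2) S(2)]) (use re in auto)
    show "B 0 = 1" by (simp add: B_def)
    show "deriv B 0 = - of_real g" using c[of 1] by (simp add: B_def deriv_Gamma_1 eg)
    show "(deriv ^^ 2) B 0 = of_real (g\<^sup>2 + pi\<^sup>2 / 6)" unfolding B_def c by (simp add: deriv_Gamma_1 eg)
  qed
  define C where "C = (\<lambda>s :: complex. cos (of_real (pi / 2) * s))"
  have hC: "C holomorphic_on S" unfolding C_def by (intro holomorphic_intros)
  define E where "E = (\<lambda>s :: complex. exp (of_real l * s))"
  have hE: "E holomorphic_on S" unfolding E_def by (intro holomorphic_intros)
  define M where "M = (\<lambda>s :: complex. (1 - s) / 2)"
  have hM: "M holomorphic_on S" unfolding M_def by (intro holomorphic_intros) auto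
  have hBC: "(\<lambda>s. B s * C s) holomorphic_on S" and hEM: "(\<lambda>s. E s * M s) holomorphic_on S"
    by (intro holomorphic_intros hB hC hE hM)+
  have eq: "zeta_reg s * (B s * C s) = (E s * M s) * D s" if s: "s \<in> S" for s
  proof -
    have p: "of_real (2 * pi) powr s = E s"
      unfolding E_def l_def by (simp add: powr_def Ln_of_real[symmetric] mult.commute del: of_real_mult)
    have "zeta_reg s * Gamma (1 + s) * cos (of_real pi * s / 2) = of_real (2 * pi) powr s * (1 - s) / 2 * zeta_reg (1 - s)"
      by (rule zeta_reg_functional) (use re[OF s] in auto)
    then show ?thesis unfolding p by (simp add: B_def C_def M_def D_def add.commute mult_ac)
  qed
  have dC: "C 0 = 1" "deriv C 0 = 0" "(deriv ^^ 2) C 0 = of_real (- (pi\<^sup>2 / 4))"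
    unfolding C_def deriv_cos_linear by (simp_all add: power_divide)
  have dE: "E 0 = 1" "deriv E 0 = of_real l" "(deriv ^^ 2) E 0 = of_real (l\<^sup>2)"
    unfolding E_def deriv_exp_linear by simp_all
  have dM: "M 0 = 1 / 2" "deriv M 0 = - 1 / 2" "(deriv ^^ 2) M 0 = 0"
    unfolding M_def deriv_one_minus_half by simp_all
  have ev: "\<forall>\<^sub>F s in nhds 0. zeta_reg s * (B s * C s) = (E s * M s) * D s"
    using eventually_nhds_in_open[OF S] by eventually_elim (rule eq)
  have z0: "zeta_reg 0 = 1 / 2" using eq[OF S(2)] by (simp add: dB dC dE dM dD)
  have "deriv (\<lambda>s. zeta_reg s * (B s * C s)) 0 = deriv (\<lambda>s. (E s * M s) * D s) 0"
    by (rule deriv_cong_ev[OF ev refl])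
  then have e0: "2 + deriv zeta_reg 0 * 4 = of_real l * 2"
    unfolding higher_deriv_mult_12[OF h1 hBC S] higher_deriv_mult_12[OF hB hC S] higher_deriv_mult_12[OF hEM hD S] higher_deriv_mult_12[OF hE hM S]
    by (simp add: dB dC dE dM dD z0 field_simps)
  have e1: "deriv zeta_reg 0 = of_real (l / 2 - 1 / 2)"
  proof -
    have "4 * deriv zeta_reg 0 = of_real (2 * l - 2)" using e0 by (simp add: eq_diff_eq algebra_simps)
    also have "2 * l - 2 = 4 * (l / 2 - 1 / 2)" by simp
    finally have "4 * deriv zeta_reg 0 = 4 * of_real (l / 2 - 1 / 2)"
      unfolding of_real_mult of_real_numeral .
    then show ?thesis unfolding mult_cancel_left by simp
  qed
  then show "deriv zeta_reg 0 = of_real (l / 2 - 1 / 2)" .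
  have "(deriv ^^ 2) (\<lambda>s. zeta_reg s * (B s * C s)) 0 = (deriv ^^ 2) (\<lambda>s. (E s * M s) * D s) 0"
    by (rule higher_deriv_cong_ev[OF ev refl])
  then have "(deriv ^^ 2) zeta_reg 0 + 2 * of_real (l / 2 - 1 / 2) * - of_real g + 1 / 2 * (of_real (g\<^sup>2 + pi\<^sup>2 / 6) + of_real (- (pi\<^sup>2 / 4)))
      = (of_real (l\<^sup>2) * (1/2) + 2 * of_real l * (- 1 / 2)) + 2 * (of_real l * (1/2) + - 1 / 2) * - of_real g + 1/2 * of_real (- 2 * stieltjes 1)"
    unfolding higher_deriv_mult_12[OF h1 hBC S] higher_deriv_mult_12[OF hB hC S] higher_deriv_mult_12[OF hEM hD S] higher_deriv_mult_12[OF hE hM S] e1 dB dC dE dM dD z0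
    by simp
  moreover have "x = c - a - b" if "x + a + b = c" for x a b c :: complex
    using that by (simp add: algebra_simps)
  ultimately have "(deriv ^^ 2) zeta_reg 0 = (of_real (l\<^sup>2) * (1/2) + 2 * of_real l * (- 1 / 2)) + 2 * (of_real l * (1/2) + - 1 / 2) * - of_real g + 1/2 * of_real (- 2 * stieltjes 1)
     - 2 * of_real (l / 2 - 1 / 2) * - of_real g - 1 / 2 * (of_real (g\<^sup>2 + pi\<^sup>2 / 6) + of_real (- (pi\<^sup>2 / 4)))"
    by blast
  also have "\<dots> = of_real ((l\<^sup>2 * (1/2) + 2 * l * (- 1 / 2)) + 2 * (l * (1/2) + - 1 / 2) * - g + 1/2 * (- 2 * stieltjes 1)
     - 2 * (l / 2 - 1 / 2) * - g - 1 / 2 * ((g\<^sup>2 + pi\<^sup>2 / 6) + (- (pi\<^sup>2 / 4))))"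
    by simp
  also have "(l\<^sup>2 * (1/2) + 2 * l * (- 1 / 2)) + 2 * (l * (1/2) + - 1 / 2) * - g + 1/2 * (- 2 * stieltjes 1)
     - 2 * (l / 2 - 1 / 2) * - g - 1 / 2 * ((g\<^sup>2 + pi\<^sup>2 / 6) + (- (pi\<^sup>2 / 4))) = l\<^sup>2 / 2 + pi\<^sup>2 / 24 - g\<^sup>2 / 2 - l - stieltjes 1"
    by (simp add: algebra_simps add_divide_distrib)
  finally show "(deriv ^^ 2) zeta_reg 0 = of_real (l\<^sup>2 / 2 + pi\<^sup>2 / 24 - g\<^sup>2 / 2 - l - stieltjes 1)" .
qed

text \<open>Stirling's formula with a rate, the constant being the first derivative at 0. A weight
  of \<open>1/2\<close> is enough here, because this remainder only meets logarithmic
  factors.\<close>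

lemma sum_ln_asymp:
  "(\<lambda>n. real n powr (1/2) * ((\<Sum>k=1..n. ln (real k)) - (real n * ln (real n) - real n + ln (real n) / 2 + ln (2 * pi) / 2))) \<longlonglongrightarrow> 0"
proof -
  have x: "(deriv ^^ 1) (em_approx n) (of_real 0) = of_real (real n - 1/2 + (\<Sum>k=1..n. ln (real k)) - ln (real n) / 2 - ln (real n) * real n)" if "n > 0" for n
    using em_approx_deriv_at_0[OF that] by simp
  from em_deriv_limit_Re(1)[of "-1/4" 0 "1/2" 1, OF _ _ _ _ x]
  show ?thesis by (simp add: zeta_reg_at_0 algebra_simps)
qed

text \<open>The second derivative at 0 mixes the squares with the sum of \<open>ln k\<close>.
  Combining it with twice the first derivative cancels that sum, and the two Taylor coefficients
  together give the constant.\<close>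

lemma sum_ln_sq_asymp:
  "(\<lambda>n. (\<Sum>k=1..n. ln (real k)^2) - (real n * ln (real n)^2 - 2 * real n * ln (real n) + 2 * real n + ln (real n)^2 / 2))
     \<longlonglongrightarrow> stieltjes 1 + (stieltjes 0)\<^sup>2 / 2 - pi\<^sup>2 / 24 - ln (2 * pi)^2 / 2"
proof -
  have x: "(deriv ^^ 2) (em_approx n) (of_real 0) = of_real (- 2 * (\<Sum>k=1..n. ln (real k)) + ln (real n)
     - (\<Sum>k=1..n. ln (real k)^2) + ln (real n)^2 / 2 + ln (real n)^2 * real n)" if "n > 0" for n
    using em_approx_deriv2_at_0[OF that] by simp
  have x1: "(deriv ^^ 1) (em_approx n) (of_real 0) = of_real (real n - 1/2 + (\<Sum>k=1..n. ln (real k)) - ln (real n) / 2 - ln (real n) * real n)" if "n > 0" for n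
    using em_approx_deriv_at_0[OF that] by simp
  define q where "q = Re ((deriv ^^ 2) zeta_reg 0)"
  have q: "q = ln (2*pi)^2 / 2 + pi\<^sup>2 / 24 - (stieltjes 0)\<^sup>2 / 2 - ln (2*pi) - stieltjes 1"
    unfolding q_def zeta_reg_at_0 by simp
  have A: "(\<lambda>n. real n powr 0 * (- 2 * (\<Sum>k=1..n. ln (real k)) + ln (real n)
     - (\<Sum>k=1..n. ln (real k)^2) + ln (real n)^2 / 2 + ln (real n)^2 * real n - q)) \<longlonglongrightarrow> 0"
    using em_deriv_limit_Re(1)[of "-1/4" 0 0 2, OF _ _ _ _ x] by (simp add: q_def)
  have B: "(\<lambda>n. real n powr 0 * (real n - 1/2 + (\<Sum>k=1..n. ln (real k)) - ln (real n) / 2 - ln (real n) * real n - (ln (2*pi) / 2 - 1 / 2))) \<longlonglongrightarrow> 0"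
    using em_deriv_limit_Re(1)[of "-1/4" 0 0 1, OF _ _ _ _ x1] by (simp add: zeta_reg_at_0)
  have "(\<lambda>n. - (real n powr 0 * (- 2 * (\<Sum>k=1..n. ln (real k)) + ln (real n)
     - (\<Sum>k=1..n. ln (real k)^2) + ln (real n)^2 / 2 + ln (real n)^2 * real n - q)) 
     - 2 * (real n powr 0 * (real n - 1/2 + (\<Sum>k=1..n. ln (real k)) - ln (real n) / 2 - ln (real n) * real n - (ln (2*pi) / 2 - 1 / 2)))
     + (- q - ln (2 * pi))) \<longlonglongrightarrow> - 0 - 2 * 0 + (- q - ln (2 * pi))"
    by (intro tendsto_intros A B)
  moreover have "\<forall>\<^sub>F n in sequentially. - (real n powr 0 * (- 2 * (\<Sum>k=1..n. ln (real k)) + ln (real n)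
     - (\<Sum>k=1..n. ln (real k)^2) + ln (real n)^2 / 2 + ln (real n)^2 * real n - q)) 
     - 2 * (real n powr 0 * (real n - 1/2 + (\<Sum>k=1..n. ln (real k)) - ln (real n) / 2 - ln (real n) * real n - (ln (2*pi) / 2 - 1 / 2)))
     + (- q - ln (2 * pi)) = (\<Sum>k=1..n. ln (real k)^2) - (real n * ln (real n)^2 - 2 * real n * ln (real n) + 2 * real n + ln (real n)^2 / 2)"
    using eventually_gt_at_top[of 0] by eventually_elim (simp add: algebra_simps)
  ultimately have "(\<lambda>n. (\<Sum>k=1..n. ln (real k)^2) - (real n * ln (real n)^2 - 2 * real n * ln (real n) + 2 * real n + ln (real n)^2 / 2))
     \<longlonglongrightarrow> - 0 - 2 * 0 + (- q - ln (2 * pi))" by (rule Lim_transform_eventually)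
  then show ?thesis by (simp add: q algebra_simps)
qed

section \<open>Fourier inversion\<close>

lemma integrable_exp_neg_abs:
  fixes a :: real
  assumes a: "a > 0"
  shows "integrable lborel (\<lambda>y. exp (- (a * \<bar>y\<bar>)))"
proof -
  have i: "integrable lborel (\<lambda>x. indicator {0<..} x *\<^sub>R exp (-(x * a)))"
    using integrable_I0i_exp_mscale[OF a] by (simp add: set_integrable_def)
  have j: "integrable lborel (\<lambda>x. indicator {0<..} (-x) *\<^sub>R exp (-((-x) * a)))"
    using lborel_integrable_real_affine[OF i, of "-1" 0] by simp
  have "integrable lborel (\<lambda>x. indicator {0<..} x *\<^sub>R exp (-(x * a)) + indicator {0<..} (-x) *\<^sub>R exp (-((-x) * a)))"
    by (rule Bochner_Integration.integrable_add[OF i j])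
  then show ?thesis
  proof (rule integrable_cong_AE_imp)
    show "AE x in lborel. indicator {0<..} x *\<^sub>R exp (-(x * a)) + indicator {0<..} (-x) *\<^sub>R exp (-((-x) * a)) = exp (- (a * \<bar>x\<bar>))"
      using AE_lborel_singleton[of 0] by eventually_elim (auto simp: indicator_def abs_if mult.commute)
  qed measurable
qed

text \<open>Dominated convergence with \<open>norm (f x)\<close> itself as majorant. It evaluates an
  integral over the line from antiderivatives on growing intervals, whose endpoints may be chosen
  for convenience.\<close>

lemma set_lebesgue_integral_exhaust:
  fixes f :: "real \<Rightarrow> 'a::euclidean_space"
  assumes f: "set_integrable lborel S f" and I: "\<And>n. I n \<in> sets borel" "\<And>n. I n \<subseteq> S"
    and ex: "\<And>x. x \<in> S \<Longrightarrow> \<forall>\<^sub>F n in sequentially. x \<in> I n"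
    and G: "\<forall>\<^sub>F n in sequentially. (f has_integral G n) (I n)" and L: "G \<longlonglongrightarrow> L"
  shows "(LBINT x:S. f x) = L"
proof (rule LIMSEQ_unique)
  show "(\<lambda>n. LBINT x:I n. f x) \<longlonglongrightarrow> (LBINT x:S. f x)"
    unfolding set_lebesgue_integral_def
  proof (rule integral_dominated_convergence[where w = "\<lambda>x. norm (indicator S x *\<^sub>R f x)"])
    show "(\<lambda>x. indicator S x *\<^sub>R f x) \<in> borel_measurable lborel"
      using f unfolding set_integrable_def by (rule borel_measurable_integrable)
    show "(\<lambda>x. indicator (I n) x *\<^sub>R f x) \<in> borel_measurable lborel" for n
      using set_integrable_subset[OF f, of "I n"] I unfolding set_integrable_def by (auto intro: borel_measurable_integrable)
    show "AE x in lborel. (\<lambda>n. indicator (I n) x *\<^sub>R f x) \<longlonglongrightarrow> indicator S x *\<^sub>R f x"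
    proof (rule AE_I2)
      fix x
      have "\<forall>\<^sub>F n in sequentially. indicator (I n) x *\<^sub>R f x = indicator S x *\<^sub>R f x"
      proof (cases "x \<in> S")
        case True
        from ex[OF this] show ?thesis by eventually_elim (use True in simp)
      next
        case False
        then have "x \<notin> I n" for n using I(2) by blast
        then show ?thesis using False by simp
      qed
      then show "(\<lambda>n. indicator (I n) x *\<^sub>R f x) \<longlonglongrightarrow> indicator S x *\<^sub>R f x" by (rule tendsto_eventually)
    qed
    show "AE x in lborel. norm (indicator (I n) x *\<^sub>R f x) \<le> norm (indicator S x *\<^sub>R f x)" for n
      using I(2)[of n] by (auto simp: indicator_def)
    show "integrable lborel (\<lambda>x. norm (indicator S x *\<^sub>R f x))"
      using f unfolding set_integrable_def by (rule integrable_norm)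
  qed
  have "\<forall>\<^sub>F n in sequentially. G n = (LBINT x:I n. f x)"
    using G
  proof eventually_elim
    case (elim n)
    have "set_integrable lborel (I n) f" using set_integrable_subset[OF f, of "I n"] I by auto
    from set_borel_integral_eq_integral(2)[OF this] show ?case using elim by (simp add: integral_unique)
  qed
  with L show "(\<lambda>n. LBINT x:I n. f x) \<longlonglongrightarrow> L" by (rule Lim_transform_eventually)
qed

lemma char_std_normal_density: "(LINT z|lborel. std_normal_density z *\<^sub>R iexp (s * z)) = of_real (exp (- s\<^sup>2 / 2))"
proof -
  have "char std_normal_distribution s = (LINT z|lborel. std_normal_density z *\<^sub>R iexp (s * z))"
    unfolding char_def by (intro integral_density) (auto simp: normal_density_nonneg)
  then show ?thesis by (simp add: char_std_normal_distribution)
qed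

lemma integrable_iexp_bounded:
  assumes "integrable M f" "g \<in> borel_measurable M"
  shows "integrable M (\<lambda>y. of_real (f y) * iexp (g y))"
proof (rule Bochner_Integration.integrable_bound[OF assms(1)])
  show "(\<lambda>y. of_real (f y) * iexp (g y)) \<in> borel_measurable M"
    using assms by measurable
qed (auto simp: norm_mult)

lemma exp_neg_abs_transform:
  "(CLBINT y. of_real (exp (- (1/2 * \<bar>y\<bar>))) * iexp (- (t * y))) = 1 / (of_real (1/4 + t\<^sup>2))"
proof -
  define s where "s = Complex (1/2) t"
  have s: "s \<noteq> 0" "1 - s \<noteq> 0" "Re s = 1/2" by (auto simp: s_def complex_eq_iff)
  let ?f = "\<lambda>y. of_real (exp (- (1/2 * \<bar>y\<bar>))) * iexp (- (t * y))"
  \<comment> \<open>One continuous antiderivative for both signs of \<open>y\<close>: on either side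
    of 0 one of the two terms is constant.\<close>
  define g where "g y = exp ((1 - s) * of_real (min y 0)) / (1 - s) - exp (- s * of_real (max y 0)) / s" for y :: real
  have f_pos: "?f y = exp (- s * of_real y)" if "y \<ge> 0" for y
  proof -
    have "of_real (- (1/2 * \<bar>y\<bar>)) + \<i> * of_real (- (t * y)) = - s * of_real y"
      using that by (simp add: s_def complex_eq_iff)
    then show ?thesis by (simp only: exp_of_real[symmetric] exp_add[symmetric])
  qed
  have f_neg: "?f y = exp ((1 - s) * of_real y)" if "y \<le> 0" for y
  proof -
    have "of_real (- (1/2 * \<bar>y\<bar>)) + \<i> * of_real (- (t * y)) = (1 - s) * of_real y"
      using that by (simp add: s_def complex_eq_iff)
    then show ?thesis by (simp only: exp_of_real[symmetric] exp_add[symmetric])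
  qed
  have D: "((\<lambda>y. exp (c * of_real y)) has_vector_derivative (c * exp (c * of_real y))) (at y)" for c :: complex and y
  proof -
    have "((\<lambda>z. exp (c * z)) has_field_derivative (c * exp (c * of_real y))) (at (of_real y))"
      by (auto intro!: derivative_eq_intros)
    from has_vector_derivative_real_field[OF this] show ?thesis .
  qed
  have hi: "(?f has_integral (g (real n) - g (- real n))) {- real n..real n}" for n
  proof (rule fundamental_theorem_of_calculus_interior_strong[of "{0}"])
    fix y assume "y \<in> {- real n<..<real n} - {0}"
    then consider "y > 0" | "y < 0" by fastforce
    then show "(g has_vector_derivative ?f y) (at y)"
    proof cases
      case 1
      have "((\<lambda>y. 1 / (1 - s) - exp (- s * of_real y) / s) has_vector_derivative (0 - (- s * exp (- s * of_real y)) / s)) (at y)"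
        by (intro has_vector_derivative_diff has_vector_derivative_const has_vector_derivative_divide D)
      then have "((\<lambda>y. 1 / (1 - s) - exp (- s * of_real y) / s) has_vector_derivative ?f y) (at y)"
        using s 1 by (simp only: f_pos) simp
      then show ?thesis
        by (rule has_vector_derivative_transform_within_open[of _ _ _ "{0<..}"]) (use 1 in \<open>auto simp: g_def\<close>)
    next
      case 2
      have "((\<lambda>y. exp ((1 - s) * of_real y) / (1 - s) - 1 / s) has_vector_derivative (((1 - s) * exp ((1 - s) * of_real y)) / (1 - s) - 0)) (at y)"
        by (intro has_vector_derivative_diff has_vector_derivative_const has_vector_derivative_divide D)
      then have "((\<lambda>y. exp ((1 - s) * of_real y) / (1 - s) - 1 / s) has_vector_derivative ?f y) (at y)"
        using s 2 by (simp only: f_neg) simp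
      then show ?thesis
        by (rule has_vector_derivative_transform_within_open[of _ _ _ "{..<0}"]) (use 2 in \<open>auto simp: g_def\<close>)
    qed
  next
    show "continuous_on {- real n..real n} g" unfolding g_def using s by (intro continuous_intros) auto
  qed auto
  have z: "(\<lambda>n. exp (- c * of_real (real n))) \<longlonglongrightarrow> 0" if "Re c = 1/2" for c
  proof (rule tendsto_norm_zero_cancel)
    have "(\<lambda>n. exp (- (real n / 2))) \<longlonglongrightarrow> 0" by real_asymp
    moreover have "norm (exp (- c * of_real (real n))) = exp (- (real n / 2))" for n
      by (simp add: norm_exp_eq_Re that)
    ultimately show "(\<lambda>n. norm (exp (- c * of_real (real n)))) \<longlonglongrightarrow> 0" by (simp only:)
  qed
  have "(\<lambda>n. (1 / (1 - s) - exp (- s * of_real (real n)) / s) - (exp (- (1 - s) * of_real (real n)) / (1 - s) - 1 / s))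
      \<longlonglongrightarrow> (1 / (1 - s) - 0 / s) - (0 / (1 - s) - 1 / s)"
    by (intro tendsto_intros z) (use s in auto)
  moreover have "g (real n) - g (- real n) = (1 / (1 - s) - exp (- s * of_real (real n)) / s) - (exp (- (1 - s) * of_real (real n)) / (1 - s) - 1 / s)" for n
    by (simp add: g_def algebra_simps)
  ultimately have lim: "(\<lambda>n. g (real n) - g (- real n)) \<longlonglongrightarrow> 1 / (1 - s) + 1 / s" by simp
  have "(CLBINT y:UNIV. ?f y) = 1 / (1 - s) + 1 / s"
  proof (rule set_lebesgue_integral_exhaust[of _ _ "\<lambda>n. {- real n..real n}", OF _ _ _ _ _ lim])
    show "set_integrable lborel UNIV ?f" unfolding set_integrable_def
      using integrable_iexp_bounded[OF integrable_exp_neg_abs[of "1/2"], of "\<lambda>y. - (t * y)"] by simp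
    show "\<forall>\<^sub>F n in sequentially. y \<in> {- real n..real n}" for y
      using eventually_ge_at_top[of "nat \<lceil>\<bar>y\<bar>\<rceil>"] by eventually_elim (unfold atLeastAtMost_iff, linarith)
  qed (use hi in auto)
  also have "1 / (1 - s) + 1 / s = 1 / (of_real (1/4 + t\<^sup>2))"
  proof -
    have "s * (1 - s) = of_real (1/4 + t\<^sup>2)" by (simp add: s_def complex_eq_iff power2_eq_square)
    moreover have "1 / (1 - s) + 1 / s = 1 / (s * (1 - s))" using s by (simp add: field_simps)
    ultimately show ?thesis by simp
  qed
  finally show ?thesis by (simp add: set_lebesgue_integral_def)
qed

text \<open>Gaussian regularisation. Evaluating the regularised integral at \<open>w = 0\<close> bounds the integral of \<open>P\<close>, so
  nonnegativity of \<open>P\<close> gives its integrability by monotone convergence.\<close>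

theorem Fourier_inversion_nonneg:
  fixes c P :: "real \<Rightarrow> real"
  assumes int: "integrable lborel c" and cont: "continuous_on UNIV c" and bdd: "\<And>y. \<bar>c y\<bar> \<le> B"
    and P: "\<And>t. (CLBINT y. of_real (c y) * iexp (t * y)) = of_real (P t)" and P0: "\<And>t. P t \<ge> 0"
  shows "integrable lborel P" "(CLBINT t. of_real (P t) * iexp (- (t * w))) = of_real (2 * pi * c w)"
proof -
  have [measurable]: "c \<in> borel_measurable borel" using cont by (rule borel_measurable_continuous_onI)
  have Pm[measurable]: "P \<in> borel_measurable borel"
  proof -
    have "(\<lambda>t. CLBINT y. of_real (c y) * iexp (t * y)) \<in> borel_measurable borel"
      by (rule lborel.borel_measurable_lebesgue_integral) measurable
    then have "(\<lambda>t. Re (of_real (P t))) \<in> borel_measurable borel"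
      unfolding P by measurable
    then show ?thesis by simp
  qed
  define A where "A = (LBINT y. \<bar>c y\<bar>)"
  have PA: "P t \<le> A" for t
  proof -
    have "P t = norm (CLBINT y. of_real (c y) * iexp (t * y))" using P[of t] P0[of t] by simp
    also have "\<dots> \<le> (LBINT y. norm (of_real (c y) * iexp (t * y)))" by (rule integral_norm_bound)
    also have "\<dots> = A" by (simp add: A_def norm_mult)
    finally show ?thesis .
  qed
  define \<phi> where "\<phi> = std_normal_density"
  have [measurable]: "\<phi> \<in> borel_measurable borel" by (simp add: \<phi>_def)
  have \<phi>0: "\<phi> z \<ge> 0" for z by (simp add: \<phi>_def normal_density_nonneg)
  have \<phi>i: "integrable lborel \<phi>" using integrable_std_normal_moment[of 0] by (simp add: \<phi>_def)
  have \<phi>1: "(LBINT z. \<phi> z) = 1" using integral_std_normal_moment_even[of 0] by (simp add: \<phi>_def)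
  \<comment> \<open>A Gaussian normalised to the value 1 at 0 instead of mass 1. It increases to 1
    as \<open>n\<close> grows, as monotone convergence requires.\<close>
  define G where "G n t = sqrt (2 * pi) * \<phi> (t / real (Suc n))" for n t
  have [measurable]: "G n \<in> borel_measurable borel" for n unfolding G_def by measurable
  have Geq: "G n t = exp (- (t / real (Suc n))\<^sup>2 / 2)" for n t
    by (simp add: G_def \<phi>_def std_normal_density_def real_sqrt_mult)
  have G0: "G n t \<ge> 0" "G n t \<le> 1" for n t by (simp_all add: Geq)
  have Gi: "integrable lborel (G n)" for n
  proof -
    have "integrable lborel (\<lambda>t. \<phi> (0 + (1 / real (Suc n)) * t))"
      by (rule lborel_integrable_real_affine[OF \<phi>i]) simp
    then show ?thesis unfolding G_def by (intro integrable_mult_right) simp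
  qed
  have Glim: "(\<lambda>n. G n t) \<longlonglongrightarrow> 1" for t
  proof -
    have "(\<lambda>n. exp (- (t / real (Suc n))\<^sup>2 / 2)) \<longlonglongrightarrow> exp (- 0\<^sup>2 / 2)"
      by (intro tendsto_intros LIMSEQ_Suc[OF lim_const_over_n]) simp
    then show ?thesis by (simp add: Geq)
  qed
  have Gmono: "mono (\<lambda>n. G n t)" for t
  proof (rule monoI)
    fix m n :: nat assume "m \<le> n"
    then have "(t / real (Suc n))\<^sup>2 \<le> (t / real (Suc m))\<^sup>2"
      unfolding power_divide by (intro divide_left_mono power_mono) auto
    then show "G m t \<le> G n t" by (simp add: Geq)
  qed
  \<comment> \<open>The transform of a wide Gaussian is a narrow one of mass \<open>2 pi\<close>;
    this follows by scaling from the characteristic function of the normal distribution.\<close>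
  have GF: "(CLBINT t. of_real (G n t) * iexp (t * x)) = of_real (2 * pi * real (Suc n) * \<phi> (real (Suc n) * x))" for n x
  proof -
    let ?n = "real (Suc n)"
    have "(CLBINT t. of_real (G n t) * iexp (t * x)) = \<bar>?n\<bar> *\<^sub>R (CLBINT z. of_real (G n (0 + ?n * z)) * iexp ((0 + ?n * z) * x))"
      by (rule lborel_integral_real_affine) simp
    also have "(CLBINT z. of_real (G n (0 + ?n * z)) * iexp ((0 + ?n * z) * x)) = (CLBINT z. of_real (sqrt (2 * pi)) * (\<phi> z *\<^sub>R iexp ((?n * x) * z)))"
      by (intro Bochner_Integration.integral_cong refl) (simp add: G_def scaleR_conv_of_real mult_ac del: of_nat_Suc)
    also have "\<dots> = of_real (sqrt (2 * pi)) * of_real (exp (- (?n * x)\<^sup>2 / 2))"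
      unfolding \<phi>_def by (subst char_std_normal_density[symmetric]) (rule integral_mult_right_zero)
    also have "exp (- (?n * x)\<^sup>2 / 2) = sqrt (2 * pi) * \<phi> (?n * x)"
      by (simp add: \<phi>_def std_normal_density_def real_sqrt_mult)
    finally have "(CLBINT t. of_real (G n t) * iexp (t * x)) = of_real (?n * (sqrt (2 * pi) * (sqrt (2 * pi) * \<phi> (?n * x))))"
      by (simp add: scaleR_conv_of_real)
    also have "?n * (sqrt (2 * pi) * (sqrt (2 * pi) * \<phi> (?n * x))) = ?n * ((sqrt (2 * pi) * sqrt (2 * pi)) * \<phi> (?n * x))"
      by (simp only: mult_ac)
    also have "sqrt (2 * pi) * sqrt (2 * pi) = 2 * pi" by simp
    finally show ?thesis by (simp only: mult_ac)
  qed
  \<comment> \<open>Fubini moves the Gaussian to the side of \<open>c\<close>: the regularised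
    inversion integral is \<open>2 pi\<close> times an average of \<open>c\<close> with respect to a
    normal density concentrating at \<open>w\<close>.\<close>
  have J: "(CLBINT t. of_real (P t * G n t) * iexp (- (t * w))) = of_real (2 * pi * (LBINT z. c (w + z / real (Suc n)) * \<phi> z))" for n w
  proof -
    let ?n = "real (Suc n)"
    let ?f = "\<lambda>t y. of_real (c y) * iexp (t * y) * (of_real (G n t) * iexp (- (t * w)))"
    have fm: "case_prod ?f \<in> borel_measurable (lborel \<Otimes>\<^sub>M lborel)" by measurable
    have nf: "norm (?f t y) = \<bar>c y\<bar> * G n t" for t y using G0 by (simp add: norm_mult)
    have fi: "integrable (lborel \<Otimes>\<^sub>M lborel) (case_prod ?f)"
    proof (rule lborel_pair.Fubini_integrable[OF fm])
      show "integrable lborel (\<lambda>t. LBINT y. norm (case_prod ?f (t, y)))"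
        unfolding prod.case nf using Gi int by simp
      show "AE t in lborel. integrable lborel (\<lambda>y. case_prod ?f (t, y))"
      proof (rule AE_I2)
        fix t
        have "integrable lborel (\<lambda>y. of_real (c y) * iexp (t * y))" by (intro integrable_iexp_bounded int) measurable
        then show "integrable lborel (\<lambda>y. case_prod ?f (t, y))" unfolding prod.case by (rule integrable_mult_left)
      qed
    qed
    have "(CLBINT y. ?f t y) = of_real (P t * G n t) * iexp (- (t * w))" for t
      unfolding integral_mult_left_zero P by (simp only: of_real_mult mult.assoc)
    then have "(CLBINT t. of_real (P t * G n t) * iexp (- (t * w))) = (CLBINT t. CLBINT y. ?f t y)"
      by (simp only:)
    also have "\<dots> = (CLBINT y. CLBINT t. ?f t y)"
      by (rule lborel_pair.Fubini_integral[OF fi, symmetric])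
    also have "\<dots> = (CLBINT y. of_real (c y * (2 * pi * ?n * \<phi> (?n * (y - w)))))"
    proof (intro Bochner_Integration.integral_cong refl)
      fix y :: real
      have "(CLBINT t. ?f t y) = (CLBINT t. of_real (c y) * (of_real (G n t) * iexp (t * (y - w))))"
        by (intro Bochner_Integration.integral_cong refl) (simp add: exp_add[symmetric] algebra_simps exp_diff exp_minus divide_inverse)
      also have "\<dots> = of_real (c y) * of_real (2 * pi * ?n * \<phi> (?n * (y - w)))"
        by (simp only: integral_mult_right_zero GF)
      finally show "(CLBINT t. ?f t y) = of_real (c y * (2 * pi * ?n * \<phi> (?n * (y - w))))" by simp
    qed
    also have "\<dots> = of_real (LBINT y. c y * (2 * pi * ?n * \<phi> (?n * (y - w))))" by (rule integral_complex_of_real)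
    also have "(LBINT y. c y * (2 * pi * ?n * \<phi> (?n * (y - w)))) = \<bar>1 / ?n\<bar> *\<^sub>R (LBINT z. c (w + 1 / ?n * z) * (2 * pi * ?n * \<phi> (?n * (w + 1 / ?n * z - w))))"
      by (rule lborel_integral_real_affine) simp
    also have "(LBINT z. c (w + 1 / ?n * z) * (2 * pi * ?n * \<phi> (?n * (w + 1 / ?n * z - w)))) = (LBINT z. (2 * pi * ?n) * (c (w + z / ?n) * \<phi> z))"
      by (intro Bochner_Integration.integral_cong refl) (simp add: mult_ac del: of_nat_Suc)
    also have "\<bar>1 / ?n\<bar> *\<^sub>R \<dots> = 2 * pi * (LBINT z. c (w + z / ?n) * \<phi> z)"
      by (simp only: integral_mult_right_zero) simp
    finally show ?thesis .
  qed
  have cl: "(\<lambda>n. (LBINT z. c (w + z / real (Suc n)) * \<phi> z)) \<longlonglongrightarrow> c w" for w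
  proof -
    have "(\<lambda>n. (LBINT z. c (w + z / real (Suc n)) * \<phi> z)) \<longlonglongrightarrow> (LBINT z. c w * \<phi> z)"
    proof (rule integral_dominated_convergence[where w = "\<lambda>z. B * \<phi> z"])
      show "integrable lborel (\<lambda>z. B * \<phi> z)" using \<phi>i by simp
      show "AE z in lborel. (\<lambda>n. c (w + z / real (Suc n)) * \<phi> z) \<longlonglongrightarrow> c w * \<phi> z"
      proof (rule AE_I2)
        fix z :: real
        have "(\<lambda>n. w + z / real (Suc n)) \<longlonglongrightarrow> w + 0"
          by (intro tendsto_intros LIMSEQ_Suc[OF lim_const_over_n])
        then have "(\<lambda>n. c (w + z / real (Suc n))) \<longlonglongrightarrow> c (w + 0)"
          using cont by (intro isCont_tendsto_compose[of _ c]) (auto simp: continuous_on_eq_continuous_at)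
        then show "(\<lambda>n. c (w + z / real (Suc n)) * \<phi> z) \<longlonglongrightarrow> c w * \<phi> z" by (intro tendsto_intros) simp
      qed
      show "AE z in lborel. norm (c (w + z / real (Suc n)) * \<phi> z) \<le> B * \<phi> z" for n
        using bdd \<phi>0 by (auto simp: abs_mult intro!: mult_right_mono)
    qed measurable
    then show ?thesis by (simp add: \<phi>1)
  qed
  \<comment> \<open>At this point \<open>P\<close> is only known to be bounded, by the integral of
    \<open>\<bar>c y\<bar>\<close>; the Gaussian factor supplies the integrability.\<close>
  have PG: "integrable lborel (\<lambda>t. P t * G n t)" for n
    by (rule Bochner_Integration.integrable_bound[of _ "\<lambda>t. A * G n t"])
       (use Gi PA P0 G0 in \<open>auto simp: abs_mult intro!: mult_right_mono order_trans[OF PA abs_ge_self]\<close>)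
  have lim0: "(\<lambda>n. LBINT t. P t * G n t) \<longlonglongrightarrow> 2 * pi * c 0"
  proof -
    have "(LBINT t. P t * G n t) = 2 * pi * (LBINT z. c (0 + z / real (Suc n)) * \<phi> z)" for n
    proof -
      have "of_real (LBINT t. P t * G n t) = (CLBINT t. of_real (P t * G n t) * iexp (- (t * 0)))"
        unfolding integral_complex_of_real[symmetric] by simp
      also have "\<dots> = of_real (2 * pi * (LBINT z. c (0 + z / real (Suc n)) * \<phi> z))" by (rule J)
      finally show ?thesis by (simp only: of_real_eq_iff)
    qed
    moreover have "(\<lambda>n. 2 * pi * (LBINT z. c (0 + z / real (Suc n)) * \<phi> z)) \<longlonglongrightarrow> 2 * pi * c 0"
      by (intro tendsto_intros cl)
    ultimately show ?thesis by (simp only:)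
  qed
  show iP: "integrable lborel P"
  proof (rule integrable_monotone_convergence[OF PG _ _ lim0])
    show "AE t in lborel. mono (\<lambda>n. P t * G n t)"
      using Gmono P0 by (auto intro!: AE_I2 simp: mono_def mult_left_mono)
    show "AE t in lborel. (\<lambda>n. P t * G n t) \<longlonglongrightarrow> P t"
      using tendsto_mult[OF tendsto_const Glim] by (auto intro!: AE_I2)
  qed measurable
  have "(\<lambda>n. CLBINT t. of_real (P t * G n t) * iexp (- (t * w))) \<longlonglongrightarrow> (CLBINT t. of_real (P t) * iexp (- (t * w)))"
  proof (rule integral_dominated_convergence[where w = P])
    show "AE t in lborel. (\<lambda>n. of_real (P t * G n t) * iexp (- (t * w))) \<longlonglongrightarrow> of_real (P t) * iexp (- (t * w))"
    proof (rule AE_I2)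
      fix t
      have "(\<lambda>n. of_real (P t * G n t) * iexp (- (t * w))) \<longlonglongrightarrow> of_real (P t * 1) * iexp (- (t * w))"
        by (intro tendsto_intros Glim)
      then show "(\<lambda>n. of_real (P t * G n t) * iexp (- (t * w))) \<longlonglongrightarrow> of_real (P t) * iexp (- (t * w))" by simp
    qed
    show "AE t in lborel. norm (of_real (P t * G n t) * iexp (- (t * w))) \<le> P t" for n
      using P0 G0 by (auto simp: norm_mult abs_mult mult_left_le)
  qed (use iP in auto)
  moreover have "(\<lambda>n. CLBINT t. of_real (P t * G n t) * iexp (- (t * w))) \<longlonglongrightarrow> of_real (2 * pi * c w)"
    unfolding J by (intro tendsto_intros cl)
  ultimately show "(CLBINT t. of_real (P t) * iexp (- (t * w))) = of_real (2 * pi * c w)"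
    by (rule LIMSEQ_unique)
qed

section \<open>The kernels as correlations of fractional parts\<close>

definition mellin_frac :: "real \<Rightarrow> real" where
  "mellin_frac y = frac (exp y) * exp (- y / 2)"

lemma mellin_frac_measurable [measurable]: "mellin_frac \<in> borel_measurable borel"
  unfolding mellin_frac_def frac_def by measurable

lemma mellin_frac_nonneg: "mellin_frac y \<ge> 0"
  by (simp add: mellin_frac_def)

text \<open>For negative \<open>y\<close> the number \<open>exp y\<close> is its own fractional
  part, which improves the exponent from \<open>- y / 2\<close> to \<open>y / 2\<close>. Hence
  exponential decay at both ends.\<close>

lemma mellin_frac_le: "mellin_frac y \<le> exp (- (1/2 * \<bar>y\<bar>))"
proof (cases "y \<ge> 0")
  case True
  have "mellin_frac y \<le> 1 * exp (- y / 2)"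
    unfolding mellin_frac_def by (intro mult_right_mono) (auto simp: frac_lt_1 less_imp_le)
  then show ?thesis using True by simp
next
  case False
  have "frac (exp y) = exp y" using False by (simp add: frac_eq)
  then have "mellin_frac y = exp (y / 2)" by (simp add: mellin_frac_def flip: exp_add)
  then show ?thesis using False by simp
qed

lemma mellin_frac_integrable: "integrable lborel mellin_frac"
  by (rule Bochner_Integration.integrable_bound[OF integrable_exp_neg_abs[of "1/2"]])
     (use mellin_frac_le mellin_frac_nonneg in auto)

text \<open>The floor function as a sum of unit steps at the points \<open>ln k\<close>. Each step
  can then be integrated separately against \<open>exp (- s y)\<close>.\<close>

lemma floor_exp_eq_sum:
  assumes "y \<le> ln (real n)" "n > 0"
  shows "real_of_int \<lfloor>exp y\<rfloor> = (\<Sum>k=1..n. if ln (real k) \<le> y then 1 else 0)"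
proof -
  have "exp y \<le> real n" using assms by (metis exp_le_cancel_iff exp_ln of_nat_0_less_iff)
  have "(\<Sum>k=1..n. if ln (real k) \<le> y then 1 else 0) = real (card {k \<in> {1..n}. ln (real k) \<le> y})"
    by (simp add: sum.If_cases Int_def)
  also have "{k \<in> {1..n}. ln (real k) \<le> y} = {1..nat \<lfloor>exp y\<rfloor>}"
  proof safe
    fix k assume k: "k \<in> {1..n}" "ln (real k) \<le> y"
    then have "real k \<le> exp y" by (metis atLeastAtMost_iff exp_le_cancel_iff exp_ln less_eq_Suc_le of_nat_0_less_iff One_nat_def)
    then show "k \<in> {1..nat \<lfloor>exp y\<rfloor>}" using k by (auto simp: le_nat_iff le_floor_iff)
  next
    fix k assume k: "k \<in> {1..nat \<lfloor>exp y\<rfloor>}"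
    then have ke: "real k \<le> exp y" by (auto simp: le_nat_iff le_floor_iff)
    then show "k \<in> {1..n}" using k \<open>exp y \<le> real n\<close> by auto
    show "ln (real k) \<le> y" using ke k by (metis atLeastAtMost_iff exp_gt_zero less_eq_Suc_le ln_exp ln_le_cancel_iff of_nat_0_less_iff One_nat_def)
  qed
  finally show ?thesis by simp
qed

lemma has_vector_derivative_exp_max:
  fixes s :: complex
  assumes "y \<noteq> a"
  shows "((\<lambda>y. exp (- s * of_real (max y a))) has_vector_derivative (if a \<le> y then - s * exp (- s * of_real y) else 0)) (at y)"
proof (cases "a < y")
  case True
  have "((\<lambda>y. exp (- s * of_real y)) has_vector_derivative (- s * exp (- s * of_real y))) (at y)"
  proof -
    have "((\<lambda>z. exp (- s * z)) has_field_derivative (- s * exp (- s * of_real y))) (at (of_real y))"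
      by (auto intro!: derivative_eq_intros)
    from has_vector_derivative_real_field[OF this] show ?thesis .
  qed
  then have "((\<lambda>y. exp (- s * of_real (max y a))) has_vector_derivative (- s * exp (- s * of_real y))) (at y)"
    by (rule has_vector_derivative_transform_within_open[of _ _ _ "{a<..}"]) (use True in \<open>auto simp: max_def\<close>)
  then show ?thesis using True by simp
next
  case False
  have "((\<lambda>y. exp (- s * of_real a)) has_vector_derivative 0) (at y)" by (rule has_vector_derivative_const)
  then have "((\<lambda>y. exp (- s * of_real (max y a))) has_vector_derivative 0) (at y)"
    by (rule has_vector_derivative_transform_within_open[of _ _ _ "{..<a}"]) (use False assms in \<open>auto simp: max_def\<close>)
  then show ?thesis using False assms by auto
qed

text \<open>Up to terms that vanish in the limit, integrating as far as \<open>ln n\<close>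
  reproduces the \<open>n\<close>-th Euler-Maclaurin approximation, divided by \<open>s - 1\<close>
  and by \<open>- s\<close>. Since the approximations converge on the critical line, no further
  continuation argument is needed.\<close>

lemma mellin_frac_transform:
  assumes s: "Re s = 1/2"
  shows "integrable lborel (\<lambda>y. of_real (frac (exp y)) * exp (- s * of_real y))"
    and "(CLBINT y. of_real (frac (exp y)) * exp (- s * of_real y)) = - riemann_zeta s / s"
proof -
  let ?f = "\<lambda>y. of_real (frac (exp y)) * exp (- s * of_real y)"
  have s0: "s \<noteq> 0" "s \<noteq> 1" "1 - s \<noteq> 0" using s by auto
  have fm[measurable]: "?f \<in> borel_measurable borel" unfolding frac_def by measurable
  have nf: "norm (?f y) = mellin_frac y" for y
    using s by (simp add: norm_mult norm_exp_eq_Re mellin_frac_def)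
  show fi: "integrable lborel ?f"
  proof (rule Bochner_Integration.integrable_bound[OF mellin_frac_integrable])
    show "AE y in lborel. norm (?f y) \<le> norm (mellin_frac y)" unfolding nf by simp
  qed measurable
  \<comment> \<open>The first term integrates \<open>exp y\<close> and the sum integrates minus the
    floor. Each summand stays constant until \<open>y\<close> reaches \<open>ln k\<close>, so that
    \<open>g n\<close> is continuous; it is an antiderivative as far as \<open>ln n\<close>.\<close>
  define g where "g n y = exp ((1 - s) * of_real y) / (1 - s) + (\<Sum>k=1..n. exp (- s * of_real (max y (ln (real k))))) / s" for n and y :: real
  have val: "(?f has_integral (g n (ln (real n)) - g n (- real n))) {- real n..ln (real n)}" if n: "n > 0" for n
  proof -
    have le: "- real n \<le> ln (real n)" using n by (smt (verit) ln_ge_zero of_nat_0_le_iff of_nat_0_less_iff of_nat_1 of_nat_le_iff less_eq_Suc_le One_nat_def)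
    show ?thesis
    proof (rule fundamental_theorem_of_calculus_interior_strong[of "(\<lambda>k. ln (real k)) ` {1..n}"])
      fix y assume y: "y \<in> {- real n<..<ln (real n)} - (\<lambda>k. ln (real k)) ` {1..n}"
      have D1: "((\<lambda>y. exp ((1 - s) * of_real y) / (1 - s)) has_vector_derivative exp ((1 - s) * of_real y)) (at y)"
      proof -
        have "((\<lambda>z. exp ((1 - s) * z) / (1 - s)) has_field_derivative (exp ((1 - s) * of_real y))) (at (of_real y))"
          using s0 by (auto intro!: derivative_eq_intros)
        from has_vector_derivative_real_field[OF this] show ?thesis .
      qed
      have D2: "((\<lambda>y. (\<Sum>k=1..n. exp (- s * of_real (max y (ln (real k))))) / s) has_vector_derivative
         (\<Sum>k=1..n. (if ln (real k) \<le> y then - s * exp (- s * of_real y) else 0)) / s) (at y)"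
        by (intro has_vector_derivative_divide has_vector_derivative_sum has_vector_derivative_exp_max) (use y in auto)
      have "((\<lambda>y. g n y) has_vector_derivative (exp ((1 - s) * of_real y) + (\<Sum>k=1..n. (if ln (real k) \<le> y then - s * exp (- s * of_real y) else 0)) / s)) (at y)"
        unfolding g_def by (intro has_vector_derivative_add D1 D2)
      moreover have "exp ((1 - s) * of_real y) + (\<Sum>k=1..n. (if ln (real k) \<le> y then - s * exp (- s * of_real y) else 0)) / s = ?f y"
      proof -
        have "(\<Sum>k=1..n. (if ln (real k) \<le> y then - s * exp (- s * of_real y) else 0)) = - s * exp (- s * of_real y) * (\<Sum>k=1..n. of_real (if ln (real k) \<le> y then 1 else 0))"
          unfolding sum_distrib_left by (intro sum.cong refl) auto
        also have "(\<Sum>k=1..n. of_real (if ln (real k) \<le> y then 1 else 0)) = (of_real (real_of_int \<lfloor>exp y\<rfloor>) :: complex)"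
          by (subst floor_exp_eq_sum[of y n]) (use y n in auto)
        finally have "(\<Sum>k=1..n. (if ln (real k) \<le> y then - s * exp (- s * of_real y) else 0)) / s = - exp (- s * of_real y) * of_real (real_of_int \<lfloor>exp y\<rfloor>)"
          using s0 by simp
        moreover have "exp ((1 - s) * of_real y) = of_real (exp y) * exp (- s * of_real y)"
          by (simp add: exp_of_real[symmetric] exp_add[symmetric] algebra_simps)
        ultimately show ?thesis by (simp add: frac_def algebra_simps)
      qed
      ultimately show "(g n has_vector_derivative ?f y) (at y)" by (simp only:)
    next
      show "continuous_on {- real n..ln (real n)} (g n)"
        unfolding g_def using s0 by (intro continuous_intros) auto
    qed (use le in auto)
  qed
  have L2: "(\<lambda>n. g n (ln (real n)) - g n (- real n)) \<longlonglongrightarrow> - riemann_zeta s / s"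
  proof -
    have ev: "\<forall>\<^sub>F n in sequentially. - (em_approx n s / (s - 1) + of_nat n powr (- s) / 2) / s - exp (- ((1 - s) * of_nat n)) / (1 - s)
        = g n (ln (real n)) - g n (- real n)"
      using eventually_gt_at_top[of 0]
    proof eventually_elim
      case (elim n)
      have pw: "of_nat k powr a = exp (a * of_real (ln (real k)))" if "k > 0" for k :: nat and a :: complex
        using that by (simp add: powr_def Ln_of_nat)
      have a: "(\<Sum>k=1..n. exp (- s * of_real (max (ln (real n)) (ln (real k))))) = of_nat n * of_nat n powr (-s)"
      proof -
        have "(\<Sum>k=1..n. exp (- s * of_real (max (ln (real n)) (ln (real k))))) = (\<Sum>k=1..n. of_nat n powr (-s))"
          using elim by (intro sum.cong refl) (auto simp: pw max_def)
        then show ?thesis by simp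
      qed
      have b: "(\<Sum>k=1..n. exp (- s * of_real (max (- real n) (ln (real k))))) = (\<Sum>k=1..n. of_nat k powr (-s))"
      proof (intro sum.cong refl)
        fix k assume "k \<in> {1..n}"
        then have "ln (real k) \<ge> 0" "k > 0" by auto
        then have "max (- real n) (ln (real k)) = ln (real k)" by (smt (verit) of_nat_0_le_iff)
        then show "exp (- s * of_real (max (- real n) (ln (real k)))) = of_nat k powr (-s)"
          using \<open>k > 0\<close> by (simp add: pw)
      qed
      have c: "exp ((1 - s) * of_real (ln (real n))) = of_nat n * of_nat n powr (-s)"
      proof -
        have "exp ((1 - s) * of_real (ln (real n))) = exp (of_real (ln (real n))) * exp (- s * of_real (ln (real n)))"
          by (simp add: exp_add[symmetric] algebra_simps)
        also have "exp (of_real (ln (real n))) = (of_nat n :: complex)" using elim by (simp add: exp_of_real)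
        finally show ?thesis using elim by (simp add: pw)
      qed
      have e: "em_approx n s = (s - 1) * ((\<Sum>k=1..n. of_nat k powr (-s)) - of_nat n powr (-s) / 2) + of_nat n * of_nat n powr (-s)"
        unfolding em_approx_def using pw[of n "1 - s"] c elim by simp
      have alg: "- (((s - 1) * (S - p / 2) + N * p) / (s - 1) + p / 2) / s - E / (1 - s) = (N * p / (1 - s) + N * p / s) - (E / (1 - s) + S / s) + (N * p / (s * (s-1)) * 0)" if "s \<noteq> 0" "s - 1 \<noteq> 0" "1 - s \<noteq> 0" for S p N E
      proof -
        have r: "1 / (1 - s) + 1 / s = - (1 / (s - 1)) / s"
        proof -
          have "- (1 / (s - 1)) = 1 / (1 - s)" using minus_divide_right[of 1 "s - 1"] by simp
          moreover have "1 / (1 - s) + 1 / s = (s + (1 - s)) / ((1 - s) * s)" using that by (subst add_frac_eq) auto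
          ultimately show ?thesis by simp
        qed
        have "((s - 1) * (S - p / 2) + N * p) / (s - 1) + p / 2 = S + N * p * (1 / (s - 1))"
          using that by (simp add: add_divide_distrib)
        then have "- (((s - 1) * (S - p / 2) + N * p) / (s - 1) + p / 2) / s = - (S + N * p * (1 / (s - 1))) / s"
          by (simp only:)
        also have "\<dots> = N * p * (- (1 / (s - 1)) / s) - S / s"
          by (simp add: add_divide_distrib diff_divide_distrib)
        finally have "- (((s - 1) * (S - p / 2) + N * p) / (s - 1) + p / 2) / s = N * p * (- (1 / (s - 1)) / s) - S / s" .
        then show ?thesis unfolding r[symmetric] by (simp add: algebra_simps)
      qed
      have d: "g n (ln (real n)) = of_nat n * of_nat n powr (-s) / (1 - s) + of_nat n * of_nat n powr (-s) / s"
        unfolding g_def a c ..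
      have d': "g n (- real n) = exp (- ((1 - s) * of_nat n)) / (1 - s) + (\<Sum>k=1..n. of_nat k powr (-s)) / s"
        unfolding g_def b by simp
      show ?case unfolding e d d' using alg s0 by simp
    qed
    have z: "(\<lambda>n. of_nat n powr (- s) :: complex) \<longlonglongrightarrow> 0"
    proof (rule tendsto_norm_zero_cancel)
      have "(\<lambda>n. real n powr (-1/2)) \<longlonglongrightarrow> 0" by real_asymp
      moreover have "\<forall>\<^sub>F n in sequentially. real n powr (-1/2) = norm (of_nat n powr (- s) :: complex)"
        using eventually_gt_at_top[of 0] by eventually_elim (subst norm_powr_real_powr, simp_all add: s)
      ultimately show "(\<lambda>n. norm (of_nat n powr (- s) :: complex)) \<longlonglongrightarrow> 0" by (rule Lim_transform_eventually)
    qed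
    have z2: "(\<lambda>n. exp (- ((1 - s) * of_nat n))) \<longlonglongrightarrow> 0"
    proof (rule tendsto_norm_zero_cancel)
      have "(\<lambda>n. exp (- (real n / 2))) \<longlonglongrightarrow> 0" by real_asymp
      moreover have "norm (exp (- ((1 - s) * of_nat n))) = exp (- (real n / 2))" for n
        by (simp add: norm_exp_eq_Re s)
      ultimately show "(\<lambda>n. norm (exp (- ((1 - s) * of_nat n)))) \<longlonglongrightarrow> 0" by (simp only:)
    qed
    have "(\<lambda>n. - (em_approx n s / (s - 1) + of_nat n powr (- s) / 2) / s - exp (- ((1 - s) * of_nat n)) / (1 - s))
       \<longlonglongrightarrow> - (zeta_reg s / (s - 1) + 0 / 2) / s - 0 / (1 - s)"
      by (intro tendsto_intros z z2 em_approx_limits(2)[of 0 0]) (use s s0 in auto)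
    then have "(\<lambda>n. g n (ln (real n)) - g n (- real n)) \<longlonglongrightarrow> - (zeta_reg s / (s - 1) + 0 / 2) / s - 0 / (1 - s)"
      using ev by (rule Lim_transform_eventually)
    then show ?thesis using s s0 by (simp add: riemann_zeta_eq)
  qed
  have "(CLBINT y:UNIV. ?f y) = - riemann_zeta s / s"
  proof (rule set_lebesgue_integral_exhaust[of _ _ "\<lambda>n. {- real n..ln (real n)}", OF _ _ _ _ _ L2])
    show "set_integrable lborel UNIV ?f" using fi by (simp add: set_integrable_def)
    show "\<forall>\<^sub>F n in sequentially. y \<in> {- real n..ln (real n)}" for y
    proof -
      have "\<forall>\<^sub>F n in sequentially. - real n \<le> y \<and> y \<le> ln (real n)"
      proof (rule eventually_conj)
        show "\<forall>\<^sub>F n in sequentially. - real n \<le> y"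
          using eventually_ge_at_top[of "nat \<lceil>- y\<rceil>"] by eventually_elim linarith
        have "filterlim (\<lambda>n. ln (real n)) at_top sequentially" by real_asymp
        then show "\<forall>\<^sub>F n in sequentially. y \<le> ln (real n)" by (simp add: filterlim_at_top)
      qed
      then show ?thesis by simp
    qed
    show "\<forall>\<^sub>F n in sequentially. (?f has_integral (g n (ln (real n)) - g n (- real n))) {- real n..ln (real n)}"
      using eventually_gt_at_top[of 0] by eventually_elim (rule val)
  qed auto
  then show "(CLBINT y. ?f y) = - riemann_zeta s / s" by (simp add: set_lebesgue_integral_def)
qed

section \<open>The correlation function and its Fourier transform\<close>

definition frac_corr :: "real \<Rightarrow> real" where
  "frac_corr w = (LBINT y. mellin_frac y * mellin_frac (y + w))"

lemma mellin_frac_le_1: "mellin_frac y \<le> 1"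
  by (rule order_trans[OF mellin_frac_le]) simp

lemma mellin_frac_norm: "\<bar>mellin_frac y\<bar> = mellin_frac y"
  by (simp add: mellin_frac_nonneg)

lemma frac_corr_integrable_integrand:
  "integrable lborel (\<lambda>y. mellin_frac y * mellin_frac (y + w))"
  by (rule Bochner_Integration.integrable_bound[OF mellin_frac_integrable])
     (auto simp: abs_mult mellin_frac_norm intro!: mult_left_le mellin_frac_nonneg mellin_frac_le_1)

lemma frac_corr_nonneg: "frac_corr w \<ge> 0"
  unfolding frac_corr_def by (intro integral_nonneg_AE AE_I2 mult_nonneg_nonneg mellin_frac_nonneg)

lemma frac_corr_bound: "\<bar>frac_corr w\<bar> \<le> (LBINT y. mellin_frac y)"
proof -
  have "frac_corr w \<le> (LBINT y. mellin_frac y)"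
    unfolding frac_corr_def
    by (intro integral_mono frac_corr_integrable_integrand mellin_frac_integrable mult_left_le mellin_frac_nonneg mellin_frac_le_1)
  then show ?thesis using frac_corr_nonneg[of w] by simp
qed

lemma frac_corr_even: "frac_corr (- w) = frac_corr w"
proof -
  have "frac_corr (- w) = \<bar>1\<bar> *\<^sub>R (LBINT y. mellin_frac (w + 1 * y) * mellin_frac ((w + 1 * y) + - w))"
    unfolding frac_corr_def by (rule lborel_integral_real_affine) simp
  then show ?thesis by (simp add: frac_corr_def mult.commute add.commute)
qed

lemma isCont_mellin_frac:
  assumes "exp y \<notin> \<int>"
  shows "isCont mellin_frac y"
proof -
  have "isCont (\<lambda>y. frac (exp y)) y"
    by (rule isCont_o2[where g = frac]) (auto intro!: continuous_frac assms)
  then show ?thesis unfolding mellin_frac_def by (intro continuous_intros) auto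
qed

lemma AE_exp_not_Ints: "AE y in lborel. exp (y + w) \<notin> (\<int> :: real set)"
proof (rule AE_I')
  have "{y :: real. exp (y + w) \<in> \<int>} \<subseteq> (\<lambda>k. ln (real_of_int k) - w) ` UNIV"
  proof
    fix y :: real assume "y \<in> {y. exp (y + w) \<in> \<int>}"
    then obtain k where "exp (y + w) = real_of_int k" by (auto elim: Ints_cases)
    then have "y = ln (real_of_int k) - w" by (metis add_diff_cancel_right' ln_exp)
    then show "y \<in> (\<lambda>k. ln (real_of_int k) - w) ` UNIV" by blast
  qed
  then have "countable {y :: real. exp (y + w) \<in> \<int>}" by (rule countable_subset) auto
  then show "{y :: real. exp (y + w) \<in> \<int>} \<in> null_sets lborel" by (rule countable_imp_null_set_lborel)
qed auto

text \<open>\<open>mellin_frac\<close> jumps, but only where \<open>exp y\<close> is an integer. For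
  almost every \<open>y\<close> the translates converge, and dominated convergence smooths the jumps
  out.\<close>

lemma frac_corr_continuous: "continuous_on UNIV frac_corr"
proof (rule continuous_on_sequentiallyI)
  fix u :: "nat \<Rightarrow> real" and w assume u: "u \<longlonglongrightarrow> w"
  show "(\<lambda>n. frac_corr (u n)) \<longlonglongrightarrow> frac_corr w"
    unfolding frac_corr_def
  proof (rule integral_dominated_convergence[where w = mellin_frac])
    show "AE y in lborel. (\<lambda>n. mellin_frac y * mellin_frac (y + u n)) \<longlonglongrightarrow> mellin_frac y * mellin_frac (y + w)"
      using AE_exp_not_Ints[of w]
    proof eventually_elim
      case (elim y)
      then have "isCont mellin_frac (y + w)" by (rule isCont_mellin_frac)
      then have "(\<lambda>n. mellin_frac (y + u n)) \<longlonglongrightarrow> mellin_frac (y + w)"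
        by (rule isCont_tendsto_compose) (intro tendsto_intros u)
      then show ?case by (intro tendsto_intros)
    qed
    show "AE y in lborel. norm (mellin_frac y * mellin_frac (y + u n)) \<le> mellin_frac y" for n
      by (rule AE_I2) (auto simp: abs_mult mellin_frac_norm intro!: mult_left_le mellin_frac_nonneg mellin_frac_le_1)
  qed (auto intro: mellin_frac_integrable)
qed

lemma mellin_frac_Fourier:
  "(CLBINT y. of_real (mellin_frac y) * iexp (- (t * y))) = - riemann_zeta (Complex (1/2) t) / Complex (1/2) t"
proof -
  have "of_real (mellin_frac y) * iexp (- (t * y)) = of_real (frac (exp y)) * exp (- Complex (1/2) t * of_real y)" for y
  proof -
    have "of_real (- y / 2) + \<i> * of_real (- (t * y)) = - Complex (1/2) t * of_real y"
      by (simp add: complex_eq_iff)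
    then have "exp (of_real (- y / 2)) * iexp (- (t * y)) = exp (- Complex (1/2) t * of_real y)"
      by (simp only: exp_add[symmetric])
    then show ?thesis by (simp only: mellin_frac_def of_real_mult exp_of_real mult.assoc)
  qed
  then show ?thesis using mellin_frac_transform(2)[of "Complex (1/2) t"] by simp
qed

definition zeta_sq :: "real \<Rightarrow> real" where
  "zeta_sq t = (norm (riemann_zeta (Complex (1/2) t) / Complex (1/2) t))\<^sup>2"

text \<open>On the critical line \<open>1 - s\<close> is the conjugate of \<open>s\<close>. The
  required conjugation symmetry of zeta is read off the Fourier integral of the real function
  \<open>mellin_frac\<close>, and it makes the product in the integrand a squared modulus, hence
  nonnegative.\<close>

lemma zeta_sq_eq:
  fixes t :: real defines "s \<equiv> Complex (1/2) t"
  shows "of_real (zeta_sq t) = riemann_zeta s * riemann_zeta (1 - s) / (s * (1 - s))"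
proof -
  have s1: "1 - s = Complex (1/2) (- t)" by (simp add: s_def complex_eq_iff)
  have "- riemann_zeta (1 - s) / (1 - s) = (CLBINT y. of_real (mellin_frac y) * iexp (- (- t * y)))"
    unfolding s1 by (rule mellin_frac_Fourier[symmetric])
  also have "\<dots> = (CLBINT y. cnj (of_real (mellin_frac y) * iexp (- (t * y))))"
    by (intro Bochner_Integration.integral_cong refl) (simp add: exp_cnj)
  also have "\<dots> = cnj (CLBINT y. of_real (mellin_frac y) * iexp (- (t * y)))"
    by (rule Bochner_Integration.integral_cnj)
  also have "\<dots> = cnj (- riemann_zeta s / s)" unfolding s_def mellin_frac_Fourier ..
  finally have "(- riemann_zeta s / s) * cnj (- riemann_zeta s / s) = (- riemann_zeta s / s) * (- riemann_zeta (1 - s) / (1 - s))"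
    by simp
  moreover have "(- riemann_zeta s / s) * cnj (- riemann_zeta s / s) = of_real (zeta_sq t)"
    unfolding zeta_sq_def s_def by (simp only: complex_norm_square[symmetric] minus_divide_left[symmetric] norm_minus_cancel)
  ultimately show ?thesis by simp
qed

text \<open>A correlation transforms into the product of the transforms at \<open>t\<close> and
  \<open>- t\<close>. The double integral converges absolutely because the norm of the integrand
  integrates to the square of the integral of \<open>mellin_frac\<close>.\<close>

lemma frac_corr_integrable_Fourier:
  "integrable lborel frac_corr" "(CLBINT w. of_real (frac_corr w) * iexp (t * w)) = of_real (zeta_sq t)"
proof -
  have [measurable]: "frac_corr \<in> borel_measurable borel"
    using frac_corr_continuous by (rule borel_measurable_continuous_onI)
  let ?f = "\<lambda>y w. of_real (mellin_frac y * mellin_frac (y + w)) * iexp (t * w)"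
  have fm: "case_prod ?f \<in> borel_measurable (lborel \<Otimes>\<^sub>M lborel)" by measurable
  have shift: "integrable lborel (\<lambda>w. mellin_frac (y + w))" "(LBINT w. mellin_frac (y + w)) = (LBINT w. mellin_frac w)" for y
    using lborel_integrable_real_affine[OF mellin_frac_integrable, of 1 y] lborel_integral_real_affine[of 1 mellin_frac y] by simp_all
  have nf: "norm (?f y w) = mellin_frac y * mellin_frac (y + w)" for y w
    by (simp add: norm_mult abs_mult mellin_frac_norm)
  have fi: "integrable (lborel \<Otimes>\<^sub>M lborel) (case_prod ?f)"
  proof (rule lborel_pair.Fubini_integrable[OF fm])
    show "integrable lborel (\<lambda>y. LBINT w. norm (case_prod ?f (y, w)))"
      unfolding prod.case nf using shift mellin_frac_integrable by simp
    show "AE y in lborel. integrable lborel (\<lambda>w. case_prod ?f (y, w))"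
    proof (rule AE_I2)
      fix y
      show "integrable lborel (\<lambda>w. case_prod ?f (y, w))" unfolding prod.case
        by (intro integrable_iexp_bounded integrable_mult_right shift) measurable
    qed
  qed
  have inner: "(CLBINT y. ?f y w) = of_real (frac_corr w) * iexp (t * w)" for w
    unfolding integral_mult_left_zero frac_corr_def by (simp only: integral_complex_of_real)
  have "integrable lborel (\<lambda>w. CLBINT y. ?f y w)" by (rule lborel_pair.integrable_snd[OF fi])
  then have "integrable lborel (\<lambda>w. norm (of_real (frac_corr w) * iexp (t * w)))"
    unfolding inner by (rule integrable_norm)
  then show "integrable lborel frac_corr" by (simp add: norm_mult frac_corr_nonneg)
  have "(CLBINT w. of_real (frac_corr w) * iexp (t * w)) = (CLBINT w. CLBINT y. ?f y w)"
    by (simp only: inner)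
  also have "\<dots> = (CLBINT y. CLBINT w. ?f y w)" by (rule lborel_pair.Fubini_integral[OF fi])
  also have "\<dots> = (CLBINT y. of_real (mellin_frac y) * iexp (- (t * y)) * (CLBINT z. of_real (mellin_frac z) * iexp (- (- t * z))))"
  proof (intro Bochner_Integration.integral_cong refl)
    fix y :: real
    have "(CLBINT w. ?f y w) = (CLBINT w. of_real (mellin_frac y) * iexp (- (t * y)) * (of_real (mellin_frac (y + 1 * w)) * iexp (- (- t * (y + 1 * w)))))"
    proof (intro Bochner_Integration.integral_cong refl)
      fix w :: real
      have "\<i> * of_real (t * w) = \<i> * of_real (- (t * y)) + \<i> * of_real (- (- t * (y + 1 * w)))"
        by (simp add: algebra_simps)
      then have e: "iexp (t * w) = iexp (- (t * y)) * iexp (- (- t * (y + 1 * w)))"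
        by (simp only: exp_add)
      show "?f y w = of_real (mellin_frac y) * iexp (- (t * y)) * (of_real (mellin_frac (y + 1 * w)) * iexp (- (- t * (y + 1 * w))))"
        unfolding e by (simp only: of_real_mult mult_1 mult_ac)
    qed
    also have "\<dots> = of_real (mellin_frac y) * iexp (- (t * y)) * (CLBINT w. of_real (mellin_frac (y + 1 * w)) * iexp (- (- t * (y + 1 * w))))"
      by (rule integral_mult_right_zero)
    also have "(CLBINT w. of_real (mellin_frac (y + 1 * w)) * iexp (- (- t * (y + 1 * w)))) = (CLBINT z. of_real (mellin_frac z) * iexp (- (- t * z)))"
      using lborel_integral_real_affine[of 1 "\<lambda>z. of_real (mellin_frac z) * iexp (- (- t * z))" y] by simp
    finally show "(CLBINT w. ?f y w) = of_real (mellin_frac y) * iexp (- (t * y)) * (CLBINT z. of_real (mellin_frac z) * iexp (- (- t * z)))" .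
  qed
  also have "\<dots> = (CLBINT y. of_real (mellin_frac y) * iexp (- (t * y))) * (CLBINT z. of_real (mellin_frac z) * iexp (- (- t * z)))"
    by (rule integral_mult_left_zero)
  also have "\<dots> = (- riemann_zeta (Complex (1/2) t) / Complex (1/2) t) * (- riemann_zeta (Complex (1/2) (- t)) / Complex (1/2) (- t))"
    unfolding mellin_frac_Fourier ..
  also have "Complex (1/2) (- t) = 1 - Complex (1/2) t" by (simp add: complex_eq_iff)
  finally show "(CLBINT w. of_real (frac_corr w) * iexp (t * w)) = of_real (zeta_sq t)"
    unfolding zeta_sq_eq by simp
qed

lemma zeta_sq_inversion:
  "integrable lborel zeta_sq" "(CLBINT t. of_real (zeta_sq t) * iexp (t * w)) = of_real (2 * pi * frac_corr w)"
proof -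
  have P0: "zeta_sq t \<ge> 0" for t by (simp add: zeta_sq_def)
  note F = Fourier_inversion_nonneg[OF frac_corr_integrable_Fourier(1) frac_corr_continuous frac_corr_bound frac_corr_integrable_Fourier(2) P0]
  show "integrable lborel zeta_sq" by (rule F)
  show "(CLBINT t. of_real (zeta_sq t) * iexp (t * w)) = of_real (2 * pi * frac_corr w)"
    using F(2)[of "- w"] by (simp add: frac_corr_even)
qed

section \<open>The two kernels in terms of the correlation\<close>

lemma gram_integrand_eq:
  assumes "u > 0" "v > 0"
  shows "gram_integrand 1 u v (Complex (1/2) t) = of_real (1 / sqrt (u * v)) * (of_real (zeta_sq t) * iexp (t * ln (v / u)))"
    and "gram_integrand 2 u v (Complex (1/2) t) = of_real (1 / sqrt (u * v)) * (of_real (zeta_sq t) * iexp (t * ln (v / u))) * (1 / of_real (1/4 + t\<^sup>2))"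
proof -
  define s where "s = Complex (1/2) t"
  \<comment> \<open>On the critical line the two powers have product of modulus
    \<open>1 / sqrt (u * v)\<close> and phase \<open>t * ln (v / u)\<close>; this makes the kernel a
    Fourier integral at \<open>ln (v / u)\<close>.\<close>
  have p: "of_real u powr (- s) * of_real v powr (- (1 - s)) = of_real (1 / sqrt (u * v)) * iexp (t * ln (v / u))"
  proof -
    have "of_real u powr (- s) * of_real v powr (- (1 - s)) = exp (- s * of_real (ln u) + - (1 - s) * of_real (ln v))"
      using assms by (simp add: powr_def Ln_of_real exp_add[symmetric])
    also have "- s * of_real (ln u) + - (1 - s) * of_real (ln v) = of_real (- ((ln u + ln v) / 2)) + \<i> * of_real (t * ln (v / u))"
      using assms by (simp add: s_def complex_eq_iff ln_div algebra_simps add_divide_distrib)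
    also have "exp \<dots> = of_real (exp (- ((ln u + ln v) / 2))) * iexp (t * ln (v / u))"
      by (simp only: exp_add exp_of_real)
    also have "exp (- ((ln u + ln v) / 2)) = 1 / sqrt (u * v)"
    proof -
      have "sqrt (u * v) = (u * v) powr (1/2)" using assms by (simp add: powr_half_sqrt)
      also have "\<dots> = exp ((ln u + ln v) / 2)" using assms by (simp add: powr_def ln_mult)
      finally have A: "sqrt (u * v) = exp ((ln u + ln v) / 2)" .
      show ?thesis unfolding A exp_minus by (rule inverse_eq_divide)
    qed
    finally show ?thesis .
  qed
  have z: "riemann_zeta s * riemann_zeta (1 - s) / (s * (1 - s)) = of_real (zeta_sq t)"
    unfolding s_def by (rule zeta_sq_eq[symmetric])
  have ss: "s * (1 - s) = of_real (1/4 + t\<^sup>2)" by (simp add: s_def complex_eq_iff power2_eq_square)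
  show "gram_integrand 1 u v (Complex (1/2) t) = of_real (1 / sqrt (u * v)) * (of_real (zeta_sq t) * iexp (t * ln (v / u)))"
    unfolding gram_integrand_def s_def[symmetric] p z[symmetric] by simp
  show "gram_integrand 2 u v (Complex (1/2) t) = of_real (1 / sqrt (u * v)) * (of_real (zeta_sq t) * iexp (t * ln (v / u))) * (1 / of_real (1/4 + t\<^sup>2))"
    unfolding gram_integrand_def s_def[symmetric] p z[symmetric] ss[symmetric] by (simp add: power2_eq_square mult_ac)
qed

lemma gram_1_eq_frac_corr:
  assumes "u > 0" "v > 0"
  shows "integrable lborel (\<lambda>t. gram_integrand 1 u v (Complex (1/2) t))"
    and "gram_kernel 1 u v = of_real (frac_corr (ln (v / u)) / sqrt (u * v))"
proof -
  show "integrable lborel (\<lambda>t. gram_integrand 1 u v (Complex (1/2) t))"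
    unfolding gram_integrand_eq[OF assms]
    by (intro integrable_mult_right integrable_iexp_bounded zeta_sq_inversion) measurable
  have "(CLBINT t. gram_integrand 1 u v (Complex (1/2) t) * \<i>) = of_real (1 / sqrt (u * v)) * of_real (2 * pi * frac_corr (ln (v / u))) * \<i>"
    unfolding gram_integrand_eq[OF assms] integral_mult_left_zero integral_mult_right_zero zeta_sq_inversion ..
  then show "gram_kernel 1 u v = of_real (frac_corr (ln (v / u)) / sqrt (u * v))"
    unfolding gram_kernel_def by simp
qed

text \<open>The additional factor \<open>1 / (1/4 + t^2)\<close> is replaced by its integral
  representation. After exchanging the integrals, the inner one is the inversion formula at
  \<open>w - y\<close>; the same use of Fubini yields the integrability in \<open>t\<close>.\<close>

lemma gram_2_eq_frac_corr:
  assumes "u > 0" "v > 0"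
  shows "integrable lborel (\<lambda>t. gram_integrand 2 u v (Complex (1/2) t))"
    and "gram_kernel 2 u v = of_real ((LBINT y. exp (- (1/2 * \<bar>ln (v / u) - y\<bar>)) * frac_corr y) / sqrt (u * v))"
proof -
  define w where "w = ln (v / u)"
  let ?e = "\<lambda>y :: real. exp (- (1/2 * \<bar>y\<bar>))"
  have [measurable]: "zeta_sq \<in> borel_measurable borel" using zeta_sq_inversion(1) by (auto dest: borel_measurable_integrable)
  have [measurable]: "frac_corr \<in> borel_measurable borel"
    using frac_corr_continuous by (rule borel_measurable_continuous_onI)
  let ?f = "\<lambda>t y. of_real (zeta_sq t) * iexp (t * w) * (of_real (?e y) * iexp (- (t * y)))"
  have ie: "integrable lborel ?e" by (rule integrable_exp_neg_abs) simp
  have nz: "\<bar>zeta_sq t\<bar> = zeta_sq t" for t by (simp add: zeta_sq_def)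
  have fm: "case_prod ?f \<in> borel_measurable (lborel \<Otimes>\<^sub>M lborel)" by measurable
  have fi: "integrable (lborel \<Otimes>\<^sub>M lborel) (case_prod ?f)"
  proof (rule lborel_pair.Fubini_integrable[OF fm])
    show "integrable lborel (\<lambda>t. LBINT y. norm (case_prod ?f (t, y)))"
      using ie zeta_sq_inversion(1) by (simp add: norm_mult nz)
    show "AE t in lborel. integrable lborel (\<lambda>y. case_prod ?f (t, y))"
    proof (rule AE_I2)
      fix t
      show "integrable lborel (\<lambda>y. case_prod ?f (t, y))" unfolding prod.case
        by (intro integrable_mult_right integrable_iexp_bounded ie) measurable
    qed
  qed
  have inner: "(CLBINT y. ?f t y) = of_real (zeta_sq t) * iexp (t * w) * (1 / of_real (1/4 + t\<^sup>2))" for t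
    unfolding integral_mult_right_zero exp_neg_abs_transform ..
  have "integrable lborel (\<lambda>t. CLBINT y. ?f t y)" by (rule lborel_pair.integrable_fst[OF fi])
  then have i2: "integrable lborel (\<lambda>t. of_real (zeta_sq t) * iexp (t * w) * (1 / of_real (1/4 + t\<^sup>2)))"
    by (simp only: inner)
  show "integrable lborel (\<lambda>t. gram_integrand 2 u v (Complex (1/2) t))"
    unfolding gram_integrand_eq[OF assms] w_def[symmetric] mult.assoc[of "of_real (1 / sqrt (u * v))"]
    by (intro integrable_mult_right i2)
  have "(CLBINT t. of_real (zeta_sq t) * iexp (t * w) * (1 / of_real (1/4 + t\<^sup>2))) = (CLBINT t. CLBINT y. ?f t y)"
    by (simp only: inner)
  also have "\<dots> = (CLBINT y. CLBINT t. ?f t y)" by (rule lborel_pair.Fubini_integral[OF fi, symmetric])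
  also have "\<dots> = (CLBINT y. of_real (?e y * (2 * pi * frac_corr (w - y))))"
  proof (intro Bochner_Integration.integral_cong refl)
    fix y :: real
    have "(CLBINT t. ?f t y) = (CLBINT t. of_real (?e y) * (of_real (zeta_sq t) * iexp (t * (w - y))))"
    proof (intro Bochner_Integration.integral_cong refl)
      fix t :: real
      have "\<i> * of_real (t * w) + \<i> * of_real (- (t * y)) = \<i> * of_real (t * (w - y))"
        by (simp add: algebra_simps)
      then have e: "iexp (t * w) * iexp (- (t * y)) = iexp (t * (w - y))"
        by (simp only: exp_add[symmetric])
      show "?f t y = of_real (?e y) * (of_real (zeta_sq t) * iexp (t * (w - y)))"
        unfolding e[symmetric] by (simp only: mult_ac)
    qed
    also have "\<dots> = of_real (?e y) * of_real (2 * pi * frac_corr (w - y))"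
      unfolding integral_mult_right_zero zeta_sq_inversion ..
    finally show "(CLBINT t. ?f t y) = of_real (?e y * (2 * pi * frac_corr (w - y)))" by simp
  qed
  also have "\<dots> = of_real (LBINT y. ?e y * (2 * pi * frac_corr (w - y)))" by (rule integral_complex_of_real)
  also have "(LBINT y. ?e y * (2 * pi * frac_corr (w - y))) = \<bar>-1\<bar> *\<^sub>R (LBINT y. ?e (w + (-1) * y) * (2 * pi * frac_corr (w - (w + (-1) * y))))"
    by (rule lborel_integral_real_affine) simp
  also have "\<dots> = (LBINT y. 2 * pi * (exp (- (1/2 * \<bar>w - y\<bar>)) * frac_corr y))" by (simp add: mult_ac)
  also have "\<dots> = 2 * pi * (LBINT y. exp (- (1/2 * \<bar>w - y\<bar>)) * frac_corr y)" by (rule integral_mult_right_zero)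
  finally have I: "(CLBINT t. of_real (zeta_sq t) * iexp (t * w) * (1 / of_real (1/4 + t\<^sup>2))) = of_real (2 * pi * (LBINT y. exp (- (1/2 * \<bar>w - y\<bar>)) * frac_corr y))" .
  have "(CLBINT t. gram_integrand 2 u v (Complex (1/2) t) * \<i>) = of_real (1 / sqrt (u * v)) * of_real (2 * pi * (LBINT y. exp (- (1/2 * \<bar>w - y\<bar>)) * frac_corr y)) * \<i>"
    unfolding gram_integrand_eq[OF assms] w_def[symmetric] mult.assoc[of "of_real (1 / sqrt (u * v))"] integral_mult_left_zero[where c = \<i>] integral_mult_right_zero I ..
  then show "gram_kernel 2 u v = of_real ((LBINT y. exp (- (1/2 * \<bar>ln (v / u) - y\<bar>)) * frac_corr y) / sqrt (u * v))"
    unfolding gram_kernel_def w_def by simp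
qed

section \<open>Piecewise differentiable functions\<close>

abbreviation nats_upto :: "real \<Rightarrow> nat set" where
  "nats_upto x \<equiv> {k::nat. 1 \<le> k \<and> real k \<le> x}"

lemma nats_upto_eq: "nats_upto x = {1..nat \<lfloor>x\<rfloor>}"
  by (auto; linarith)

lemma finite_nats_upto [simp]: "finite (nats_upto x)"
  unfolding nats_upto_eq by simp

lemma nats_upto_of_nat: "nats_upto (real n) = {1..n}"
  unfolding nats_upto_eq by simp

lemma card_nats_upto: "x \<ge> 0 \<Longrightarrow> real (card (nats_upto x)) = real_of_int \<lfloor>x\<rfloor>"
  unfolding nats_upto_eq by simp

definition locally_finite :: "real set \<Rightarrow> bool" where
  "locally_finite E \<longleftrightarrow> (\<forall>a b. finite (E \<inter> {a..b}))"

text \<open>The setting for functions built from \<open>frac\<close> and from sums over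
  \<open>k \<le> t\<close>: continuity together with a derivative off a locally finite set suffices
  for the fundamental theorem of calculus. The exceptional set is an explicit argument, so that sums
  and products simply unite these sets.\<close>

definition pw_deriv :: "real set \<Rightarrow> (real \<Rightarrow> real) \<Rightarrow> (real \<Rightarrow> real) \<Rightarrow> bool" where
  "pw_deriv E f f' \<longleftrightarrow> locally_finite E \<and> continuous_on {0<..} f \<and>
     (\<forall>t>0. t \<notin> E \<longrightarrow> (f has_real_derivative f' t) (at t))"

lemma locally_finite_empty: "locally_finite {}"
  and locally_finite_Un: "locally_finite A \<Longrightarrow> locally_finite B \<Longrightarrow> locally_finite (A \<union> B)"
  by (auto simp: locally_finite_def Int_Un_distrib2)

lemma locally_finite_scaled_nats:
  assumes "c > 0"
  shows "locally_finite (range (\<lambda>k::nat. c * real k))"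
  unfolding locally_finite_def
proof (intro allI)
  fix a b
  have "range (\<lambda>k::nat. c * real k) \<inter> {a..b} \<subseteq> (\<lambda>k. c * real k) ` {..nat \<lceil>b / c\<rceil>}"
  proof
    fix x assume "x \<in> range (\<lambda>k::nat. c * real k) \<inter> {a..b}"
    then obtain k :: nat where k: "x = c * real k" "c * real k \<le> b" by auto
    then have "real k \<le> b / c" using assms by (simp add: field_simps)
    then have "k \<le> nat \<lceil>b / c\<rceil>" by linarith
    then show "x \<in> (\<lambda>k. c * real k) ` {..nat \<lceil>b / c\<rceil>}" using k by auto
  qed
  then show "finite (range (\<lambda>k::nat. c * real k) \<inter> {a..b})" by (rule finite_subset) auto
qed

lemma pw_deriv_smooth:
  assumes "\<And>t. t > 0 \<Longrightarrow> (f has_real_derivative f' t) (at t)"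
  shows "pw_deriv {} f f'"
  unfolding pw_deriv_def
proof (intro conjI allI impI)
  show "continuous_on {0<..} f"
    by (rule DERIV_continuous_on[of _ _ f'], rule has_field_derivative_at_within, rule assms) simp
qed (use assms locally_finite_empty in blast)+

lemma pw_deriv_add: "pw_deriv E f f' \<Longrightarrow> pw_deriv E' g g' \<Longrightarrow> pw_deriv (E \<union> E') (\<lambda>t. f t + g t) (\<lambda>t. f' t + g' t)"
proof -
  assume f: "pw_deriv E f f'" and g: "pw_deriv E' g g'"
  show ?thesis unfolding pw_deriv_def
  proof (intro conjI allI impI)
    show "locally_finite (E \<union> E')" using f g by (simp add: pw_deriv_def locally_finite_Un)
    show "continuous_on {0<..} (\<lambda>t. f t + g t)" using f g by (simp add: pw_deriv_def continuous_on_add)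
    fix t :: real assume "t > 0" "t \<notin> E \<union> E'"
    then have "(f has_real_derivative f' t) (at t)" "(g has_real_derivative g' t) (at t)" using f g by (auto simp: pw_deriv_def)
    then show "((\<lambda>t. f t + g t) has_real_derivative f' t + g' t) (at t)" by (rule DERIV_add)
  qed
qed

lemma pw_deriv_diff: "pw_deriv E f f' \<Longrightarrow> pw_deriv E' g g' \<Longrightarrow> pw_deriv (E \<union> E') (\<lambda>t. f t - g t) (\<lambda>t. f' t - g' t)"
proof -
  assume f: "pw_deriv E f f'" and g: "pw_deriv E' g g'"
  show ?thesis unfolding pw_deriv_def
  proof (intro conjI allI impI)
    show "locally_finite (E \<union> E')" using f g by (simp add: pw_deriv_def locally_finite_Un)
    show "continuous_on {0<..} (\<lambda>t. f t - g t)" using f g by (simp add: pw_deriv_def continuous_on_diff)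
    fix t :: real assume "t > 0" "t \<notin> E \<union> E'"
    then have "(f has_real_derivative f' t) (at t)" "(g has_real_derivative g' t) (at t)" using f g by (auto simp: pw_deriv_def)
    then show "((\<lambda>t. f t - g t) has_real_derivative f' t - g' t) (at t)" by (rule DERIV_diff)
  qed
qed

lemma pw_deriv_mult: "pw_deriv E f f' \<Longrightarrow> pw_deriv E' g g' \<Longrightarrow> pw_deriv (E \<union> E') (\<lambda>t. f t * g t) (\<lambda>t. f' t * g t + g' t * f t)"
proof -
  assume f: "pw_deriv E f f'" and g: "pw_deriv E' g g'"
  show ?thesis unfolding pw_deriv_def
  proof (intro conjI allI impI)
    show "locally_finite (E \<union> E')" using f g by (simp add: pw_deriv_def locally_finite_Un)
    show "continuous_on {0<..} (\<lambda>t. f t * g t)" using f g by (simp add: pw_deriv_def continuous_on_mult)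
    fix t :: real assume "t > 0" "t \<notin> E \<union> E'"
    then have "(f has_real_derivative f' t) (at t)" "(g has_real_derivative g' t) (at t)" using f g by (auto simp: pw_deriv_def)
    then show "((\<lambda>t. f t * g t) has_real_derivative f' t * g t + g' t * f t) (at t)" by (rule DERIV_mult)
  qed
qed

lemma pw_deriv_cong:
  assumes "pw_deriv E f f'" "\<And>t. t > 0 \<Longrightarrow> f t = g t" "\<And>t. t > 0 \<Longrightarrow> t \<notin> E \<Longrightarrow> f' t = g' t"
  shows "pw_deriv E g g'"
  unfolding pw_deriv_def
proof (intro conjI allI impI)
  show "locally_finite E" using assms by (simp add: pw_deriv_def)
  have "continuous_on {0<..} f" using assms by (simp add: pw_deriv_def)
  then show "continuous_on {0<..} g" by (rule continuous_on_cong[THEN iffD1, rotated 2]) (use assms in auto)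
  fix t :: real assume t: "t > 0" "t \<notin> E"
  then have "(f has_real_derivative g' t) (at t)" using assms by (auto simp: pw_deriv_def)
  then show "(g has_real_derivative g' t) (at t)"
    by (rule has_field_derivative_transform_within_open[of _ _ _ "{0<..}"]) (use t assms in auto)
qed

lemma pw_deriv_const: "pw_deriv {} (\<lambda>t. c) (\<lambda>t. 0)"
  by (rule pw_deriv_smooth) auto

text \<open>Each summand vanishes where it enters the sum, so the sum stays continuous there.\<close>

lemma pw_deriv_sum_upto:
  assumes c: "c > 0" and \<phi>: "\<And>k. k \<ge> 1 \<Longrightarrow> pw_deriv E (\<phi> k) (\<phi>' k)" and z: "\<And>k. k \<ge> 1 \<Longrightarrow> \<phi> k (c * real k) = 0"
    and E: "locally_finite E"
  shows "pw_deriv (E \<union> range (\<lambda>k::nat. c * real k)) (\<lambda>t. \<Sum>k\<in>nats_upto (t / c). \<phi> k t) (\<lambda>t. \<Sum>k\<in>nats_upto (t / c). \<phi>' k t)"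
  unfolding pw_deriv_def
proof (intro conjI allI impI)
  show "locally_finite (E \<union> range (\<lambda>k::nat. c * real k))"
    by (intro locally_finite_Un E locally_finite_scaled_nats c)
  have cont: "continuous_on {0<..<c * real n} (\<lambda>t. \<Sum>k\<in>nats_upto (t / c). \<phi> k t)" for n :: nat
  proof -
    \<comment> \<open>Replacing \<open>t\<close> by \<open>max t (c * real k)\<close> freezes each
      summand at its zero until it enters. The sum of varying length thereby becomes a fixed finite
      sum of continuous functions.\<close>
    have "continuous_on {0<..<c * real n} (\<lambda>t. \<Sum>k=1..n. \<phi> k (max t (c * real k)))"
    proof (intro continuous_on_sum)
      fix k assume "k \<in> {1..n}"
      then have k: "k \<ge> 1" by simp
      show "continuous_on {0<..<c * real n} (\<lambda>t. \<phi> k (max t (c * real k)))"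
        by (rule continuous_on_compose2[of "{0<..}" "\<phi> k"])
           (use \<phi>[OF k] in \<open>auto simp: pw_deriv_def intro!: continuous_intros\<close>)
    qed
    moreover have "(\<Sum>k=1..n. \<phi> k (max t (c * real k))) = (\<Sum>k\<in>nats_upto (t / c). \<phi> k t)" if t: "t \<in> {0<..<c * real n}" for t
    proof -
      have "(\<Sum>k=1..n. \<phi> k (max t (c * real k))) = (\<Sum>k\<in>{1..n}. if real k \<le> t / c then \<phi> k t else 0)"
      proof (intro sum.cong refl)
        fix k assume "k \<in> {1..n}"
        then show "\<phi> k (max t (c * real k)) = (if real k \<le> t / c then \<phi> k t else 0)"
          using c z[of k] by (auto simp: max_def field_simps)
      qed
      also have "\<dots> = (\<Sum>k\<in>{k\<in>{1..n}. real k \<le> t / c}. \<phi> k t)"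
        by (rule sum.inter_filter[symmetric]) simp
      also have "{k\<in>{1..n}. real k \<le> t / c} = nats_upto (t / c)"
      proof -
        have "k \<le> n" if "real k \<le> t / c" for k
        proof -
          have "t / c < real n" using t c by (simp add: field_simps)
          with that have "real k < real n" by linarith
          then show ?thesis by simp
        qed
        then show ?thesis by auto
      qed
      finally show ?thesis .
    qed
    ultimately show ?thesis by (rule continuous_on_eq)
  qed
  show "continuous_on {0<..} (\<lambda>t. \<Sum>k\<in>nats_upto (t / c). \<phi> k t)"
    unfolding continuous_on_eq_continuous_at[OF open_greaterThan]
  proof
    fix t :: real assume t: "t \<in> {0<..}"
    obtain n :: nat where n: "t / c < real n" using reals_Archimedean2 by blast
    then have "t \<in> {0<..<c * real n}" using t c by (simp add: field_simps)
    then show "isCont (\<lambda>t. \<Sum>k\<in>nats_upto (t / c). \<phi> k t) t"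
      using cont[of n] by (simp add: continuous_on_eq_continuous_at)
  qed
  fix t :: real assume t: "t > 0" "t \<notin> E \<union> range (\<lambda>k::nat. c * real k)"
  \<comment> \<open>As \<open>t\<close> is not a grid point, it lies strictly between two
    consecutive ones, and the index set of the sum is constant in between.\<close>
  define n where "n = \<lfloor>t / c\<rfloor>"
  have n0: "n \<ge> 0" using t c by (simp add: n_def)
  have nt: "c * real_of_int n < t"
  proof -
    have "c * real_of_int n \<le> t" using c unfolding n_def by (metis floor_correct pos_le_divide_eq mult.commute)
    moreover have "c * real_of_int n \<noteq> t"
    proof
      assume a: "c * real_of_int n = t"
      have "t = c * real (nat n)" unfolding a[symmetric] using n0 by simp
      then show False using t by blast
    qed
    ultimately show ?thesis by simp
  qed
  have nt2: "t < c * (real_of_int n + 1)"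
  proof -
    have "t / c < real_of_int n + 1" unfolding n_def by linarith
    then show ?thesis using c by (simp add: pos_divide_less_eq mult.commute)
  qed
  have same: "nats_upto (z / c) = nats_upto (t / c)" if "z \<in> {c * real_of_int n<..<c * (real_of_int n + 1)}" for z
  proof -
    have "real_of_int n \<le> z / c" "z / c < real_of_int n + 1"
      using that c by (simp_all add: field_simps)
    then have "\<lfloor>z / c\<rfloor> = n" by (simp add: floor_eq_iff)
    then show ?thesis unfolding nats_upto_eq n_def by simp
  qed
  have "((\<lambda>z. \<Sum>k\<in>nats_upto (t / c). \<phi> k z) has_real_derivative (\<Sum>k\<in>nats_upto (t / c). \<phi>' k t)) (at t)"
    by (rule DERIV_sum) (use \<phi> t in \<open>auto simp: pw_deriv_def\<close>)
  then show "((\<lambda>t. \<Sum>k\<in>nats_upto (t / c). \<phi> k t) has_real_derivative (\<Sum>k\<in>nats_upto (t / c). \<phi>' k t)) (at t)"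
  proof (rule has_field_derivative_transform_within_open)
    show "open {c * real_of_int n<..<c * (real_of_int n + 1)}" by simp
    show "t \<in> {c * real_of_int n<..<c * (real_of_int n + 1)}" using nt nt2 by simp
    fix z assume "z \<in> {c * real_of_int n<..<c * (real_of_int n + 1)}"
    from same[OF this] show "(\<Sum>k\<in>nats_upto (t / c). \<phi> k z) = (\<Sum>k\<in>nats_upto (z / c). \<phi> k z)"
      by (simp only:)
  qed
qed

lemma pw_deriv_integral:
  assumes f: "pw_deriv E f f'" and ab: "0 < a" "a \<le> b"
  shows "(f' has_integral (f b - f a)) {a..b}"
proof (rule fundamental_theorem_of_calculus_interior_strong[of "E \<inter> {a..b}" a b f f'])
  show "finite (E \<inter> {a..b})" using f by (auto simp: pw_deriv_def locally_finite_def)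
  show "continuous_on {a..b} f" using f ab by (auto simp: pw_deriv_def intro: continuous_on_subset)
  fix t assume "t \<in> {a<..<b} - E \<inter> {a..b}"
  then show "(f has_vector_derivative f' t) (at t)"
    using f ab by (auto simp: pw_deriv_def has_real_derivative_iff_has_vector_derivative[symmetric])
qed (use ab in auto)

text \<open>The substitution \<open>t = c * exp y\<close>, carried out on the antiderivative. The
  finitely many exceptional points in the range are pulled back by the logarithm.\<close>

lemma pw_deriv_integral_exp:
  assumes f: "pw_deriv E f f'" and c: "c > 0" and ab: "a \<le> b"
  shows "((\<lambda>y. f' (c * exp y) * (c * exp y)) has_integral (f (c * exp b) - f (c * exp a))) {a..b}"
proof (rule fundamental_theorem_of_calculus_interior_strong[of "(\<lambda>t. ln (t / c)) ` (E \<inter> {c * exp a..c * exp b})" a b "\<lambda>y. f (c * exp y)"])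
  show "finite ((\<lambda>t. ln (t / c)) ` (E \<inter> {c * exp a..c * exp b}))"
    using f by (auto simp: pw_deriv_def locally_finite_def)
  show "continuous_on {a..b} (\<lambda>y. f (c * exp y))"
    by (rule continuous_on_compose2[of "{0<..}" f]) (use f c in \<open>auto simp: pw_deriv_def intro!: continuous_intros\<close>)
  fix y assume y: "y \<in> {a<..<b} - (\<lambda>t. ln (t / c)) ` (E \<inter> {c * exp a..c * exp b})"
  have nE: "c * exp y \<notin> E"
  proof
    assume "c * exp y \<in> E"
    then have "c * exp y \<in> E \<inter> {c * exp a..c * exp b}" using y c by auto
    moreover have "ln ((c * exp y) / c) = y" using c by simp
    ultimately have "y \<in> (\<lambda>t. ln (t / c)) ` (E \<inter> {c * exp a..c * exp b})" by (metis image_eqI)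
    then show False using y by blast
  qed
  have "((\<lambda>y. f (c * exp y)) has_real_derivative (f' (c * exp y) * (c * exp y))) (at y)"
  proof (rule DERIV_chain2[where f = f and g = "\<lambda>y. c * exp y"])
    show "(f has_real_derivative f' (c * exp y)) (at (c * exp y))"
      using f c nE by (auto simp: pw_deriv_def)
  qed (auto intro!: derivative_eq_intros)
  then show "((\<lambda>y. f (c * exp y)) has_vector_derivative f' (c * exp y) * (c * exp y)) (at y)"
    by (simp add: has_real_derivative_iff_has_vector_derivative)
qed (use ab in auto)

lemma pw_deriv_mono:
  assumes f: "pw_deriv E f f'" and ab: "0 < a" "a \<le> b" and nn: "\<And>t. t \<ge> a \<Longrightarrow> f' t \<ge> 0"
  shows "f a \<le> f b"
proof -
  have "0 \<le> f b - f a"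
    by (rule has_integral_nonneg[OF pw_deriv_integral[OF f ab]]) (use nn in auto)
  then show ?thesis by simp
qed

lemma pw_deriv_le_limit:
  assumes f: "pw_deriv E f f'" and a: "0 < a" and nn: "\<And>t. t \<ge> a \<Longrightarrow> f' t \<ge> 0"
    and lim: "(\<lambda>n. f (real n)) \<longlonglongrightarrow> 0"
  shows "f a \<le> 0"
proof (rule LIMSEQ_le_const[OF lim])
  show "\<exists>N. \<forall>n\<ge>N. f a \<le> f (real n)"
  proof (intro exI allI impI)
    fix n assume "nat \<lceil>a\<rceil> \<le> n"
    then have "a \<le> real n" by linarith
    then show "f a \<le> f (real n)" by (intro pw_deriv_mono[OF f a] nn)
  qed
qed

text \<open>Both \<open>f t - C / t ^ p\<close> and \<open>- f t - C / t ^ p\<close> are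
  nondecreasing and tend to 0 along the integers, hence are nonpositive. Monotonicity makes the
  limit along the integers sufficient.\<close>

lemma pw_deriv_decay:
  assumes f: "pw_deriv E f f'" and a: "0 < a" and p: "p \<ge> 1" and C: "\<And>t. t > 0 \<Longrightarrow> \<bar>f' t\<bar> \<le> real p * C / t ^ Suc p"
    and lim: "(\<lambda>n. f (real n)) \<longlonglongrightarrow> 0"
  shows "\<bar>f a\<bar> \<le> C / a ^ p"
proof -
  have D: "((\<lambda>t. C / t ^ p) has_real_derivative (- (real p * C / t ^ Suc p))) (at t)" if "t > 0" for t
  proof -
    have "t ^ p = t ^ (p - 1) * t" using p by (metis power_minus_mult less_le_trans zero_less_one)
    then show ?thesis using that by (auto intro!: derivative_eq_intros simp: field_simps)
  qed
  have l: "(\<lambda>n. C / real n ^ p) \<longlonglongrightarrow> 0"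
  proof (rule tendsto_divide_0[OF tendsto_const])
    show "filterlim (\<lambda>n. real n ^ p) at_infinity sequentially"
      using p by (intro filterlim_at_top_imp_at_infinity filterlim_pow_at_top filterlim_real_sequentially) auto
  qed
  have s: "pw_deriv {} (\<lambda>t. C / t ^ p) (\<lambda>t. - (real p * C / t ^ Suc p))" by (rule pw_deriv_smooth) (rule D)
  have "f a - C / a ^ p \<le> 0"
  proof (rule pw_deriv_le_limit[OF pw_deriv_diff[OF f s] a])
    show "(\<lambda>n. f (real n) - C / real n ^ p) \<longlonglongrightarrow> 0" using tendsto_diff[OF lim l] by simp
    fix t assume "a \<le> t"
    then show "0 \<le> f' t - - (real p * C / t ^ Suc p)" using C[of t] a by linarith
  qed
  moreover have "(0 - f a) - C / a ^ p \<le> 0"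
  proof (rule pw_deriv_le_limit[OF pw_deriv_diff[OF pw_deriv_diff[OF pw_deriv_const f] s] a])
    show "(\<lambda>n. 0 - f (real n) - C / real n ^ p) \<longlonglongrightarrow> 0" using tendsto_diff[OF tendsto_diff[OF tendsto_const[of 0] lim] l] by simp
    fix t assume "a \<le> t"
    then show "0 \<le> 0 - f' t - - (real p * C / t ^ Suc p)" using C[of t] a by linarith
  qed
  ultimately show ?thesis by (simp add: abs_le_iff)
qed

section \<open>The remainders R1 and R2\<close>

abbreviation "\<gamma>\<^sub>0 \<equiv> stieltjes 0"
abbreviation "\<gamma>\<^sub>1 \<equiv> stieltjes 1"

text \<open>\<open>T_aux y = R2 y + y * R2' y\<close>, the derivative of \<open>y * R2 y\<close> away from the positive integers.\<close>

definition T_aux :: "real \<Rightarrow> real" where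
  "T_aux y = 1 / (2 * y) + (1 - \<gamma>\<^sub>0) * ln y - (ln y)\<^sup>2 / 2 + \<gamma>\<^sub>0 + \<gamma>\<^sub>1 - 1
     + (\<Sum>l\<in>nats_upto y. ln (y / real l) / real l + 1 / y - 1 / real l)"

text \<open>The floor hidden in \<open>frac\<close> counts the summands of \<open>H\<close>, so its
  share \<open>1 / y\<close> can be moved into each of them. Every summand then vanishes at
  \<open>y = k\<close>, which shows that the jumps of \<open>H\<close> and of \<open>frac\<close>
  cancel.\<close>

lemma R1_alt:
  assumes "y > 0"
  shows "R1 y = ln y + \<gamma>\<^sub>0 - 1 + 1 / (2 * y) - (\<Sum>k\<in>nats_upto y. 1 / real k - 1 / y)"
proof -
  have "(\<Sum>k\<in>nats_upto y. 1 / real k - 1 / y) = H y - real_of_int \<lfloor>y\<rfloor> / y"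
    unfolding sum_subtractf H_def using card_nats_upto[of y] assms by simp
  then show ?thesis using assms by (simp add: R1_def frac_def field_simps)
qed

lemma R1_pw: "pw_deriv (range real) R1 (\<lambda>y. (frac y - 1/2) / y\<^sup>2)"
proof -
  have s: "pw_deriv {} (\<lambda>y. ln y + \<gamma>\<^sub>0 - 1 + 1 / (2 * y)) (\<lambda>y. 1 / y - 1 / (2 * y\<^sup>2))"
    by (rule pw_deriv_smooth) (auto intro!: derivative_eq_intros simp: field_simps power2_eq_square)
  have t: "pw_deriv ({} \<union> range (\<lambda>k::nat. 1 * real k)) (\<lambda>y. \<Sum>k\<in>nats_upto (y / 1). 1 / real k - 1 / y) (\<lambda>y. \<Sum>k\<in>nats_upto (y / 1). 1 / y\<^sup>2)"
    by (rule pw_deriv_sum_upto)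
       (auto intro!: pw_deriv_smooth locally_finite_empty derivative_eq_intros simp: power2_eq_square)
  show ?thesis
  proof (rule pw_deriv_cong[where E = "range real"])
    show "pw_deriv (range real) (\<lambda>y. (ln y + \<gamma>\<^sub>0 - 1 + 1 / (2 * y)) - (\<Sum>k\<in>nats_upto (y / 1). 1 / real k - 1 / y))
      (\<lambda>y. (1 / y - 1 / (2 * y\<^sup>2)) - (\<Sum>k\<in>nats_upto (y / 1). 1 / y\<^sup>2))"
      using pw_deriv_diff[OF s t] by simp
    fix y :: real assume y: "y > 0"
    then show "(ln y + \<gamma>\<^sub>0 - 1 + 1 / (2 * y)) - (\<Sum>k\<in>nats_upto (y / 1). 1 / real k - 1 / y) = R1 y"
      by (simp add: R1_alt)
    have "(\<Sum>k\<in>nats_upto (y / 1). 1 / y\<^sup>2) = real_of_int \<lfloor>y\<rfloor> / y\<^sup>2"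
      using card_nats_upto[of y] y by simp
    then show "(1 / y - 1 / (2 * y\<^sup>2)) - (\<Sum>k\<in>nats_upto (y / 1). 1 / y\<^sup>2) = (frac y - 1/2) / y\<^sup>2"
      using y by (simp add: frac_def field_simps power2_eq_square)
  qed
qed

lemma H_of_nat: "H (real n) = harm n"
  unfolding H_def nats_upto_of_nat by (simp add: harm_def inverse_eq_divide)

lemma harm_limit: "(\<lambda>n. harm n - ln (real n)) \<longlonglongrightarrow> \<gamma>\<^sub>0"
  unfolding stieltjes_0 by (rule euler_mascheroni_LIMSEQ)

lemma frac_of_nat [simp]: "frac (real n) = 0"
  by (simp add: frac_def)

lemma R1_nat_limit: "(\<lambda>n. R1 (real n)) \<longlonglongrightarrow> 0"
proof -
  have "(\<lambda>n. \<gamma>\<^sub>0 - (harm n - ln (real n)) + 1 / (2 * real n)) \<longlonglongrightarrow> \<gamma>\<^sub>0 - \<gamma>\<^sub>0 + 0"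
    by (intro tendsto_intros harm_limit) real_asymp
  moreover have "\<gamma>\<^sub>0 - (harm n - ln (real n)) + 1 / (2 * real n) = R1 (real n)" for n
    by (simp add: R1_def H_of_nat)
  ultimately show ?thesis by simp
qed

text \<open>The periodic antiderivative of \<open>frac y - 1/2\<close> that vanishes at the
  integers: half of the second periodic Bernoulli function minus its value at 0.\<close>

definition saw_integral :: "real \<Rightarrow> real" where
  "saw_integral y = ((frac y)\<^sup>2 - frac y) / 2"

lemma saw_integral_bounds: "- 1/8 \<le> saw_integral y" "saw_integral y \<le> 0"
proof -
  have "0 \<le> (frac y - 1/2)\<^sup>2" by simp
  then show "- 1/8 \<le> saw_integral y" by (simp add: saw_integral_def power2_eq_square algebra_simps)
  have "frac y * frac y \<le> frac y" by (intro mult_left_le_one_le) (auto simp: frac_lt_1 less_imp_le)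
  then show "saw_integral y \<le> 0" by (simp add: saw_integral_def power2_eq_square)
qed

lemma saw_integral_pw: "pw_deriv (range real) saw_integral (\<lambda>y. frac y - 1/2)"
proof -
  have s: "pw_deriv {} (\<lambda>y::real. y\<^sup>2 / 2 - y / 2) (\<lambda>y. y - 1/2)"
    by (rule pw_deriv_smooth) (auto intro!: derivative_eq_intros)
  have t: "pw_deriv ({} \<union> range (\<lambda>k::nat. 1 * real k)) (\<lambda>y. \<Sum>k\<in>nats_upto (y / 1). y - real k) (\<lambda>y. \<Sum>k\<in>nats_upto (y / 1). 1)"
    by (rule pw_deriv_sum_upto)
       (auto intro!: pw_deriv_smooth locally_finite_empty derivative_eq_intros)
  show ?thesis
  proof (rule pw_deriv_cong[where E = "range real"])
    show "pw_deriv (range real) (\<lambda>y. (y\<^sup>2 / 2 - y / 2) - (\<Sum>k\<in>nats_upto (y / 1). y - real k)) (\<lambda>y. (y - 1/2) - (\<Sum>k\<in>nats_upto (y / 1). 1))"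
      using pw_deriv_diff[OF s t] by simp
    fix y :: real assume y: "y > 0"
    define n where "n = nat \<lfloor>y\<rfloor>"
    have n: "real n = real_of_int \<lfloor>y\<rfloor>" using y by (simp add: n_def)
    have g: "(\<Sum>k=1..n. real k) = real n * (real n + 1) / 2"
      by (induction n) (auto simp: field_simps)
    have "(\<Sum>k\<in>nats_upto (y / 1). y - real k) = real n * y - real n * (real n + 1) / 2"
      unfolding nats_upto_eq div_by_1 n_def[symmetric] sum_subtractf g by simp
    then show "(y\<^sup>2 / 2 - y / 2) - (\<Sum>k\<in>nats_upto (y / 1). y - real k) = saw_integral y"
      unfolding saw_integral_def frac_def n[symmetric] by (simp add: power2_eq_square field_simps)
    show "(y - 1/2) - (\<Sum>k\<in>nats_upto (y / 1). 1) = frac y - 1/2"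
      using card_nats_upto[of y] y by (simp add: frac_def)
  qed
qed

text \<open>Bounding the derivative of \<open>R1\<close> directly gives only order
  \<open>1 / a\<close>. Subtracting \<open>saw_integral y / y^2\<close> is an integration by parts
  that gains a power. As \<open>saw_integral\<close> lies between \<open>-1/8\<close> and 0, the
  difference lies between 0 and \<open>1/8 / a^2\<close> and the subtracted term between
  \<open>-1/8 / a^2\<close> and 0, so the constant does not double.\<close>

lemma R1_bound:
  assumes a: "a > 0"
  shows "\<bar>R1 a\<bar> \<le> 1 / 8 / a\<^sup>2"
proof -
  have s: "pw_deriv {} (\<lambda>y. 1 / y\<^sup>2) (\<lambda>y::real. - 2 / y ^ 3)"
    by (rule pw_deriv_smooth) (auto intro!: derivative_eq_intros simp: field_simps power2_eq_square power3_eq_cube)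
  have "pw_deriv (range real \<union> (range real \<union> {})) (\<lambda>y. R1 y - saw_integral y * (1 / y\<^sup>2))
     (\<lambda>y. (frac y - 1/2) / y\<^sup>2 - ((frac y - 1/2) * (1 / y\<^sup>2) + (- 2 / y ^ 3) * saw_integral y))"
    by (intro pw_deriv_diff R1_pw pw_deriv_mult saw_integral_pw s)
  then have D: "pw_deriv (range real) (\<lambda>y. R1 y - saw_integral y * (1 / y\<^sup>2)) (\<lambda>y. 2 * saw_integral y / y ^ 3)"
    unfolding Un_absorb Un_empty_right
    by (rule pw_deriv_cong) (auto simp: field_simps power2_eq_square power3_eq_cube)
  have lim: "(\<lambda>n. R1 (real n) - saw_integral (real n) * (1 / (real n)\<^sup>2)) \<longlonglongrightarrow> 0"
    using R1_nat_limit by (simp add: saw_integral_def)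
  have l2: "(\<lambda>n. 1 / 8 * (1 / (real n)\<^sup>2)) \<longlonglongrightarrow> 0" by real_asymp
  have "(0 - (R1 a - saw_integral a * (1 / a\<^sup>2))) \<le> 0"
  proof (rule pw_deriv_le_limit[OF pw_deriv_diff[OF pw_deriv_const D] a])
    fix t assume "a \<le> t"
    then show "0 \<le> 0 - 2 * saw_integral t / t ^ 3"
      using a saw_integral_bounds[of t] by (simp add: divide_nonpos_pos)
  next
    show "(\<lambda>n. 0 - (R1 (real n) - saw_integral (real n) * (1 / (real n)\<^sup>2))) \<longlonglongrightarrow> 0"
      using tendsto_diff[OF tendsto_const lim, of 0] by simp
  qed
  moreover have "(R1 a - saw_integral a * (1 / a\<^sup>2)) - 1 / 8 * (1 / a\<^sup>2) \<le> 0"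
  proof (rule pw_deriv_le_limit[OF pw_deriv_diff[OF D pw_deriv_mult[OF pw_deriv_const s]] a])
    fix t assume "a \<le> t"
    then have t: "t > 0" using a by simp
    have "0 \<le> 2 * (saw_integral t + 1/8) / t ^ 3"
      using t saw_integral_bounds[of t] by (intro divide_nonneg_pos) auto
    then show "0 \<le> 2 * saw_integral t / t ^ 3 - (0 * (1 / t\<^sup>2) + - 2 / t ^ 3 * (1 / 8))"
      by (simp add: algebra_simps add_divide_distrib)
  next
    show "(\<lambda>n. R1 (real n) - saw_integral (real n) * (1 / (real n)\<^sup>2) - 1 / 8 * (1 / (real n)\<^sup>2)) \<longlonglongrightarrow> 0"
      using tendsto_diff[OF lim l2] by simp
  qed
  moreover have "saw_integral a * (1 / a\<^sup>2) \<le> 0"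
    by (rule mult_nonpos_nonneg[OF saw_integral_bounds(2)]) simp
  moreover have "(- 1/8) * (1 / a\<^sup>2) \<le> saw_integral a * (1 / a\<^sup>2)"
    by (rule mult_right_mono[OF saw_integral_bounds(1)]) simp
  ultimately show ?thesis by (simp add: abs_le_iff)
qed

lemma T_aux_pw: "pw_deriv (range real) T_aux (\<lambda>y. - (R1 y / y))"
proof -
  have s: "pw_deriv {} (\<lambda>y. 1 / (2 * y) + (1 - \<gamma>\<^sub>0) * ln y - (ln y)\<^sup>2 / 2 + \<gamma>\<^sub>0 + \<gamma>\<^sub>1 - 1) (\<lambda>y. - 1 / (2 * y\<^sup>2) + (1 - \<gamma>\<^sub>0) / y - ln y / y)"
    by (rule pw_deriv_smooth) (auto intro!: derivative_eq_intros simp: field_simps power2_eq_square)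
  have t: "pw_deriv ({} \<union> range (\<lambda>k::nat. 1 * real k)) (\<lambda>y. \<Sum>l\<in>nats_upto (y / 1). ln (y / real l) / real l + 1 / y - 1 / real l)
     (\<lambda>y. \<Sum>l\<in>nats_upto (y / 1). (1 / real l - 1 / y) / y)"
    by (rule pw_deriv_sum_upto)
       (auto intro!: pw_deriv_smooth locally_finite_empty derivative_eq_intros simp: field_simps power2_eq_square)
  show ?thesis
  proof (rule pw_deriv_cong[where E = "range real"])
    show "pw_deriv (range real) (\<lambda>y. (1 / (2 * y) + (1 - \<gamma>\<^sub>0) * ln y - (ln y)\<^sup>2 / 2 + \<gamma>\<^sub>0 + \<gamma>\<^sub>1 - 1) + (\<Sum>l\<in>nats_upto (y / 1). ln (y / real l) / real l + 1 / y - 1 / real l))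
      (\<lambda>y. (- 1 / (2 * y\<^sup>2) + (1 - \<gamma>\<^sub>0) / y - ln y / y) + (\<Sum>l\<in>nats_upto (y / 1). (1 / real l - 1 / y) / y))"
      using pw_deriv_add[OF s t] by simp
    fix y :: real assume y: "y > 0"
    show "(1 / (2 * y) + (1 - \<gamma>\<^sub>0) * ln y - (ln y)\<^sup>2 / 2 + \<gamma>\<^sub>0 + \<gamma>\<^sub>1 - 1) + (\<Sum>l\<in>nats_upto (y / 1). ln (y / real l) / real l + 1 / y - 1 / real l) = T_aux y"
      by (simp add: T_aux_def)
    show "(- 1 / (2 * y\<^sup>2) + (1 - \<gamma>\<^sub>0) / y - ln y / y) + (\<Sum>l\<in>nats_upto (y / 1). (1 / real l - 1 / y) / y) = - (R1 y / y)"
      unfolding sum_divide_distrib[symmetric] div_by_1 R1_alt[OF y] using y by (simp add: field_simps power2_eq_square)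
  qed
qed

text \<open>Each summand has a triple zero at \<open>y = l\<close>. That is why
  \<open>y * R2 y\<close>, its derivative \<open>T_aux\<close> and in turn the derivative of
  \<open>T_aux\<close> all remain continuous across the integers.\<close>

lemma R2_pw: "pw_deriv (range real) (\<lambda>y. y * R2 y) T_aux"
proof -
  let ?c = "ln (2 * pi) / 2 + 1"
  have s: "pw_deriv {} (\<lambda>y. ?c + ln y / 2 + (2 - \<gamma>\<^sub>0) * (y * ln y) - y * (ln y)\<^sup>2 / 2 + (2 * \<gamma>\<^sub>0 + \<gamma>\<^sub>1 - 3) * y)
     (\<lambda>y. 1 / (2 * y) + (2 - \<gamma>\<^sub>0) * (ln y + 1) - (ln y)\<^sup>2 / 2 - ln y + (2 * \<gamma>\<^sub>0 + \<gamma>\<^sub>1 - 3))"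
    by (rule pw_deriv_smooth) (auto intro!: derivative_eq_intros simp: field_simps power2_eq_square)
  have t: "pw_deriv ({} \<union> range (\<lambda>k::nat. 1 * real k)) (\<lambda>y. \<Sum>l\<in>nats_upto (y / 1). (1 + y / real l) * ln (y / real l) + 2 * (1 - y / real l))
     (\<lambda>y. \<Sum>l\<in>nats_upto (y / 1). ln (y / real l) / real l + 1 / y - 1 / real l)"
    by (rule pw_deriv_sum_upto)
       (auto intro!: pw_deriv_smooth locally_finite_empty derivative_eq_intros simp: field_simps power2_eq_square)
  show ?thesis
  proof (rule pw_deriv_cong[where E = "range real"])
    show "pw_deriv (range real) (\<lambda>y. (?c + ln y / 2 + (2 - \<gamma>\<^sub>0) * (y * ln y) - y * (ln y)\<^sup>2 / 2 + (2 * \<gamma>\<^sub>0 + \<gamma>\<^sub>1 - 3) * y) + (\<Sum>l\<in>nats_upto (y / 1). (1 + y / real l) * ln (y / real l) + 2 * (1 - y / real l)))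
      (\<lambda>y. (1 / (2 * y) + (2 - \<gamma>\<^sub>0) * (ln y + 1) - (ln y)\<^sup>2 / 2 - ln y + (2 * \<gamma>\<^sub>0 + \<gamma>\<^sub>1 - 3)) + (\<Sum>l\<in>nats_upto (y / 1). ln (y / real l) / real l + 1 / y - 1 / real l))"
      using pw_deriv_add[OF s t] by simp
    fix y :: real assume y: "y > 0"
    have c: "y * (1 / y * A) = A" for A using y by simp
    show "(?c + ln y / 2 + (2 - \<gamma>\<^sub>0) * (y * ln y) - y * (ln y)\<^sup>2 / 2 + (2 * \<gamma>\<^sub>0 + \<gamma>\<^sub>1 - 3) * y) + (\<Sum>l\<in>nats_upto (y / 1). (1 + y / real l) * ln (y / real l) + 2 * (1 - y / real l)) = y * R2 y"
      unfolding R2_def distrib_left right_diff_distrib c div_by_1 by (simp add: algebra_simps)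
    show "(1 / (2 * y) + (2 - \<gamma>\<^sub>0) * (ln y + 1) - (ln y)\<^sup>2 / 2 - ln y + (2 * \<gamma>\<^sub>0 + \<gamma>\<^sub>1 - 3)) + (\<Sum>l\<in>nats_upto (y / 1). ln (y / real l) / real l + 1 / y - 1 / real l) = T_aux y"
      by (simp add: T_aux_def algebra_simps)
  qed
qed

section \<open>Values at integers and decay at infinity\<close>

definition harm_err :: "nat \<Rightarrow> real" where
  "harm_err n = harm n - ln (real n) - \<gamma>\<^sub>0 - 1 / (2 * real n)"

definition ln_div_err :: "nat \<Rightarrow> real" where
  "ln_div_err n = (\<Sum>k=1..n. ln (real k) / real k) - ln (real n)^2 / 2 - ln (real n) / (2 * real n) - \<gamma>\<^sub>1"

definition ln_fact_err :: "nat \<Rightarrow> real" where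
  "ln_fact_err n = (\<Sum>k=1..n. ln (real k)) - (real n * ln (real n) - real n + ln (real n) / 2 + ln (2 * pi) / 2)"

definition ln_sq_err :: "nat \<Rightarrow> real" where
  "ln_sq_err n = (\<Sum>k=1..n. ln (real k)^2) - (real n * ln (real n)^2 - 2 * real n * ln (real n) + 2 * real n + ln (real n)^2 / 2)"

lemma tendsto_weighted:
  fixes e g :: "nat \<Rightarrow> real"
  assumes e: "(\<lambda>n. real n powr b * e n) \<longlonglongrightarrow> 0" and g: "(\<lambda>n. g n * real n powr (-b)) \<longlonglongrightarrow> 0"
  shows "(\<lambda>n. g n * e n) \<longlonglongrightarrow> 0"
proof -
  have "(\<lambda>n. (g n * real n powr (-b)) * (real n powr b * e n)) \<longlonglongrightarrow> 0 * 0"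
    by (intro tendsto_mult e g)
  moreover have "\<forall>\<^sub>F n in sequentially. (g n * real n powr (-b)) * (real n powr b * e n) = g n * e n"
    using eventually_gt_at_top[of 0]
  proof eventually_elim
    case (elim n)
    have "real n powr (-b) * real n powr b = 1" using elim by (simp flip: powr_add)
    then show ?case by (metis (no_types, opaque_lifting) mult.assoc mult.left_neutral)
  qed
  ultimately show ?thesis by (auto intro: Lim_transform_eventually)
qed

lemma harm_err_lim: "(\<lambda>n. real n powr (5/4) * harm_err n) \<longlonglongrightarrow> 0"
  using harm_asymp by (simp add: harm_err_def)

lemma ln_div_err_lim: "(\<lambda>n. real n powr (5/4) * ln_div_err n) \<longlonglongrightarrow> 0"
  using sum_ln_div_asymp by (simp add: ln_div_err_def)

lemma ln_fact_err_lim: "(\<lambda>n. real n powr (1/2) * ln_fact_err n) \<longlonglongrightarrow> 0"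
  using sum_ln_asymp by (simp add: ln_fact_err_def)

text \<open>At an integer the sum unfolds into \<open>harm n\<close> and the sum of
  \<open>ln l / l\<close>. The elementary part of \<open>T_aux\<close> is exactly what cancels their
  main terms, so only the remainders are left.\<close>

lemma T_aux_of_nat:
  assumes n: "n > 0"
  shows "T_aux (real n) = (ln (real n) - 1) * harm_err n - ln_div_err n"
proof -
  have "(\<Sum>l\<in>nats_upto (real n). ln (real n / real l) / real l + 1 / real n - 1 / real l)
    = (\<Sum>l=1..n. ln (real n) * (1 / real l) - ln (real l) / real l + 1 / real n - 1 / real l)"
    unfolding nats_upto_of_nat using n by (intro sum.cong refl) (auto simp: ln_div diff_divide_distrib)
  also have "\<dots> = ln (real n) * harm n - (\<Sum>l=1..n. ln (real l) / real l) + 1 - harm n"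
    unfolding sum_subtractf sum.distrib sum_distrib_left[symmetric] using n by (simp add: harm_def inverse_eq_divide)
  finally have S: "(\<Sum>l\<in>nats_upto (real n). ln (real n / real l) / real l + 1 / real n - 1 / real l)
     = ln (real n) * harm n - (\<Sum>l=1..n. ln (real l) / real l) + 1 - harm n" .
  show ?thesis
    unfolding T_aux_def S harm_err_def ln_div_err_def using n by (simp add: field_simps power2_eq_square)
qed

lemma R2_of_nat:
  assumes n: "n > 0"
  shows "real n * R2 (real n) = real n * (ln (real n) - 2) * harm_err n - real n * ln_div_err n - ln_fact_err n"
proof -
  have "(\<Sum>l\<in>nats_upto (real n). (1 + real n / real l) * ln (real n / real l) + 2 * (1 - real n / real l))
    = (\<Sum>l=1..n. ln (real n) - ln (real l) + (real n * ln (real n)) * (1 / real l) - real n * (ln (real l) / real l) + 2 - (2 * real n) * (1 / real l))"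
    unfolding nats_upto_of_nat using n by (intro sum.cong refl) (auto simp: ln_div algebra_simps add_divide_distrib diff_divide_distrib)
  also have "\<dots> = real n * ln (real n) - (\<Sum>l=1..n. ln (real l)) + (real n * ln (real n)) * harm n - real n * (\<Sum>l=1..n. ln (real l) / real l) + 2 * real n - (2 * real n) * harm n"
    unfolding sum_subtractf sum.distrib sum_distrib_left[symmetric] using n by (simp add: harm_def inverse_eq_divide)
  finally have S: "(\<Sum>l\<in>nats_upto (real n). (1 + real n / real l) * ln (real n / real l) + 2 * (1 - real n / real l))
     = real n * ln (real n) - (\<Sum>l=1..n. ln (real l)) + (real n * ln (real n)) * harm n - real n * (\<Sum>l=1..n. ln (real l) / real l) + 2 * real n - (2 * real n) * harm n" .
  show ?thesis
    unfolding R2_def S harm_err_def ln_div_err_def ln_fact_err_def using n by (simp add: field_simps power2_eq_square)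
qed

text \<open>The derivative \<open>- R1 t / t\<close> is of third order, and integrating it halves
  the constant \<open>1/8\<close> of \<open>R1\<close>. Along the integers \<open>harm_err n\<close>
  carries a factor \<open>ln n\<close>, so a rate is needed to see the limit.\<close>

lemma T_aux_bound:
  assumes a: "a > 0"
  shows "\<bar>T_aux a\<bar> \<le> 1 / 16 / a\<^sup>2"
proof (rule pw_deriv_decay[OF T_aux_pw a])
  fix t :: real assume t: "t > 0"
  have "\<bar>- (R1 t / t)\<bar> = \<bar>R1 t\<bar> / t" using t by simp
  also have "\<dots> \<le> (1 / 8 / t\<^sup>2) / t" using t by (intro divide_right_mono R1_bound) auto
  finally show "\<bar>- (R1 t / t)\<bar> \<le> real 2 * (1 / 16) / t ^ Suc 2" by (simp add: eval_nat_numeral mult_ac)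
next
  have "(\<lambda>n. (ln (real n) - 1) * harm_err n - 1 * ln_div_err n) \<longlonglongrightarrow> 0 - 0"
  proof (intro tendsto_diff)
    show "(\<lambda>n. (ln (real n) - 1) * harm_err n) \<longlonglongrightarrow> 0"
      by (rule tendsto_weighted[OF harm_err_lim]) real_asymp
    show "(\<lambda>n. 1 * ln_div_err n) \<longlonglongrightarrow> 0"
      by (rule tendsto_weighted[OF ln_div_err_lim]) real_asymp
  qed
  moreover have "\<forall>\<^sub>F n in sequentially. (ln (real n) - 1) * harm_err n - 1 * ln_div_err n = T_aux (real n)"
    using eventually_gt_at_top[of 0] by eventually_elim (simp add: T_aux_of_nat)
  ultimately show "(\<lambda>n. T_aux (real n)) \<longlonglongrightarrow> 0" by (auto intro: Lim_transform_eventually)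
qed simp

text \<open>The estimate is applied to \<open>y * R2 y\<close>, whose derivative
  \<open>T_aux\<close> is already of second order. At an integer this quantity contains
  \<open>harm_err n\<close> multiplied by \<open>n * ln n\<close>: the place where a weight above 1
  is indispensable.\<close>

lemma R2_bound:
  assumes a: "a > 0"
  shows "\<bar>R2 a\<bar> \<le> 1 / 16 / a\<^sup>2"
proof -
  have "\<bar>a * R2 a\<bar> \<le> 1 / 16 / a ^ 1"
  proof (rule pw_deriv_decay[OF R2_pw a])
    fix t :: real assume t: "t > 0"
    show "\<bar>T_aux t\<bar> \<le> real 1 * (1 / 16) / t ^ Suc 1"
      using T_aux_bound[OF t] by (simp add: power2_eq_square)
  next
    have "(\<lambda>n. (real n * (ln (real n) - 2)) * harm_err n - real n * ln_div_err n - 1 * ln_fact_err n) \<longlonglongrightarrow> 0 - 0 - 0"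
    proof (intro tendsto_diff)
      show "(\<lambda>n. (real n * (ln (real n) - 2)) * harm_err n) \<longlonglongrightarrow> 0"
        by (rule tendsto_weighted[OF harm_err_lim]) real_asymp
      show "(\<lambda>n. real n * ln_div_err n) \<longlonglongrightarrow> 0"
        by (rule tendsto_weighted[OF ln_div_err_lim]) real_asymp
      show "(\<lambda>n. 1 * ln_fact_err n) \<longlonglongrightarrow> 0"
        by (rule tendsto_weighted[OF ln_fact_err_lim]) real_asymp
    qed
    moreover have "\<forall>\<^sub>F n in sequentially. (real n * (ln (real n) - 2)) * harm_err n - real n * ln_div_err n - 1 * ln_fact_err n = real n * R2 (real n)"
      using eventually_gt_at_top[of 0] by eventually_elim (simp add: R2_of_nat)
    ultimately show "(\<lambda>n. real n * R2 (real n)) \<longlonglongrightarrow> 0" by (auto intro: Lim_transform_eventually)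
  qed simp
  then have "a * \<bar>R2 a\<bar> \<le> 1 / 16 / a" using a by (simp add: abs_mult)
  then show ?thesis using a by (simp add: field_simps power2_eq_square)
qed

text \<open>The summand is symmetric in \<open>k\<close> and \<open>l\<close> and vanishes on the
  diagonal, so the sum is half of the one over the full square. Expanded there, the product gives
  each of the two terms on the right twice. The induction verifies the outcome by adding one
  row.\<close>

lemma double_sum_identity:
  "(\<Sum>k=1..n. \<Sum>l=1..k. (1 / real l - 1 / real k) * (ln (real k) - ln (real l)))
     = harm n * (\<Sum>k=1..n. ln (real k)) - real n * (\<Sum>k=1..n. ln (real k) / real k)"
proof (induction n)
  case 0
  then show ?case by simp
next
  case (Suc n)
  define m where "m = real (Suc n)"
  have m: "m > 0" "real n = m - 1" by (auto simp: m_def)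
  define L where "L = ln m"
  define h S A :: real where "h = harm n" and "S = (\<Sum>k=1..n. ln (real k))" and "A = (\<Sum>k=1..n. ln (real k) / real k)"
  have h': "harm (Suc n) = h + 1 / m" by (simp add: h_def harm_Suc m_def inverse_eq_divide)
  have S': "(\<Sum>k=1..Suc n. ln (real k)) = S + L" by (simp add: S_def L_def m_def)
  have A': "(\<Sum>k=1..Suc n. ln (real k) / real k) = A + L / m" by (simp add: A_def L_def m_def)
  have "(\<Sum>l=1..Suc n. (1 / real l - 1 / m) * (L - ln (real l)))
    = (\<Sum>l=1..Suc n. L * (1 / real l) - ln (real l) / real l - L / m + (1 / m) * ln (real l))"
    by (intro sum.cong refl) (simp add: algebra_simps)
  also have "\<dots> = L * harm (Suc n) - (A + L / m) - m * (L / m) + (1 / m) * (S + L)"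
    unfolding sum_subtractf sum.distrib sum_distrib_left[symmetric] A' S' by (simp add: harm_def inverse_eq_divide m_def)
  finally have I: "(\<Sum>l=1..Suc n. (1 / real l - 1 / m) * (L - ln (real l))) = L * harm (Suc n) - (A + L / m) - m * (L / m) + (1 / m) * (S + L)" .
  have "(\<Sum>k=1..Suc n. \<Sum>l=1..k. (1 / real l - 1 / real k) * (ln (real k) - ln (real l)))
    = (h * S - real n * A) + (\<Sum>l=1..Suc n. (1 / real l - 1 / m) * (L - ln (real l)))"
    using Suc.IH by (simp add: h_def S_def A_def m_def L_def)
  also have "\<dots> = (h + 1 / m) * (S + L) - m * (A + L / m)"
    unfolding I h' m(2) using m(1) by (simp add: field_simps)
  finally show ?case unfolding h' S' A' m_def .
qed

text \<open>In this combination the terms without logarithms cancel inside the sums, and the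
  coefficient of \<open>ln k - ln l\<close> becomes
  \<open>2 / l - (1 / k + 1 / l) = 1 / l - 1 / k\<close>. That is the symmetric product which can be
  summed in closed form.\<close>

lemma two_T_aux_minus_R2_of_nat:
  assumes k: "k > 0"
  shows "2 * T_aux (real k) - R2 (real k) = - ln (2 * pi) / 2 * (1 / real k) - (ln (real k) / real k) / 2 - \<gamma>\<^sub>0 * ln (real k) - ln (real k)^2 / 2 + (\<gamma>\<^sub>1 + 1)
     + (\<Sum>l=1..k. (1 / real l - 1 / real k) * (ln (real k) - ln (real l)))"
proof -
  have T: "(\<Sum>l\<in>nats_upto (real k). ln (real k / real l) / real l + 1 / real k - 1 / real l)
    = (\<Sum>l=1..k. (ln (real k) - ln (real l)) / real l + 1 / real k - 1 / real l)"
    unfolding nats_upto_of_nat using k by (intro sum.cong refl) (auto simp: ln_div)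
  have R: "1 / real k * (\<Sum>l\<in>nats_upto (real k). (1 + real k / real l) * ln (real k / real l) + 2 * (1 - real k / real l))
    = (\<Sum>l=1..k. (1 / real k + 1 / real l) * (ln (real k) - ln (real l)) + 2 / real k - 2 / real l)"
    unfolding nats_upto_of_nat sum_distrib_left using k by (intro sum.cong refl) (auto simp: ln_div field_simps)
  have D: "2 * (\<Sum>l=1..k. (ln (real k) - ln (real l)) / real l + 1 / real k - 1 / real l) - (\<Sum>l=1..k. (1 / real k + 1 / real l) * (ln (real k) - ln (real l)) + 2 / real k - 2 / real l)
    = (\<Sum>l=1..k. (1 / real l - 1 / real k) * (ln (real k) - ln (real l)))"
    unfolding sum_distrib_left sum_subtractf[symmetric] by (intro sum.cong refl) (simp add: algebra_simps add_divide_distrib diff_divide_distrib)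
  show ?thesis
    unfolding T_aux_def R2_def T R D[symmetric] by (simp add: algebra_simps add_divide_distrib diff_divide_distrib)
qed

lemma K2_series: "(\<lambda>k. 2 * T_aux (real (Suc k)) - R2 (real (Suc k))) sums (K2 - 2 * K1)"
proof -
  define l where "l = ln (2 * pi)"
  define C where "C = \<gamma>\<^sub>1 + \<gamma>\<^sub>0\<^sup>2 / 2 - pi\<^sup>2 / 24 - l\<^sup>2 / 2"
  \<comment> \<open>An exact identity: all growing main terms cancel, leaving a constant, the
    remainder of the squares, and remainders with prefactors that their rates outweigh.\<close>
  have part: "(\<Sum>k<n. 2 * T_aux (real (Suc k)) - R2 (real (Suc k)))
    = - l * \<gamma>\<^sub>0 / 2 - \<gamma>\<^sub>1 / 2 - 1/2 - ln_sq_err n / 2 - (l / 2) * harm_err n - (1/2 + real n) * ln_div_err n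
      + (ln (real n) + 1 / (2 * real n)) * ln_fact_err n + (\<Sum>k=1..n. ln (real k)) * harm_err n" if n: "n > 0" for n
  proof -
    have "(\<Sum>k<n. 2 * T_aux (real (Suc k)) - R2 (real (Suc k))) = (\<Sum>k=1..n. 2 * T_aux (real k) - R2 (real k))"
      by (rule sum.reindex_bij_witness[of _ "\<lambda>k. k - 1" Suc]) auto
    also have "\<dots> = (\<Sum>k=1..n. - l / 2 * (1 / real k) - (ln (real k) / real k) / 2 - \<gamma>\<^sub>0 * ln (real k) - ln (real k)^2 / 2 + (\<gamma>\<^sub>1 + 1)
        + (\<Sum>l=1..k. (1 / real l - 1 / real k) * (ln (real k) - ln (real l))))"
      unfolding l_def by (intro sum.cong refl two_T_aux_minus_R2_of_nat) auto
    also have "\<dots> = - l / 2 * harm n - (\<Sum>k=1..n. ln (real k) / real k) / 2 - \<gamma>\<^sub>0 * (\<Sum>k=1..n. ln (real k)) - (\<Sum>k=1..n. ln (real k)^2) / 2 + real n * (\<gamma>\<^sub>1 + 1)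
        + (harm n * (\<Sum>k=1..n. ln (real k)) - real n * (\<Sum>k=1..n. ln (real k) / real k))"
      unfolding double_sum_identity[symmetric] sum_subtractf sum.distrib sum_distrib_left[symmetric] sum_divide_distrib[symmetric]
      by (simp add: harm_def inverse_eq_divide distrib_left)
    finally have P: "(\<Sum>k<n. 2 * T_aux (real (Suc k)) - R2 (real (Suc k))) = \<dots>" .
    define N where "N = real n"
    define L where "L = ln N"
    have N: "N > 0" using n by (simp add: N_def)
    have h: "harm n = L + \<gamma>\<^sub>0 + 1 / (2 * N) + harm_err n" by (simp add: harm_err_def L_def N_def)
    have A: "(\<Sum>k=1..n. ln (real k) / real k) = L^2 / 2 + L / (2 * N) + \<gamma>\<^sub>1 + ln_div_err n" by (simp add: ln_div_err_def L_def N_def)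
    have S: "(\<Sum>k=1..n. ln (real k)) = (N * L - N + L / 2 + l / 2) + ln_fact_err n" by (simp add: ln_fact_err_def L_def N_def l_def)
    have B: "(\<Sum>k=1..n. ln (real k)^2) = (N * L^2 - 2 * N * L + 2 * N + L^2 / 2) + ln_sq_err n" by (simp add: ln_sq_err_def L_def N_def)
    show ?thesis unfolding P h A S B N_def[symmetric] L_def[symmetric]
      using N by (simp add: field_simps power2_eq_square)
  qed
  have b: "(\<lambda>n. ln_sq_err n) \<longlonglongrightarrow> C"
    using sum_ln_sq_asymp by (simp add: ln_sq_err_def C_def l_def)
  have S: "(\<lambda>n. (\<Sum>k=1..n. ln (real k)) * harm_err n) \<longlonglongrightarrow> 0"
  proof (rule tendsto_weighted[OF harm_err_lim])
    \<comment> \<open>The exponent \<open>-5/4\<close> is split as \<open>1/2 - 7/4\<close>, so that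
      the remainder in Stirling's formula appears with the weight for which its limit is
      known.\<close>
    have "(\<lambda>n. real n powr (1/2) * ln_fact_err n * real n powr (-7/4) + (real n * ln (real n) - real n + ln (real n) / 2 + l / 2) * real n powr (-(5/4))) \<longlonglongrightarrow> 0 * 0 + 0"
      by (intro tendsto_add tendsto_mult ln_fact_err_lim) real_asymp+
    moreover have "\<forall>\<^sub>F n in sequentially. real n powr (1/2) * ln_fact_err n * real n powr (-7/4) + (real n * ln (real n) - real n + ln (real n) / 2 + l / 2) * real n powr (-(5/4))
       = (\<Sum>k=1..n. ln (real k)) * real n powr (-(5/4))"
      using eventually_gt_at_top[of 0]
    proof eventually_elim
      case (elim n)
      have "real n powr (1/2) * real n powr (-7/4) = real n powr (-(5/4))" using elim by (simp flip: powr_add)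
      then have "real n powr (1/2) * ln_fact_err n * real n powr (-7/4) = ln_fact_err n * real n powr (-(5/4))"
        by (metis mult.assoc mult.commute)
      then show ?case by (simp add: ln_fact_err_def l_def algebra_simps)
    qed
    ultimately show "(\<lambda>n. (\<Sum>k=1..n. ln (real k)) * real n powr (-(5/4))) \<longlonglongrightarrow> 0"
      by (auto intro: Lim_transform_eventually)
  qed
  have "(\<lambda>n. - l * \<gamma>\<^sub>0 / 2 - \<gamma>\<^sub>1 / 2 - 1/2 - ln_sq_err n / 2 - (l / 2) * harm_err n - (1/2 + real n) * ln_div_err n
      + (ln (real n) + 1 / (2 * real n)) * ln_fact_err n + (\<Sum>k=1..n. ln (real k)) * harm_err n)
      \<longlonglongrightarrow> - l * \<gamma>\<^sub>0 / 2 - \<gamma>\<^sub>1 / 2 - 1/2 - C / 2 - 0 - 0 + 0 + 0"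
  proof (intro tendsto_add tendsto_diff tendsto_const S tendsto_divide b)
    show "(\<lambda>n. (l / 2) * harm_err n) \<longlonglongrightarrow> 0"
      by (rule tendsto_weighted[OF harm_err_lim]) real_asymp
    show "(\<lambda>n. (1/2 + real n) * ln_div_err n) \<longlonglongrightarrow> 0"
      by (rule tendsto_weighted[OF ln_div_err_lim]) real_asymp
    show "(\<lambda>n. (ln (real n) + 1 / (2 * real n)) * ln_fact_err n) \<longlonglongrightarrow> 0"
      by (rule tendsto_weighted[OF ln_fact_err_lim]) real_asymp
  qed simp
  moreover have "- l * \<gamma>\<^sub>0 / 2 - \<gamma>\<^sub>1 / 2 - 1/2 - C / 2 - 0 - 0 + 0 + 0 = K2 - 2 * K1"
    unfolding C_def K2_def K1_def l_def[symmetric] by (simp add: field_simps power2_eq_square)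
  ultimately have "(\<lambda>n. - l * \<gamma>\<^sub>0 / 2 - \<gamma>\<^sub>1 / 2 - 1/2 - ln_sq_err n / 2 - (l / 2) * harm_err n - (1/2 + real n) * ln_div_err n
      + (ln (real n) + 1 / (2 * real n)) * ln_fact_err n + (\<Sum>k=1..n. ln (real k)) * harm_err n) \<longlonglongrightarrow> K2 - 2 * K1"
    by (simp only:)
  then show ?thesis unfolding sums_def
  proof (rule Lim_transform_eventually)
    show "\<forall>\<^sub>F n in sequentially. - l * \<gamma>\<^sub>0 / 2 - \<gamma>\<^sub>1 / 2 - 1/2 - ln_sq_err n / 2 - (l / 2) * harm_err n - (1/2 + real n) * ln_div_err n
      + (ln (real n) + 1 / (2 * real n)) * ln_fact_err n + (\<Sum>k=1..n. ln (real k)) * harm_err n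
      = (\<Sum>k<n. 2 * T_aux (real (Suc k)) - R2 (real (Suc k)))"
      using eventually_gt_at_top[of 0] by eventually_elim (rule part[symmetric])
  qed
qed

section \<open>The correlation as a series\<close>

lemma summable_inverse_Suc_sq: "summable (\<lambda>k. C / (real (Suc k) * x)\<^sup>2)"
proof -
  have "summable (\<lambda>k. C / x\<^sup>2 * (1 / (real (Suc k))\<^sup>2))"
    using sums_summable[OF inverse_squares_sums] by (intro summable_mult) simp
  moreover have "C / x\<^sup>2 * (1 / (real (Suc k))\<^sup>2) = C / (real (Suc k) * x)\<^sup>2" for k
    by (simp only: power_mult_distrib times_divide_times_eq mult_1_right mult.commute)
  ultimately show ?thesis by (simp only:)
qed

lemma summable_of_sq_bound:
  assumes b: "\<And>a. a > 0 \<Longrightarrow> \<bar>f a\<bar> \<le> C / a\<^sup>2" and x: "x > 0"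
  shows "summable (\<lambda>k. \<bar>f (real (Suc k) * x)\<bar>)" "summable (\<lambda>k. f (real (Suc k) * x))"
proof -
  show s: "summable (\<lambda>k. \<bar>f (real (Suc k) * x)\<bar>)"
    by (rule summable_comparison_test'[OF summable_inverse_Suc_sq[of C x], of 0])
       (use b[of "real (Suc _) * x"] x in simp)
  then show "summable (\<lambda>k. f (real (Suc k) * x))" by (rule summable_rabs_cancel)
qed

text \<open>The integral of \<open>frac r / r\<close> from 0 to \<open>t\<close>, written out: the
  sum is the integral of the floor divided by \<open>r\<close>. At an integer \<open>n\<close> the
  value is \<open>n - n * ln n\<close> plus the logarithm of the factorial.\<close>

definition ln_sum_aux :: "real \<Rightarrow> real" where
  "ln_sum_aux t = t - (\<Sum>k\<in>nats_upto t. ln (t / real k))"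

lemma ln_sum_aux_pw: "pw_deriv (range real) ln_sum_aux (\<lambda>t. frac t / t)"
proof -
  have s: "pw_deriv {} (\<lambda>t::real. t) (\<lambda>t. 1)" by (rule pw_deriv_smooth) auto
  have t: "pw_deriv ({} \<union> range (\<lambda>k::nat. 1 * real k)) (\<lambda>y. \<Sum>k\<in>nats_upto (y / 1). ln (y / real k)) (\<lambda>y. \<Sum>k\<in>nats_upto (y / 1). 1 / y)"
    by (rule pw_deriv_sum_upto) (auto intro!: pw_deriv_smooth locally_finite_empty derivative_eq_intros)
  show ?thesis
  proof (rule pw_deriv_cong[where E = "range real"])
    show "pw_deriv (range real) (\<lambda>y. y - (\<Sum>k\<in>nats_upto (y / 1). ln (y / real k))) (\<lambda>y. 1 - (\<Sum>k\<in>nats_upto (y / 1). 1 / y))"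
      using pw_deriv_diff[OF s t] by simp
    fix y :: real assume y: "y > 0"
    show "y - (\<Sum>k\<in>nats_upto (y / 1). ln (y / real k)) = ln_sum_aux y" by (simp add: ln_sum_aux_def)
    have "(\<Sum>k\<in>nats_upto (y / 1). 1 / y) = real_of_int \<lfloor>y\<rfloor> / y" using card_nats_upto[of y] y by simp
    then show "1 - (\<Sum>k\<in>nats_upto (y / 1). 1 / y) = frac y / y" using y by (simp add: frac_def field_simps)
  qed
qed

text \<open>After removing the main term and \<open>saw_integral t / t\<close>, the derivative is of
  second order, and Stirling's formula along the integers gives the limit. The remaining difference
  and the removed term contribute \<open>1/8 / t\<close> each.\<close>

lemma ln_sum_aux_asymp:
  assumes t: "t > 0"
  shows "\<bar>ln_sum_aux t - ln t / 2 - ln (2 * pi) / 2\<bar> \<le> 1 / (4 * t)"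
proof -
  let ?f = "\<lambda>t. ln_sum_aux t - (ln t / 2 + ln (2 * pi) / 2) - saw_integral t * (1 / t)"
  have s: "pw_deriv {} (\<lambda>t. ln t / 2 + ln (2 * pi) / 2) (\<lambda>t. 1 / (2 * t))"
    by (rule pw_deriv_smooth) (auto intro!: derivative_eq_intros)
  have s2: "pw_deriv {} (\<lambda>t. 1 / t) (\<lambda>t::real. - 1 / t\<^sup>2)"
    by (rule pw_deriv_smooth) (auto intro!: derivative_eq_intros simp: power2_eq_square)
  have "pw_deriv (range real \<union> {} \<union> (range real \<union> {})) ?f (\<lambda>t. (frac t / t - 1 / (2 * t)) - ((frac t - 1/2) * (1 / t) + (- 1 / t\<^sup>2) * saw_integral t))"
    by (intro pw_deriv_diff pw_deriv_mult ln_sum_aux_pw s s2 saw_integral_pw)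
  then have D: "pw_deriv (range real) ?f (\<lambda>t. saw_integral t / t\<^sup>2)"
    unfolding Un_absorb Un_empty_right by (rule pw_deriv_cong) (auto simp: field_simps power2_eq_square)
  have "\<bar>?f t\<bar> \<le> 1 / 8 / t ^ 1"
  proof (rule pw_deriv_decay[OF D t])
    fix u :: real assume u: "u > 0"
    have "\<bar>saw_integral u\<bar> \<le> 1 / 8" using saw_integral_bounds[of u] by (simp add: abs_le_iff)
    then have "\<bar>saw_integral u\<bar> / u\<^sup>2 \<le> 1 / 8 / u\<^sup>2" by (rule divide_right_mono) simp
    then show "\<bar>saw_integral u / u\<^sup>2\<bar> \<le> real 1 * (1 / 8) / u ^ Suc 1" by (simp add: power2_eq_square)
  next
    have "(\<lambda>n. 1 * ln_fact_err n) \<longlonglongrightarrow> 0" by (rule tendsto_weighted[OF ln_fact_err_lim]) real_asymp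
    moreover have "\<forall>\<^sub>F n in sequentially. 1 * ln_fact_err n = ?f (real n)"
      using eventually_gt_at_top[of 0]
    proof eventually_elim
      case (elim n)
      have "(\<Sum>k\<in>nats_upto (real n). ln (real n / real k)) = (\<Sum>k=1..n. ln (real n) - ln (real k))"
        unfolding nats_upto_of_nat using elim by (intro sum.cong refl) (auto simp: ln_div)
      also have "\<dots> = real n * ln (real n) - (\<Sum>k=1..n. ln (real k))" by (simp add: sum_subtractf)
      finally have S: "(\<Sum>k\<in>nats_upto (real n). ln (real n / real k)) = real n * ln (real n) - (\<Sum>k=1..n. ln (real k))" .
      show ?case unfolding ln_sum_aux_def S ln_fact_err_def by (simp add: saw_integral_def)
    qed
    ultimately show "(\<lambda>n. ?f (real n)) \<longlonglongrightarrow> 0" by (auto intro: Lim_transform_eventually)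
  qed simp
  moreover have "\<bar>saw_integral t * (1 / t)\<bar> \<le> 1 / 8 / t"
  proof -
    have "\<bar>saw_integral t\<bar> \<le> 1 / 8" using saw_integral_bounds[of t] by (simp add: abs_le_iff)
    then have "\<bar>saw_integral t\<bar> / t \<le> 1 / 8 / t" using t by (intro divide_right_mono) auto
    then show ?thesis using t by (simp add: abs_mult)
  qed
  ultimately have "\<bar>ln_sum_aux t - ln t / 2 - ln (2 * pi) / 2\<bar> \<le> 1 / 8 / t + 1 / 8 / t"
    unfolding abs_le_iff power_one_right by linarith
  also have "\<dots> = 1 / (4 * t)" using t by (simp add: field_simps)
  finally show ?thesis .
qed

theorem frac_corr_series:
  "exp (w / 2) * frac_corr w = K + w / 2 + exp w * S1 (exp w)"
proof -
  define x where "x = exp w"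
  have x: "x > 0" by (simp add: x_def)
  \<comment> \<open>an antiderivative of \<open>x * frac t * frac (t / x) / t\<^sup>2\<close>, obtained from \<open>frac (t / x) = t / x - \<lfloor>t / x\<rfloor>\<close>\<close>
  define \<Phi> where "\<Phi> t = ln_sum_aux t - x * (\<Sum>k\<in>nats_upto (t / x). R1 t - R1 (x * real k)) - x / 2 * (\<Sum>k\<in>nats_upto (t / x). 1 / (x * real k) - 1 / t)" for t
  define E where "E = range real \<union> range (\<lambda>k::nat. x * real k)"
  have "pw_deriv (range real \<union> ({} \<union> E) \<union> ({} \<union> E)) \<Phi>
     (\<lambda>t. frac t / t - (0 * (\<Sum>k\<in>nats_upto (t / x). R1 t - R1 (x * real k)) + (\<Sum>k\<in>nats_upto (t / x). (frac t - 1/2) / t\<^sup>2 - 0) * x)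
        - (0 * (\<Sum>k\<in>nats_upto (t / x). 1 / (x * real k) - 1 / t) + (\<Sum>k\<in>nats_upto (t / x). 1 / t\<^sup>2) * (x / 2)))"
    unfolding \<Phi>_def
  proof (intro pw_deriv_diff pw_deriv_mult ln_sum_aux_pw pw_deriv_const)
    have E: "locally_finite (range real)" using R1_pw by (simp add: pw_deriv_def)
    have "pw_deriv (range real \<union> {}) (\<lambda>t. R1 t - R1 (x * real k)) (\<lambda>t. (frac t - 1/2) / t\<^sup>2 - 0)" for k
      by (intro pw_deriv_diff R1_pw pw_deriv_const)
    then show "pw_deriv E (\<lambda>t. \<Sum>k\<in>nats_upto (t / x). R1 t - R1 (x * real k)) (\<lambda>t. \<Sum>k\<in>nats_upto (t / x). (frac t - 1/2) / t\<^sup>2 - 0)"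
      unfolding E_def by (intro pw_deriv_sum_upto x E) simp_all
    have p: "pw_deriv (range real) (\<lambda>t. 1 / (x * real k) - 1 / t) (\<lambda>t. 1 / t\<^sup>2)" for k
    proof -
      have "pw_deriv {} (\<lambda>t. 1 / (x * real k) - 1 / t) (\<lambda>t. 1 / t\<^sup>2)"
        by (rule pw_deriv_smooth) (auto intro!: derivative_eq_intros simp: power2_eq_square)
      then show ?thesis using E by (simp add: pw_deriv_def)
    qed
    show "pw_deriv E (\<lambda>t. \<Sum>k\<in>nats_upto (t / x). 1 / (x * real k) - 1 / t) (\<lambda>t. \<Sum>k\<in>nats_upto (t / x). 1 / t\<^sup>2)"
      unfolding E_def by (intro pw_deriv_sum_upto x E p) simp
  qed
  then have \<Phi>: "pw_deriv (range real \<union> ({} \<union> E) \<union> ({} \<union> E)) \<Phi> (\<lambda>t. x * frac t * frac (t / x) / t\<^sup>2)"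
  proof (rule pw_deriv_cong)
    fix t :: real assume t: "t > 0"
    have c: "(\<Sum>k\<in>nats_upto (t / x). (a::real)) = real_of_int \<lfloor>t / x\<rfloor> * a" for a
      using card_nats_upto[of "t / x"] t x by simp
    show "frac t / t - (0 * (\<Sum>k\<in>nats_upto (t / x). R1 t - R1 (x * real k)) + (\<Sum>k\<in>nats_upto (t / x). (frac t - 1/2) / t\<^sup>2 - 0) * x)
        - (0 * (\<Sum>k\<in>nats_upto (t / x). 1 / (x * real k) - 1 / t) + (\<Sum>k\<in>nats_upto (t / x). 1 / t\<^sup>2) * (x / 2)) = x * frac t * frac (t / x) / t\<^sup>2"
      unfolding c frac_def[of "t / x"] using t x by (simp add: field_simps power2_eq_square)
  qed simp
  \<comment> \<open>Evenness of the correlation allows the shift by \<open>- w\<close>, so that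
    \<open>exp (y - w)\<close> is the quotient \<open>t / x\<close> occurring in the
    antiderivative.\<close>
  define f where "f y = exp (w / 2) * (mellin_frac y * mellin_frac (y + - w))" for y
  have f_eq: "f y = x * frac (1 * exp y) * frac ((1 * exp y) / x) / (1 * exp y)\<^sup>2 * (1 * exp y)" for y
  proof -
    have e1: "exp (y + - w) = exp y / x" by (simp add: x_def exp_diff)
    have "f y = frac (exp y) * frac (exp y / x) * (exp (w / 2) * (exp (- y / 2) * exp (- (y + - w) / 2)))"
      unfolding f_def mellin_frac_def e1 by (simp only: mult_ac)
    also have "exp (w / 2) * (exp (- y / 2) * exp (- (y + - w) / 2)) = exp (w - y)"
      unfolding exp_add[symmetric] by (simp add: field_simps)
    also have "exp (w - y) = x / exp y" by (simp add: x_def exp_diff)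
    finally show ?thesis by (simp add: power2_eq_square)
  qed
  have f_int: "integrable lborel f"
    unfolding f_def by (intro integrable_mult_right frac_corr_integrable_integrand)
  have f_val: "(LBINT y. f y) = exp (w / 2) * frac_corr w"
    unfolding f_def integral_mult_right_zero frac_corr_def[symmetric] frac_corr_even ..
  \<comment> \<open>At the upper endpoint \<open>n * x\<close> the sums over
    \<open>k \<le> t / x\<close> run over \<open>1..n\<close> exactly. The lower endpoint is
    eventually below both 1 and \<open>x\<close>, where all sums are empty and the antiderivative at
    \<open>t\<close> is just \<open>t\<close>.\<close>
  define G where "G n = \<Phi> (real n * x) - \<Phi> (exp (- real n))" for n
  have R1s: "summable (\<lambda>k. R1 (real (Suc k) * x))"
    by (rule summable_of_sq_bound(2)[OF R1_bound x])
  have Gval: "\<forall>\<^sub>F n in sequentially. ln_sum_aux (real n * x) - harm n / 2 + 1/2 - x * (real n * R1 (real n * x)) + x * (\<Sum>k<n. R1 (real (Suc k) * x)) - exp (- real n) = G n"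
  proof -
    have "(\<lambda>n. exp (- real n)) \<longlonglongrightarrow> 0" by real_asymp
    then have "\<forall>\<^sub>F n in sequentially. exp (- real n) < min 1 x"
      by (rule order_tendstoD(2)) (use x in simp)
    then show ?thesis using eventually_gt_at_top[of 0]
    proof eventually_elim
      case (elim n)
      have "nats_upto z = {}" if "z < 1" for z using that by auto
      moreover have "exp (- real n) < 1" "exp (- real n) / x < 1" using elim x by (auto simp: divide_less_eq)
      ultimately have e: "nats_upto (exp (- real n)) = {}" "nats_upto (exp (- real n) / x) = {}" by blast+
      have 0: "\<Phi> (exp (- real n)) = exp (- real n)"
        unfolding \<Phi>_def ln_sum_aux_def e by simp
      have nx: "real n * x / x = real n" using x by simp
      have s1: "(\<Sum>k=1..n. R1 (real n * x) - R1 (x * real k)) = real n * R1 (real n * x) - (\<Sum>k<n. R1 (real (Suc k) * x))"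
      proof -
        have "(\<Sum>k=1..n. R1 (x * real k)) = (\<Sum>k<n. R1 (real (Suc k) * x))"
          by (rule sum.reindex_bij_witness[of _ Suc "\<lambda>k. k - 1"]) (auto simp: mult.commute)
        then show ?thesis by (simp add: sum_subtractf)
      qed
      have s2: "(\<Sum>k=1..n. 1 / (x * real k) - 1 / (real n * x)) = (harm n - 1) / x"
      proof -
        have "(\<Sum>k=1..n. 1 / (x * real k)) = harm n / x"
          by (simp add: harm_def sum_divide_distrib inverse_eq_divide mult.commute)
        then show ?thesis using elim x by (simp add: sum_subtractf diff_divide_distrib)
      qed
      have 1: "\<Phi> (real n * x) = ln_sum_aux (real n * x) - x * (real n * R1 (real n * x) - (\<Sum>k<n. R1 (real (Suc k) * x))) - x / 2 * ((harm n - 1) / x)"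
        unfolding \<Phi>_def nx nats_upto_of_nat s1 s2 ..
      show ?case unfolding G_def 0 1 using x by (simp add: field_simps)
    qed
  qed
  have lims: "(\<lambda>n. (ln_sum_aux (real n * x) - ln (real n * x) / 2 - ln (2 * pi) / 2)) \<longlonglongrightarrow> 0"
  proof (rule Lim_null_comparison)
    show "\<forall>\<^sub>F n in sequentially. norm (ln_sum_aux (real n * x) - ln (real n * x) / 2 - ln (2 * pi) / 2) \<le> 1 / (4 * (real n * x))"
      using eventually_gt_at_top[of 0] by eventually_elim (use ln_sum_aux_asymp x in simp)
    have "(\<lambda>n. 1 / (4 * x) * (1 / real n)) \<longlonglongrightarrow> 1 / (4 * x) * 0" by (intro tendsto_mult tendsto_const) real_asymp
    then show "(\<lambda>n. 1 / (4 * (real n * x))) \<longlonglongrightarrow> 0" by (simp add: mult_ac)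
  qed
  have limR: "(\<lambda>n. real n * R1 (real n * x)) \<longlonglongrightarrow> 0"
  proof (rule Lim_null_comparison)
    show "\<forall>\<^sub>F n in sequentially. norm (real n * R1 (real n * x)) \<le> 1 / (8 * x\<^sup>2) * (1 / real n)"
      using eventually_gt_at_top[of 0]
    proof eventually_elim
      case (elim n)
      have "\<bar>R1 (real n * x)\<bar> \<le> 1 / 8 / (real n * x)\<^sup>2" using elim x by (intro R1_bound) simp
      then have "real n * \<bar>R1 (real n * x)\<bar> \<le> real n * (1 / 8 / (real n * x)\<^sup>2)" by (rule mult_left_mono) simp
      then show ?case using elim x by (simp add: abs_mult field_simps power2_eq_square)
    qed
    have "(\<lambda>n. 1 / (8 * x\<^sup>2) * (1 / real n)) \<longlonglongrightarrow> 1 / (8 * x\<^sup>2) * 0" by (intro tendsto_mult tendsto_const) real_asymp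
    then show "(\<lambda>n. 1 / (8 * x\<^sup>2) * (1 / real n)) \<longlonglongrightarrow> 0" by simp
  qed
  have limE: "(\<lambda>n. exp (- real n)) \<longlonglongrightarrow> 0" by real_asymp
  have limS: "(\<lambda>n. \<Sum>k<n. R1 (real (Suc k) * x)) \<longlonglongrightarrow> S1 x"
    unfolding S1_def using R1s by (rule summable_LIMSEQ)
  \<comment> \<open>The \<open>ln n / 2\<close> inside \<open>ln_sum_aux\<close> cancels against
    \<open>harm n / 2\<close>. What remains is \<open>ln (2 pi) / 2\<close>, minus half of Euler's
    constant, plus \<open>1/2\<close>, which is \<open>K\<close>; the \<open>w / 2\<close> comes
    from \<open>ln x\<close>.\<close>
  have "(\<lambda>n. (ln_sum_aux (real n * x) - ln (real n * x) / 2 - ln (2 * pi) / 2) - (harm n - ln (real n)) / 2 + (ln (2 * pi) / 2 + w / 2 + 1/2)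
       - x * (real n * R1 (real n * x)) + x * (\<Sum>k<n. R1 (real (Suc k) * x)) - exp (- real n))
     \<longlonglongrightarrow> 0 - \<gamma>\<^sub>0 / 2 + (ln (2 * pi) / 2 + w / 2 + 1/2) - x * 0 + x * S1 x - 0"
    by (intro tendsto_add tendsto_diff tendsto_mult tendsto_const lims limR limS limE tendsto_divide harm_limit) simp_all
  also have "0 - \<gamma>\<^sub>0 / 2 + (ln (2 * pi) / 2 + w / 2 + 1/2) - x * 0 + x * S1 x - 0 = K + w / 2 + exp w * S1 (exp w)"
    unfolding K_def x_def by (simp add: field_simps)
  finally have "(\<lambda>n. (ln_sum_aux (real n * x) - ln (real n * x) / 2 - ln (2 * pi) / 2) - (harm n - ln (real n)) / 2 + (ln (2 * pi) / 2 + w / 2 + 1/2)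
       - x * (real n * R1 (real n * x)) + x * (\<Sum>k<n. R1 (real (Suc k) * x)) - exp (- real n)) \<longlonglongrightarrow> K + w / 2 + exp w * S1 (exp w)" .
  moreover have "\<forall>\<^sub>F n in sequentially. (ln_sum_aux (real n * x) - ln (real n * x) / 2 - ln (2 * pi) / 2) - (harm n - ln (real n)) / 2 + (ln (2 * pi) / 2 + w / 2 + 1/2)
       - x * (real n * R1 (real n * x)) + x * (\<Sum>k<n. R1 (real (Suc k) * x)) - exp (- real n) = G n"
    using Gval eventually_gt_at_top[of 0]
  proof eventually_elim
    case (elim n)
    have "ln (real n * x) = ln (real n) + w" using elim by (simp add: ln_mult x_def)
    then show ?case unfolding elim(1)[symmetric] by (simp add: field_simps)
  qed
  ultimately have L: "G \<longlonglongrightarrow> K + w / 2 + exp w * S1 (exp w)" by (rule Lim_transform_eventually)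
  have ev: "\<forall>\<^sub>F n in sequentially. - real n \<le> y \<and> y \<le> ln (real n) + w" for y
  proof (rule eventually_conj)
    show "\<forall>\<^sub>F n in sequentially. - real n \<le> y"
      using eventually_ge_at_top[of "nat \<lceil>- y\<rceil>"] by eventually_elim linarith
    have "filterlim (\<lambda>n. ln (real n) + w) at_top sequentially" by real_asymp
    then show "\<forall>\<^sub>F n in sequentially. y \<le> ln (real n) + w" by (simp add: filterlim_at_top)
  qed
  have "(LBINT y:UNIV. f y) = K + w / 2 + exp w * S1 (exp w)"
  proof (rule set_lebesgue_integral_exhaust[of _ _ "\<lambda>n. {- real n..ln (real n) + w}", OF _ _ _ _ _ L])
    show "set_integrable lborel UNIV f" using f_int by (simp add: set_integrable_def)
    show "\<forall>\<^sub>F n in sequentially. (f has_integral G n) {- real n..ln (real n) + w}"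
      using eventually_gt_at_top[of 0] ev[of 0]
    proof eventually_elim
      case (elim n)
      then have "- real n \<le> ln (real n) + w" by linarith
      then have "((\<lambda>y. x * frac (1 * exp y) * frac ((1 * exp y) / x) / (1 * exp y)\<^sup>2 * (1 * exp y)) has_integral (\<Phi> (1 * exp (ln (real n) + w)) - \<Phi> (1 * exp (- real n)))) {- real n..ln (real n) + w}"
        by (intro pw_deriv_integral_exp[OF \<Phi>]) auto
      moreover have "exp (ln (real n) + w) = real n * x" using elim by (simp add: exp_add x_def)
      ultimately show ?case unfolding f_eq[abs_def] G_def by (simp only: mult_1)
    qed
  qed (use ev in auto)
  then show ?thesis using f_val by (simp add: set_lebesgue_integral_def)
qed

section \<open>Convolution with the Laplace kernel\<close>

lemma has_integral_series:
  fixes u :: "nat \<Rightarrow> real \<Rightarrow> real"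
  assumes cont: "\<And>k. continuous_on {a..b} (u k)" and bd: "\<And>k y. y \<in> {a..b} \<Longrightarrow> \<bar>u k y\<bar> \<le> M k" and M: "summable M"
    and int: "\<And>k. (u k has_integral v k) {a..b}"
  shows "((\<lambda>y. \<Sum>k. u k y) has_integral (\<Sum>k. v k)) {a..b}"
proof -
  have "uniform_limit {a..b} (\<lambda>n y. \<Sum>k<n. u k y) (\<lambda>y. \<Sum>k. u k y) sequentially"
    by (rule Weierstrass_m_test[OF _ M]) (use bd in auto)
  then obtain I J where I: "\<And>n. ((\<lambda>y. \<Sum>k<n. u k y) has_integral I n) {a..b}"
    and J: "((\<lambda>y. \<Sum>k. u k y) has_integral J) {a..b}" and IJ: "I \<longlonglongrightarrow> J"
    by (rule uniform_limit_integral) (auto intro!: continuous_on_sum cont)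
  have "I = (\<lambda>n. \<Sum>k<n. v k)"
    by (rule ext, rule has_integral_unique[OF I]) (intro has_integral_sum int finite_lessThan)
  with IJ have "v sums J" by (simp only: sums_def)
  then show ?thesis using J by (simp add: sums_iff)
qed

lemma pw_deriv_continuous_exp:
  assumes "pw_deriv E f f'" "c > 0"
  shows "continuous_on A (\<lambda>y. f (c * exp y))"
  by (rule continuous_on_compose2[of "{0<..}" f]) (use assms in \<open>auto simp: pw_deriv_def intro!: continuous_intros\<close>)

lemma R1_exp_bound:
  assumes "y \<ge> a"
  shows "\<bar>R1 (real (Suc k) * exp y)\<bar> \<le> 1 / 8 / (real (Suc k) * exp a)\<^sup>2"
proof -
  have "\<bar>R1 (real (Suc k) * exp y)\<bar> \<le> 1 / 8 / (real (Suc k) * exp y)\<^sup>2" by (rule R1_bound) simp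
  also have "\<dots> \<le> 1 / 8 / (real (Suc k) * exp a)\<^sup>2"
    using assms by (intro divide_left_mono power_mono mult_left_mono) auto
  finally show ?thesis .
qed

section \<open>Antiderivatives of the series on the logarithmic scale\<close>

definition T_sum :: "real \<Rightarrow> real" where
  "T_sum y = (\<Sum>k. T_aux (real (Suc k) * exp y))"

text \<open>Minus \<open>exp y\<close> times this series is an antiderivative of
  \<open>exp y * S1 (exp y)\<close>, just as minus \<open>T_sum\<close> is one of
  \<open>S1 (exp y)\<close>.\<close>

definition V_sum :: "real \<Rightarrow> real" where
  "V_sum y = (\<Sum>k. T_aux (real (Suc k) * exp y) - R2 (real (Suc k) * exp y))"

lemma summable_T: "summable (\<lambda>k. T_aux (real (Suc k) * exp y))"
  by (rule summable_of_sq_bound(2)[OF T_aux_bound exp_gt_zero])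

lemma summable_R2: "summable (\<lambda>k. R2 (real (Suc k) * exp y))"
  by (rule summable_of_sq_bound(2)[OF R2_bound exp_gt_zero])

lemma summable_R1: "summable (\<lambda>k. R1 (real (Suc k) * exp y))"
  by (rule summable_of_sq_bound(2)[OF R1_bound exp_gt_zero])

lemma S1_has_integral:
  assumes "a \<le> b"
  shows "((\<lambda>y. S1 (exp y)) has_integral (T_sum a - T_sum b)) {a..b}"
proof -
  have "((\<lambda>y. \<Sum>k. R1 (real (Suc k) * exp y)) has_integral (\<Sum>k. T_aux (real (Suc k) * exp a) - T_aux (real (Suc k) * exp b))) {a..b}"
  proof (rule has_integral_series)
    show "continuous_on {a..b} (\<lambda>y. R1 (real (Suc k) * exp y))" for k
      by (rule pw_deriv_continuous_exp[OF R1_pw]) simp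
    show "summable (\<lambda>k. 1 / 8 / (real (Suc k) * exp a)\<^sup>2)" by (rule summable_inverse_Suc_sq)
    show "\<bar>R1 (real (Suc k) * exp y)\<bar> \<le> 1 / 8 / (real (Suc k) * exp a)\<^sup>2" if "y \<in> {a..b}" for k y
      using that by (intro R1_exp_bound) auto
    show "((\<lambda>y. R1 (real (Suc k) * exp y)) has_integral (T_aux (real (Suc k) * exp a) - T_aux (real (Suc k) * exp b))) {a..b}" for k
    proof -
      have "((\<lambda>y. - (R1 (real (Suc k) * exp y) / (real (Suc k) * exp y)) * (real (Suc k) * exp y)) has_integral (T_aux (real (Suc k) * exp b) - T_aux (real (Suc k) * exp a))) {a..b}"
        by (rule pw_deriv_integral_exp[OF T_aux_pw _ assms]) simp
      from has_integral_neg[OF this] show ?thesis by (simp del: of_nat_Suc)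
    qed
  qed
  then show ?thesis unfolding S1_def T_sum_def by (simp only: suminf_diff[OF summable_T summable_T])
qed

text \<open>The product \<open>t * T_aux t\<close> has derivative \<open>T_aux t - R1 t\<close>, and
  \<open>t * R2 t\<close> has derivative \<open>T_aux t\<close>; in the difference
  \<open>T_aux\<close> drops out.\<close>

lemma W_pw: "pw_deriv (range real) (\<lambda>t. t * (T_aux t - R2 t)) (\<lambda>t. - R1 t)"
proof -
  have s: "pw_deriv {} (\<lambda>t::real. t) (\<lambda>t. 1)" by (rule pw_deriv_smooth) auto
  have "pw_deriv ({} \<union> range real \<union> range real) (\<lambda>t. t * T_aux t - t * R2 t) (\<lambda>t. (1 * T_aux t + - (R1 t / t) * t) - T_aux t)"
    by (intro pw_deriv_diff pw_deriv_mult s T_aux_pw R2_pw)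
  then show ?thesis unfolding Un_empty_left Un_absorb
    by (rule pw_deriv_cong) (auto simp: algebra_simps)
qed

lemma exp_S1_has_integral:
  assumes "a \<le> b"
  shows "((\<lambda>y. exp y * S1 (exp y)) has_integral (exp a * V_sum a - exp b * V_sum b)) {a..b}"
proof -
  let ?W = "\<lambda>k y. exp y * (T_aux (real (Suc k) * exp y) - R2 (real (Suc k) * exp y))"
  have "((\<lambda>y. \<Sum>k. exp y * R1 (real (Suc k) * exp y)) has_integral (\<Sum>k. ?W k a - ?W k b)) {a..b}"
  proof (rule has_integral_series)
    show "continuous_on {a..b} (\<lambda>y. exp y * R1 (real (Suc k) * exp y))" for k
      by (intro continuous_intros pw_deriv_continuous_exp[OF R1_pw]) simp
    show "summable (\<lambda>k. exp b * (1 / 8 / (real (Suc k) * exp a)\<^sup>2))" by (intro summable_mult summable_inverse_Suc_sq)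
    show "\<bar>exp y * R1 (real (Suc k) * exp y)\<bar> \<le> exp b * (1 / 8 / (real (Suc k) * exp a)\<^sup>2)" if "y \<in> {a..b}" for k y
    proof -
      have "exp y * \<bar>R1 (real (Suc k) * exp y)\<bar> \<le> exp b * (1 / 8 / (real (Suc k) * exp a)\<^sup>2)"
        using that by (intro mult_mono R1_exp_bound) auto
      then show ?thesis by (simp only: abs_mult abs_exp_cancel)
    qed
    show "((\<lambda>y. exp y * R1 (real (Suc k) * exp y)) has_integral (?W k a - ?W k b)) {a..b}" for k
    proof -
      let ?n = "real (Suc k)"
      have hi: "((\<lambda>y. - R1 (?n * exp y) * (?n * exp y)) has_integral (?n * exp b * (T_aux (?n * exp b) - R2 (?n * exp b)) - ?n * exp a * (T_aux (?n * exp a) - R2 (?n * exp a)))) {a..b}"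
        by (rule pw_deriv_integral_exp[OF W_pw _ assms]) simp
      have alg: "- 1 / n * (n * p * X - n * q * Y) = q * Y - p * X" "- 1 / n * (- X * (n * p)) = p * X"
        if "n \<noteq> 0" for n p q X Y :: real using that by (simp_all add: field_simps)
      have n0: "?n \<noteq> 0" by simp
      from has_integral_mult_right[OF hi, of "- 1 / ?n"] show ?thesis
        by (simp only: alg[OF n0])
    qed
  qed
  also have "(\<lambda>y. \<Sum>k. exp y * R1 (real (Suc k) * exp y)) = (\<lambda>y. exp y * S1 (exp y))"
    unfolding S1_def by (intro ext suminf_mult summable_R1)
  also have "(\<Sum>k. ?W k a - ?W k b) = exp a * V_sum a - exp b * V_sum b"
  proof -
    have s: "summable (\<lambda>k. T_aux (real (Suc k) * exp y) - R2 (real (Suc k) * exp y))" for y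
      by (intro summable_diff summable_T summable_R2)
    show ?thesis unfolding V_sum_def
      by (simp only: suminf_mult[OF s, symmetric] suminf_diff[OF summable_mult[OF s] summable_mult[OF s]])
  qed
  finally show ?thesis .
qed

text \<open>The Laplace kernel splits the convolution at \<open>w\<close>. After multiplication by
  \<open>exp (w / 2)\<close>, the integrand to the left of \<open>w\<close> is
  \<open>q_corr y\<close>, and to the right it is
  \<open>exp w * exp (- y) * q_corr y\<close>.\<close>

definition q_corr :: "real \<Rightarrow> real" where
  "q_corr y = exp (y / 2) * frac_corr y"

lemma q_corr_eq: "q_corr y = K + y / 2 + exp y * S1 (exp y)"
  unfolding q_corr_def by (rule frac_corr_series)

lemma q_corr_reflect: "exp (- y) * q_corr y = q_corr (- y)"
  unfolding q_corr_def frac_corr_even mult.assoc[symmetric] exp_add[symmetric] by simp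

lemma K1_eq: "K1 = K + 1/2"
  by (simp add: K1_def K_def field_simps)

lemma q_corr_has_integral:
  assumes "a \<le> b"
  shows "(q_corr has_integral ((K * b + b\<^sup>2 / 4 - exp b * V_sum b) - (K * a + a\<^sup>2 / 4 - exp a * V_sum a))) {a..b}"
proof -
  have "((\<lambda>y. K + y / 2) has_integral ((K * b + b\<^sup>2 / 4) - (K * a + a\<^sup>2 / 4))) {a..b}"
    by (rule fundamental_theorem_of_calculus[OF assms])
       (auto intro!: derivative_eq_intros simp: has_real_derivative_iff_has_vector_derivative[symmetric])
  from has_integral_add[OF this exp_S1_has_integral[OF assms]] show ?thesis
    by (simp add: q_corr_eq[abs_def] algebra_simps)
qed

lemma exp_q_corr_has_integral:
  assumes "a \<le> b"
  shows "((\<lambda>y. exp (- y) * q_corr y) has_integral ((exp (- a) * (K1 + a / 2) + T_sum a) - (exp (- b) * (K1 + b / 2) + T_sum b))) {a..b}"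
proof -
  \<comment> \<open>Integrating \<open>y / 2\<close> by parts against \<open>exp (- y)\<close> adds
    \<open>1/2\<close> to \<open>K\<close>, which is how \<open>K1\<close> arises.\<close>
  have "((\<lambda>y. exp (- y) * (K + y / 2)) has_integral (- exp (- b) * (K1 + b / 2) - - exp (- a) * (K1 + a / 2))) {a..b}"
    by (rule fundamental_theorem_of_calculus[OF assms])
       (auto intro!: derivative_eq_intros simp: has_real_derivative_iff_has_vector_derivative[symmetric] K1_eq algebra_simps add_divide_distrib diff_divide_distrib)
  from has_integral_add[OF this S1_has_integral[OF assms]] have
    "((\<lambda>y. exp (- y) * (K + y / 2) + S1 (exp y)) has_integral ((exp (- a) * (K1 + a / 2) + T_sum a) - (exp (- b) * (K1 + b / 2) + T_sum b))) {a..b}"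
    by (simp add: algebra_simps)
  moreover have "exp (- y) * q_corr y = exp (- y) * (K + y / 2) + S1 (exp y)" for y
  proof -
    have "exp (- y) * (exp y * S1 (exp y)) = S1 (exp y)" by (simp add: mult.assoc[symmetric] exp_add[symmetric])
    then show ?thesis unfolding q_corr_eq by (simp add: distrib_left)
  qed
  ultimately show ?thesis by (simp only:)
qed

lemma T_sum_limit: "(\<lambda>n. T_sum (real n)) \<longlonglongrightarrow> 0"
proof (rule Lim_null_comparison)
  define B where "B = (\<Sum>k. 1 / 16 / (real (Suc k) * 1)\<^sup>2)"
  show "\<forall>\<^sub>F n in sequentially. norm (T_sum (real n)) \<le> B * exp (- 2 * real n)"
  proof (rule always_eventually, rule allI)
    fix n :: nat
    have sb: "summable (\<lambda>k. 1 / 16 / (real (Suc k) * exp (real n))\<^sup>2)" by (rule summable_inverse_Suc_sq)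
    have "\<bar>T_sum (real n)\<bar> \<le> (\<Sum>k. \<bar>T_aux (real (Suc k) * exp (real n))\<bar>)"
      unfolding T_sum_def by (rule summable_rabs[OF summable_of_sq_bound(1)[OF T_aux_bound]]) simp_all
    also have "\<dots> \<le> (\<Sum>k. 1 / 16 / (real (Suc k) * exp (real n))\<^sup>2)"
      by (intro suminf_le T_aux_bound sb summable_of_sq_bound(1)[OF T_aux_bound]) simp_all
    also have "\<dots> = (\<Sum>k. exp (- 2 * real n) * (1 / 16 / (real (Suc k) * 1)\<^sup>2))"
    proof (intro suminf_cong)
      fix k
      have "exp (- 2 * real n) = 1 / (exp (real n))\<^sup>2"
        by (simp add: power2_eq_square exp_minus inverse_eq_divide flip: exp_add)
      then show "1 / 16 / (real (Suc k) * exp (real n))\<^sup>2 = exp (- 2 * real n) * (1 / 16 / (real (Suc k) * 1)\<^sup>2)"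
        by (simp only: power_mult_distrib) (simp add: mult.commute)
    qed
    also have "\<dots> = exp (- 2 * real n) * B"
      unfolding B_def by (rule suminf_mult[OF summable_inverse_Suc_sq])
    finally show "norm (T_sum (real n)) \<le> B * exp (- 2 * real n)" by (simp add: mult.commute)
  qed
  have "(\<lambda>n. B * exp (- 2 * real n)) \<longlonglongrightarrow> B * 0" by (intro tendsto_mult tendsto_const) real_asymp
  then show "(\<lambda>n. B * exp (- 2 * real n)) \<longlonglongrightarrow> 0" by simp
qed

theorem frac_corr_convolution:
  "exp (w / 2) * (LBINT y. exp (- (1/2 * \<bar>w - y\<bar>)) * frac_corr y) = K2 + K1 * w + w\<^sup>2 / 4 + exp w * S2 (exp w)"
proof -
  define P where "P y = K * y + y\<^sup>2 / 4 - exp y * V_sum y" for y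
  define F where "F y = exp (- y) * (K1 + y / 2) + T_sum y" for y
  define f where "f y = exp (w / 2) * (exp (- (1/2 * \<bar>w - y\<bar>)) * frac_corr y)" for y
  have Pi: "(q_corr has_integral (P b - P a)) {a..b}" if "a \<le> b" for a b
    unfolding P_def by (rule q_corr_has_integral[OF that])
  have Fi: "((\<lambda>y. exp (- y) * q_corr y) has_integral (F a - F b)) {a..b}" if "a \<le> b" for a b
    unfolding F_def by (rule exp_q_corr_has_integral[OF that])
  have f1: "f y = q_corr y" if "y \<le> w" for y
  proof -
    have "exp (w / 2) * exp (- (1/2 * \<bar>w - y\<bar>)) = exp (y / 2)"
      unfolding exp_add[symmetric] using that by (simp add: field_simps)
    then show ?thesis unfolding f_def q_corr_def mult.assoc[symmetric] by (simp only:)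
  qed
  have f2: "f y = exp w * (exp (- y) * q_corr y)" if "w \<le> y" for y
  proof -
    have "exp (w / 2) * exp (- (1/2 * \<bar>w - y\<bar>)) = exp w * (exp (- y) * exp (y / 2))"
      unfolding exp_add[symmetric] using that by (simp add: field_simps)
    then show ?thesis unfolding f_def q_corr_def mult.assoc[symmetric] by (simp only: mult.assoc[symmetric])
  qed
  \<comment> \<open>The value \<open>P (- n)\<close> contains \<open>V_sum\<close> far to the left,
    where the inverse-square bounds on its terms blow up. Reflecting the interval by evenness
    expresses it by \<open>F n\<close>, in which \<open>T_sum\<close> is evaluated far to the right
    and tends to 0.\<close>
  have symm: "P 0 - P (- real n) = F 0 - F (real n)" for n
  proof (rule has_integral_unique)
    show "(q_corr has_integral (P 0 - P (- real n))) {- real n..- 0}" using Pi[of "- real n" 0] by simp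
    have "((\<lambda>y. q_corr (- y)) has_integral (F 0 - F (real n))) {0..real n}"
      using Fi[of 0 "real n"] by (simp add: q_corr_reflect)
    then have "((\<lambda>y. q_corr (- y)) has_integral (F 0 - F (real n))) {- (- 0)..- (- real n)}" by simp
    then show "(q_corr has_integral (F 0 - F (real n))) {- real n..- 0}"
      by (subst (asm) has_integral_reflect_real) simp
  qed
  have [measurable]: "frac_corr \<in> borel_measurable borel"
    using frac_corr_continuous by (rule borel_measurable_continuous_onI)
  have fi: "integrable lborel f"
    unfolding f_def
  proof (rule integrable_mult_right, rule Bochner_Integration.integrable_bound[OF frac_corr_integrable_Fourier(1)])
    show "AE y in lborel. norm (exp (- (1/2 * \<bar>w - y\<bar>)) * frac_corr y) \<le> norm (frac_corr y)"
      by (auto simp: abs_mult mult_left_le_one_le)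
  qed measurable
  define G where "G n = (P w - (F (real n) + P 0 - F 0)) + exp w * (F w - F (real n))" for n :: nat
  have ev: "\<forall>\<^sub>F n in sequentially. - real n \<le> y \<and> y \<le> real n" for y
    using eventually_ge_at_top[of "nat \<lceil>\<bar>y\<bar>\<rceil>"] by eventually_elim linarith
  have Gi: "\<forall>\<^sub>F n in sequentially. (f has_integral G n) {- real n..real n}"
    using ev[of w]
  proof eventually_elim
    case (elim n)
    have "(f has_integral (P w - P (- real n))) {- real n..w}"
      by (rule has_integral_eq[OF _ Pi]) (use elim f1 in auto)
    moreover have "(f has_integral (exp w * (F w - F (real n)))) {w..real n}"
      by (rule has_integral_eq[OF _ has_integral_mult_right[OF Fi]]) (use elim f2 in auto)
    ultimately have "(f has_integral ((P w - P (- real n)) + exp w * (F w - F (real n)))) {- real n..real n}"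
      by (intro has_integral_combine[of _ w]) (use elim in auto)
    moreover have "P (- real n) = F (real n) + P 0 - F 0" using symm[of n] by linarith
    ultimately show ?case unfolding G_def by (simp only:)
  qed
  have F0: "(\<lambda>n. F (real n)) \<longlonglongrightarrow> 0"
  proof -
    have "(\<lambda>n. exp (- real n) * (K1 + real n / 2)) \<longlonglongrightarrow> 0" by real_asymp
    from tendsto_add[OF this T_sum_limit] show ?thesis by (simp add: F_def)
  qed
  have "G \<longlonglongrightarrow> (P w - (0 + P 0 - F 0)) + exp w * (F w - 0)"
    unfolding G_def by (intro tendsto_intros F0)
  then have L: "G \<longlonglongrightarrow> (P w - P 0 + F 0) + exp w * F w" by (simp add: algebra_simps)
  have "(LBINT y:UNIV. f y) = (P w - P 0 + F 0) + exp w * F w"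
  proof (rule set_lebesgue_integral_exhaust[of _ _ "\<lambda>n. {- real n..real n}", OF _ _ _ _ Gi L])
    show "set_integrable lborel UNIV f" using fi by (simp add: set_integrable_def)
  qed (use ev in auto)
  then have "exp (w / 2) * (LBINT y. exp (- (1/2 * \<bar>w - y\<bar>)) * frac_corr y) = (P w - P 0 + F 0) + exp w * F w"
    unfolding f_def set_lebesgue_integral_def by simp
  also have "\<dots> = K2 + K1 * w + w\<^sup>2 / 4 + exp w * S2 (exp w)"
  proof -
    have TR: "T_sum w - V_sum w = S2 (exp w)"
      unfolding T_sum_def V_sum_def S2_def
      by (subst suminf_diff[OF summable_T summable_diff[OF summable_T summable_R2]]) simp
    have "(\<lambda>k. T_aux (real (Suc k) * exp 0) + (T_aux (real (Suc k) * exp 0) - R2 (real (Suc k) * exp 0))) sums (T_sum 0 + V_sum 0)"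
      unfolding T_sum_def V_sum_def
      by (intro sums_add summable_sums summable_T summable_diff summable_R2)
    then have "(\<lambda>k. 2 * T_aux (real (Suc k)) - R2 (real (Suc k))) sums (T_sum 0 + V_sum 0)"
      by (simp add: algebra_simps)
    \<comment> \<open>Two boundary values at 0 survive, one from each antiderivative. They add up to
      \<open>T_aux k + (T_aux k - R2 k)\<close>, which explains the combination summed in
      \<open>K2_series\<close>.\<close>
    then have TV: "T_sum 0 + V_sum 0 = K2 - 2 * K1" using K2_series by (rule sums_unique2)
    have "exp w * exp (- w) = 1" by (simp flip: exp_add)
    then have "exp w * F w = K1 + w / 2 + exp w * T_sum w"
      unfolding F_def distrib_left mult.assoc[symmetric] by simp
    then have "(P w - P 0 + F 0) + exp w * F w = K * w + w\<^sup>2 / 4 + w / 2 + 2 * K1 + (T_sum 0 + V_sum 0) + exp w * (T_sum w - V_sum w)"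
      by (simp add: P_def F_def algebra_simps)
    also have "\<dots> = K2 + K1 * w + w\<^sup>2 / 4 + exp w * S2 (exp w)"
      unfolding TR TV by (simp add: K1_eq algebra_simps)
    finally show ?thesis .
  qed
  finally show ?thesis .
qed

theorem theorem2p1:
  fixes u v :: real
  assumes "u > 0" and "v > 0"
  shows
    "(integrable lborel (\<lambda>t. gram_integrand 1 u v (Complex (1/2) t)) \<and>
      summable (\<lambda>k. \<bar>R1 (real (Suc k) * (v / u))\<bar>) \<and>
      gram_kernel 1 u v =
        of_real (1 / v * (K + 1/2 * ln (v / u)) + 1 / u * S1 (v / u))) \<and>
     (integrable lborel (\<lambda>t. gram_integrand 2 u v (Complex (1/2) t)) \<and>
      summable (\<lambda>k. \<bar>R2 (real (Suc k) * (v / u))\<bar>) \<and>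
      gram_kernel 2 u v =
        of_real (1 / v * (K2 + K1 * ln (v / u) + 1/4 * (ln (v / u))\<^sup>2) + 1 / u * S2 (v / u)))"
proof -
  define w where "w = ln (v / u)"
  have x: "v / u > 0" using assms by simp
  have ew: "exp w = v / u" using x by (simp add: w_def)
  \<comment> \<open>Since \<open>exp (w / 2)\<close> equals \<open>v / sqrt (u * v)\<close>, the
    symmetric prefactor becomes \<open>1 / v\<close> times the weight \<open>exp (w / 2)\<close> of
    the series formulas. The \<open>exp w\<close> in front of the series then turns
    \<open>1 / v\<close> into \<open>1 / u\<close>.\<close>
  have sq: "A / sqrt (u * v) = 1 / v * (exp (w / 2) * A)" for A
  proof -
    have "exp (w / 2) = sqrt (v / u)"
    proof -
      have "(exp (w / 2))\<^sup>2 = v / u" by (simp add: power2_eq_square ew flip: exp_add)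
      then show ?thesis by (metis exp_ge_zero real_sqrt_unique)
    qed
    also have "\<dots> = v / sqrt (u * v)"
      using assms by (simp add: real_sqrt_divide real_sqrt_mult field_simps)
    finally show ?thesis using assms by simp
  qed
  have e1: "frac_corr w / sqrt (u * v) = 1 / v * (K + 1/2 * w) + 1 / u * S1 (v / u)"
    unfolding sq frac_corr_series ew using assms by (simp add: field_simps)
  have e2: "(LBINT y. exp (- (1/2 * \<bar>w - y\<bar>)) * frac_corr y) / sqrt (u * v) = 1 / v * (K2 + K1 * w + 1/4 * w\<^sup>2) + 1 / u * S2 (v / u)"
    unfolding sq frac_corr_convolution ew using assms by (simp add: field_simps)
  show ?thesis
    using gram_1_eq_frac_corr[OF assms] gram_2_eq_frac_corr[OF assms]
      summable_of_sq_bound(1)[OF R1_bound x] summable_of_sq_bound(1)[OF R2_bound x] e1 e2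
    unfolding w_def by (simp only: simp_thms)
qed

end
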